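(* Let $V\in\mathcal P^{s,p}_q(\mathbb R^n)$ and $g\in W^{s,p}(\mathbb R^n)$, where $q>\frac{n}{ps}>1$, $p>1$, $s\in(0,1)$, and let $B_{2r}(x_0)\subset\Omega$. If $u\in \mathrm Y^{s,p}_g(\Omega)^-$ is a weak subsolution of the nonlocal equation $\mathrm L^p_K u+V|u|^{p-2}u=0$ in $\Omega$, $u=g$ in $\mathbb R^n\setminus\Omega$, then there is a constant $C_0>0$ depending only on $n,s,p,\lambda,\Lambda$ and $\Omega$ such that $$\sup_{B_r(x_0)}u\le\delta\,\mathcal T_r(u_+;x_0)+C_0\,\delta^{-\frac{(p-1)n}{sp^2}}\left(\frac1{|B_{2r}(x_0)|}\int_{B_{2r}(x_0)}u_+^p\,dx\right)^{1/p}$$ for any $\delta\in(0,1]$.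
   Context: Throughout, $\Omega\subset\mathbb R^n$ is a bounded domain with Lipschitz boundary, $f_+=\max\{f,0\}$, $f_-=\max\{-f,0\}$, and $B_r(x_0)$ is the ball of radius $r$ centered at $x_0$. Kernel and operator: $K$ is a positive kernel with $\frac{c_{n,p,s}\lambda}{|y|^{n+ps}}\le K(y)=K(-y)\le\frac{c_{n,p,s}\Lambda}{|y|^{n+ps}}$ for $y\in\mathbb R^n\setminus\{0\}$, where $0<\lambda\le\Lambda$ and $c_{n,p,s}=\frac{\Gamma(\frac{n+p}{2})\,p\,(1-s)}{\pi^{(n-1)/2}\Gamma(\frac{p+1}{2})}$. Set $H_p(t)=|t|^{p-2}t$, $d_K(x,y)=K(x-y)\,dx\,dy$, and $\mathrm L^p_Ku(x)=\mathrm{p.v.}\int_{\mathbb R^n}H_p(u(x)-u(y))K(x-y)\,dy$. Weights: a weight is a locally integrable function on $\mathbb R^n$ with values in $[0,\infty)$ a.e. A pair of weights $(\upsilon,\omega)$ is in the $(A_1,A_1)$-Muckenhoupt class if $\sup_Q\left(\frac1{|Q|}\int_Q\upsilon\,dy\right)\|\omega^{-1}\|_{L^\infty(Q)}<\infty$ (supremum over all cubes $Q\subset\mathbb R^n$), and $\omega\in A_1$ if $(\omega,\omega)\in(A_1,A_1)$. Potentials: for $q>\frac n{ps}>1$, $\mathcal P^{s,p}_q(\mathbb R^n)$ is the class of all potentials $V=V_+-V_-$ such that (i) $V_-\in L^1_{\rm loc}(\mathbb R^n)$; (ii) $V_+\in L^q_{\rm loc}(\mathbb R^n)$; (iii) there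 is an a.e. positive bounded function $b$ on $\mathbb R^n$ such that $V_+/b\in L^q_{\rm loc}(\mathbb R^n)$ and, for all $i\in\mathbb N$, with $V_+^{b,i}:=\frac{\max\{b,1/i\}}{b}V_+$, one has $(V_-,V_+^{b,i})\in(A_1,A_1)$ and $V_+^{b,i}\in A_1$. Function spaces: $\mathrm X^{s,p}(\Omega)$ is the space of measurable $v:\mathbb R^n\to\mathbb R$ with $v|_\Omega\in L^p(\Omega)$ and $\iint_{\mathbb R^{2n}\setminus(\Omega^c\times\Omega^c)}\frac{|v(x)-v(y)|^p}{|x-y|^{n+ps}}dx\,dy<\infty$; $\mathrm X^{s,p}_0(\Omega)=\{v\in\mathrm X^{s,p}(\Omega):v=0\text{ a.e. in }\mathbb R^n\setminus\Omega\}$. $L^p_V(\Omega)$ is the class of measurable $u:\mathbb R^n\to\mathbb R$ with $\int_\Omega|u|^pV_+\,dy<\infty$ and $\int_\Omega|u|^pV_-\,dy<\infty$. $\mathrm Y^{s,p}(\Omega)=\mathrm X^{s,p}(\Omega)\cap L^p_V(\Omega)$, $\mathrm Y^{s,p}_0(\Omega)=\mathrm X^{s,p}_0(\Omega)\cap L^p_V(\Omega)$, $\mathrm Y^{s,p}_g(\Omega)^\pm=\{u\in\mathrm Y^{s,p}(\Omega):(g-u)_\pm\in\mathrm Y^{s,p}_0(\Omega)\}$, $\mathrm Y^{s,p}_g(\Omega)=\mathrm Y^{s,p}_g(\Omega)^+\cap\mathrm Y^{s,p}_g(\Omega)^-$. $W^{s,p}(\mathbb R^n)$ is the usual fractional Sobolev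 space. Weak (sub/super)solutions: $u\in\mathrm Y^{s,p}_g(\Omega)^-$ (resp. $u\in\mathrm Y^{s,p}_g(\Omega)^+$) is a weak subsolution (resp. weak supersolution) if $$\iint_{\mathbb R^n\times\mathbb R^n}H_p(u(x)-u(y))(\varphi(x)-\varphi(y))\,d_K(x,y)+\int_{\mathbb R^n}V|u|^{p-2}u\,\varphi\,dx\le0\ (\text{resp. }\ge0)$$ for all nonnegative $\varphi\in\mathrm Y^{s,p}_0(\Omega)$. A weak solution is both a weak subsolution and a weak supersolution (equality for all $\varphi\in\mathrm Y^{s,p}_0(\Omega)$). Nonlocal tail: for $B_r(x_0)\subset\Omega$, $\mathcal T_r(u;x_0)=\left(\frac{ps}{|S^{n-1}|}r^{ps}\int_{\mathbb R^n\setminus B_r(x_0)}\frac{|u(y)|^{p-1}}{|y-x_0|^{n+ps}}dy\right)^{\frac1{p-1}}$, where $|S^{n-1}|$ is the surface measure of the unit sphere. *)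

theory Defs
  imports "HOL-Analysis.Analysis" "HOL-Probability.Essential_Supremum"
begin

text \<open>Functions on the whole space are real-valued and Lebesgue measurable, and double integrals
  are taken with respect to Lebesgue measure on the product space. The dimension \<open>n\<close> is
  \<open>CARD('n)\<close>.\<close>

definition pos_part :: "('a \<Rightarrow> real) \<Rightarrow> 'a \<Rightarrow> real" where
  "pos_part f = (\<lambda>x. max (f x) 0)"

definition neg_part :: "('a \<Rightarrow> real) \<Rightarrow> 'a \<Rightarrow> real" where
  "neg_part f = (\<lambda>x. max (- f x) 0)"

subsection \<open>Lipschitz domains\<close>

text \<open>Near every boundary point, in a suitable rotated coordinate system with vertical unit
  vector \<open>e\<close>, the set is the part above the graph of a Lipschitz function \<open>\<gamma>\<close> defined on the
  hyperplane orthogonal to \<open>e\<close>.\<close>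

definition lipschitz_boundary :: "'a::euclidean_space set \<Rightarrow> bool" where
  "lipschitz_boundary \<Omega> \<longleftrightarrow>
     (\<forall>z\<in>frontier \<Omega>. \<exists>e \<gamma> L \<rho>. norm e = 1 \<and> \<rho> > 0 \<and> L-lipschitz_on {v. v \<bullet> e = 0} \<gamma> \<and>
        \<Omega> \<inter> ball z \<rho> = {x \<in> ball z \<rho>. x \<bullet> e > (\<gamma> (x - (x \<bullet> e) *\<^sub>R e) :: real)})"

definition bounded_lipschitz_domain :: "'a::euclidean_space set \<Rightarrow> bool" where
  "bounded_lipschitz_domain \<Omega> \<longleftrightarrow>
     open \<Omega> \<and> connected \<Omega> \<and> \<Omega> \<noteq> {} \<and> bounded \<Omega> \<and> lipschitz_boundary \<Omega>"

subsection \<open>Kernels\<close>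

definition kernel_const :: "real \<Rightarrow> real \<Rightarrow> real \<Rightarrow> real" where
  "kernel_const n p s =
     Gamma ((n + p) / 2) * p * (1 - s) / (pi powr ((n - 1) / 2) * Gamma ((p + 1) / 2))"

definition admissible_kernel ::
    "real \<Rightarrow> real \<Rightarrow> real \<Rightarrow> real \<Rightarrow> (real ^ 'n \<Rightarrow> real) \<Rightarrow> bool" where
  "admissible_kernel s p lam Lam K \<longleftrightarrow>
     K \<in> borel_measurable lebesgue \<and>
     (\<forall>y. y \<noteq> 0 \<longrightarrow>
        kernel_const (real CARD('n)) p s * lam / norm y powr (real CARD('n) + p * s) \<le> K y \<and>
        K y = K (- y) \<and>
        K y \<le> kernel_const (real CARD('n)) p s * Lam / norm y powr (real CARD('n) + p * s))"

definition H :: "real \<Rightarrow> real \<Rightarrow> real" where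
  "H p t = \<bar>t\<bar> powr (p - 2) * t"

subsection \<open>Weights and potentials\<close>

definition Lloc :: "real \<Rightarrow> ('a::euclidean_space \<Rightarrow> real) set" where
  "Lloc q = {f \<in> borel_measurable lebesgue.
     \<forall>C. compact C \<longrightarrow> set_integrable lebesgue C (\<lambda>x. \<bar>f x\<bar> powr q)}"

definition weight :: "('a::euclidean_space \<Rightarrow> real) \<Rightarrow> bool" where
  "weight w \<longleftrightarrow> w \<in> Lloc 1 \<and> (AE x in lebesgue. 0 \<le> w x)"

definition cubes :: "(real ^ 'n) set set" where
  "cubes = {cbox a (a + (\<chi> i. l)) | a l. l > 0}"

text \<open>The supremum is taken in the extended nonnegative reals, where \<open>inverse 0 = \<infinity>\<close> and
  \<open>0 * \<infinity> = 0\<close>; so a weight \<open>w\<close> vanishing on a non-null part of \<open>Q\<close> has an infinite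
  \<open>L\<^sup>\<infinity>\<close>-norm of \<open>1/w\<close> on \<open>Q\<close>.\<close>

definition A1_pair :: "(real ^ 'n \<Rightarrow> real) \<Rightarrow> (real ^ 'n \<Rightarrow> real) \<Rightarrow> bool" where
  "A1_pair v w \<longleftrightarrow> weight v \<and> weight w \<and>
     (SUP Q\<in>cubes. (\<integral>\<^sup>+x\<in>Q. ennreal (v x) \<partial>lebesgue) / emeasure lebesgue Q
        * esssup (restrict_space lebesgue Q) (\<lambda>x. inverse (ennreal (w x)))) < \<infinity>"

definition A1_weight :: "(real ^ 'n \<Rightarrow> real) \<Rightarrow> bool" where
  "A1_weight w \<longleftrightarrow> A1_pair w w"

definition truncated_potential ::
    "('a \<Rightarrow> real) \<Rightarrow> ('a \<Rightarrow> real) \<Rightarrow> nat \<Rightarrow> 'a \<Rightarrow> real" where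
  "truncated_potential V b i = (\<lambda>x. max (b x) (1 / real i) / b x * pos_part V x)"

definition potentials :: "real \<Rightarrow> (real ^ 'n \<Rightarrow> real) set" where
  "potentials q = {V. neg_part V \<in> Lloc 1 \<and> pos_part V \<in> Lloc q \<and>
     (\<exists>b. b \<in> borel_measurable lebesgue \<and> bounded (range b) \<and> (AE x in lebesgue. 0 < b x) \<and>
        (\<lambda>x. pos_part V x / b x) \<in> Lloc q \<and>
        (\<forall>i\<ge>1. A1_pair (neg_part V) (truncated_potential V b i) \<and>
                A1_weight (truncated_potential V b i)))}"

subsection \<open>Function spaces\<close>

definition gagliardo :: "real \<Rightarrow> real \<Rightarrow> (real ^ 'n \<Rightarrow> real) \<Rightarrow> (real ^ 'n) \<times> (real ^ 'n) \<Rightarrow> real" where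
  "gagliardo s p v = (\<lambda>(x, y).
     \<bar>v x - v y\<bar> powr p / norm (x - y) powr (real CARD('n) + p * s))"

definition W_space :: "real \<Rightarrow> real \<Rightarrow> (real ^ 'n \<Rightarrow> real) set" where
  "W_space s p = {g \<in> borel_measurable lebesgue.
     integrable lebesgue (\<lambda>x. \<bar>g x\<bar> powr p) \<and> integrable lebesgue (gagliardo s p g)}"

definition X_space :: "real \<Rightarrow> real \<Rightarrow> (real ^ 'n) set \<Rightarrow> (real ^ 'n \<Rightarrow> real) set" where
  "X_space s p \<Omega> = {v \<in> borel_measurable lebesgue.
     set_integrable lebesgue \<Omega> (\<lambda>x. \<bar>v x\<bar> powr p) \<and>
     set_integrable lebesgue (- ((- \<Omega>) \<times> (- \<Omega>))) (gagliardo s p v)}"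

definition X0_space :: "real \<Rightarrow> real \<Rightarrow> (real ^ 'n) set \<Rightarrow> (real ^ 'n \<Rightarrow> real) set" where
  "X0_space s p \<Omega> = {v \<in> X_space s p \<Omega>. AE x in lebesgue. x \<notin> \<Omega> \<longrightarrow> v x = 0}"

definition LpV :: "real \<Rightarrow> (real ^ 'n \<Rightarrow> real) \<Rightarrow> (real ^ 'n) set \<Rightarrow> (real ^ 'n \<Rightarrow> real) set" where
  "LpV p V \<Omega> = {u \<in> borel_measurable lebesgue.
     set_integrable lebesgue \<Omega> (\<lambda>x. \<bar>u x\<bar> powr p * pos_part V x) \<and>
     set_integrable lebesgue \<Omega> (\<lambda>x. \<bar>u x\<bar> powr p * neg_part V x)}"

definition Y_space ::
    "real \<Rightarrow> real \<Rightarrow> (real ^ 'n \<Rightarrow> real) \<Rightarrow> (real ^ 'n) set \<Rightarrow> (real ^ 'n \<Rightarrow> real) set" where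
  "Y_space s p V \<Omega> = X_space s p \<Omega> \<inter> LpV p V \<Omega>"

definition Y0_space ::
    "real \<Rightarrow> real \<Rightarrow> (real ^ 'n \<Rightarrow> real) \<Rightarrow> (real ^ 'n) set \<Rightarrow> (real ^ 'n \<Rightarrow> real) set" where
  "Y0_space s p V \<Omega> = X0_space s p \<Omega> \<inter> LpV p V \<Omega>"

definition Yg_minus_space ::
    "real \<Rightarrow> real \<Rightarrow> (real ^ 'n \<Rightarrow> real) \<Rightarrow> (real ^ 'n) set \<Rightarrow> (real ^ 'n \<Rightarrow> real)
       \<Rightarrow> (real ^ 'n \<Rightarrow> real) set" where
  "Yg_minus_space s p V \<Omega> g =
     {u \<in> Y_space s p V \<Omega>. neg_part (\<lambda>x. g x - u x) \<in> Y0_space s p V \<Omega>}"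

subsection \<open>Weak subsolutions and the nonlocal tail\<close>

text \<open>For \<open>u\<close> in \<open>Y_space\<close>, \<open>\<phi>\<close> in \<open>Y0_space\<close> and an admissible kernel both integrals
  converge absolutely by Hoelder's inequality, so the Bochner integrals below never take their
  default value.\<close>

definition weak_subsolution ::
    "real \<Rightarrow> real \<Rightarrow> (real ^ 'n \<Rightarrow> real) \<Rightarrow> (real ^ 'n \<Rightarrow> real) \<Rightarrow> (real ^ 'n) set
       \<Rightarrow> (real ^ 'n \<Rightarrow> real) \<Rightarrow> (real ^ 'n \<Rightarrow> real) \<Rightarrow> bool" where
  "weak_subsolution s p K V \<Omega> g u \<longleftrightarrow>
     u \<in> Yg_minus_space s p V \<Omega> g \<and>
     (\<forall>\<phi>\<in>Y0_space s p V \<Omega>. (\<forall>x. 0 \<le> \<phi> x) \<longrightarrow>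
        (\<integral>(x, y). H p (u x - u y) * (\<phi> x - \<phi> y) * K (x - y) \<partial>lebesgue)
        + (\<integral>x. V x * \<bar>u x\<bar> powr (p - 2) * u x * \<phi> x \<partial>lebesgue) \<le> 0)"

text \<open>Surface measure of the unit sphere in dimension \<open>n\<close>.\<close>

definition sphere_area :: "real \<Rightarrow> real" where
  "sphere_area n = 2 * pi powr (n / 2) / Gamma (n / 2)"

text \<open>The integral is finite for every \<open>u\<close> in \<open>X_space s p \<Omega>\<close> with \<open>\<Omega>\<close> bounded and
  \<open>ball x0 r \<subseteq> \<Omega>\<close>.\<close>

definition tail :: "real \<Rightarrow> real \<Rightarrow> real \<Rightarrow> (real ^ 'n \<Rightarrow> real) \<Rightarrow> real ^ 'n \<Rightarrow> real" where
  "tail s p r u x0 =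
     (p * s / sphere_area (real CARD('n)) * r powr (p * s) *
        (LINT y:- ball x0 r|lebesgue.
           \<bar>u y\<bar> powr (p - 1) / norm (y - x0) powr (real CARD('n) + p * s))) powr (1 / (p - 1))"

end

theory Submission
  imports Defs
begin

text \<open>The two-weight condition forces \<open>V\<^sub>- = 0\<close> almost everywhere, because \<open>V\<^sub>-\<close> and \<open>V\<^sub>+\<close>
  have disjoint supports. Hence the potential term has a good sign when the equation is tested
  with \<open>(u - k)\<^sub>+ \<eta>\<^sup>p\<close>, and a nonlocal Caccioppoli inequality follows. The De Giorgi
  iteration needs no Sobolev inequality: where \<open>v > 2t\<close>, the energy of \<open>v\<close> controls
  \<open>v\<^sup>p\<close> times the kernel mass of \<open>{v \<le> t}\<close>, and that mass is at least of order
  \<open>R\<^sup>-\<^sup>p\<^sup>s\<close> as soon as \<open>{v > t}\<close> fills at most half of a ball of radius \<open>R\<close>. This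
  gives a bound with \<open>\<delta> = 1\<close> on every ball; applied to all balls of radius comparable to
  \<open>\<delta> powr ((p - 1) / (p s)) * r\<close> centred in \<open>B\<^sub>r(x\<^sub>0)\<close>, it produces the factor \<open>\<delta>\<close>
  in front of the tail and the stated power of \<open>\<delta>\<close> in front of the average.\<close>

section \<open>Pointwise inequalities\<close>

text \<open>A Sobolev inequality would make the recursion superlinear in the truncated mass. Here
  every step is linear in that mass, and the gain sits in the free radius \<open>R\<close>: the less
  mass lies above the level, the smaller \<open>R\<close> may be taken, and the factor
  \<open>R powr (p * s)\<close> then beats the growth caused by the shrinking gaps between levels
  and radii. The powers of \<delta> are pure scaling. On a ball of radius \<rho> = \<epsilon> *
  \<delta> powr ((p - 1) / (p * s)) * r the tail condition carries \<rho> powr (p * s), hence a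
  factor \<delta> powr (p - 1), whose (p - 1)-st root is \<delta>. The average loses (r / \<rho>) ^
  n, whose p-th root is \<delta> powr (- (p - 1) * n / (s * p^2)) up to a constant. The iteration
  runs on iterated Borel integrals with values in the extended nonnegative reals, so that the
  energies need no finiteness proofs. This is why \<open>u\<close> is exchanged for a Borel
  representative and why the Bochner integrals of the statement are translated separately.\<close>

lemma powr_diff_le:
  fixes a b p :: real
  assumes "1 \<le> p" "0 \<le> a" "a \<le> b"
  shows "b powr p - a powr p \<le> p * b powr (p - 1) * (b - a)"
\<comment> \<open>The mean value theorem needs a derivative on the closed interval, and
  \<open>powr\<close> is differentiated only at positive bases; hence \<open>a = 0\<close> is
  treated by hand.\<close>
proof (cases "a = 0 \<or> a = b")
  case True
  then show ?thesis
  proof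
    assume "a = 0"
    show ?thesis
    proof (cases "b = 0")
      case False
      then have "b powr (p - 1) * b = b powr p" using assms by (simp add: powr_mult_base mult.commute)
      moreover have "b powr p \<le> p * b powr p"
        using assms by (simp add: mult_le_cancel_right1)
      ultimately show ?thesis using \<open>a = 0\<close> assms by (simp add: mult.assoc)
    qed (use \<open>a = 0\<close> in simp)
  qed simp
next
  case False
  then have ab: "0 < a" "a < b" using assms by auto
  have "\<exists>z>a. z < b \<and> b powr p - a powr p = (b - a) * (p * z powr (p - 1))"
    by (rule MVT2[OF ab(2)]) (use ab in \<open>auto intro!: derivative_eq_intros\<close>)
  then obtain z where z: "a < z" "z < b" "b powr p - a powr p = (b - a) * (p * z powr (p - 1))"
    by blast
  have "z powr (p - 1) \<le> b powr (p - 1)"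
    using z ab assms by (intro powr_mono2) auto
  then have "(b - a) * (p * z powr (p - 1)) \<le> (b - a) * (p * b powr (p - 1))"
    using ab assms by (intro mult_left_mono) auto
  then show ?thesis using z by (simp add: mult_ac)
qed

lemma powr_add_le:
  fixes x y p :: real
  assumes "0 \<le> p" "0 \<le> x" "0 \<le> y"
  shows "(x + y) powr p \<le> 2 powr p * (x powr p + y powr p)"
proof -
  have "(x + y) powr p \<le> (2 * max x y) powr p"
    using assms by (intro powr_mono2) auto
  also have "\<dots> = 2 powr p * max x y powr p"
    using assms by (simp add: powr_mult)
  also have "max x y powr p \<le> x powr p + y powr p"
    by (simp add: max_def)
  finally show ?thesis by simp
qed

lemma powr_minus_one_mult:
  fixes x p :: real
  assumes "0 \<le> x"
  shows "x powr (p - 1) * x = x powr p"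
  using assms by (cases "x = 0") (auto simp: powr_mult_base mult.commute)

text \<open>If \<open>x\<close> is at least \<open>2 * p * z\<close>, the left side is at most half
  of \<open>x powr p\<close>; otherwise \<open>x\<close> itself is bounded by
  \<open>2 * p * z\<close>. The coefficient 1/2 leaves half of the good term standing in the
  Caccioppoli inequality.\<close>

lemma young_powr:
  fixes x z p :: real
  assumes "1 < p" "0 \<le> x" "0 \<le> z"
  shows "p * x powr (p - 1) * z \<le> x powr p / 2 + (2 * p) powr p * z powr p"
proof (cases "2 * p * z \<le> x")
  case True
  have "x powr (p - 1) * (2 * p * z) \<le> x powr (p - 1) * x"
    using True by (intro mult_left_mono) auto
  then have "p * x powr (p - 1) * z \<le> x powr p / 2"
    using powr_minus_one_mult[OF assms(2), of p] by (simp add: mult_ac)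
  moreover have "0 \<le> (2 * p) powr p * z powr p" by simp
  ultimately show ?thesis by linarith
next
  case False
  have "x powr (p - 1) \<le> (2 * p * z) powr (p - 1)"
    using False assms by (intro powr_mono2) auto
  then have "x powr (p - 1) * (p * z) \<le> (2 * p * z) powr (p - 1) * (p * z)"
    using assms by (intro mult_right_mono) auto
  also have "\<dots> \<le> (2 * p * z) powr (p - 1) * (2 * p * z)"
    using assms by (intro mult_left_mono) auto
  also have "\<dots> = (2 * p * z) powr p"
    using assms by (intro powr_minus_one_mult) auto
  also have "\<dots> = (2 * p) powr p * z powr p"
    using assms by (simp add: powr_mult)
  finally have "p * x powr (p - 1) * z \<le> (2 * p) powr p * z powr p"
    by (simp add: mult_ac)
  then show ?thesis using powr_ge_zero[of x p] by linarith
qed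

section \<open>The monotone power \<open>H\<close> and the algebraic Caccioppoli inequality\<close>

lemma H_minus: "H p (- t) = - H p t"
  by (simp add: H_def)

lemma H_nonneg: "0 \<le> t \<Longrightarrow> H p t = t powr (p - 1)"
  using powr_minus_one_mult[of t "p - 1"] by (simp add: H_def)

lemma abs_H: "\<bar>H p t\<bar> = \<bar>t\<bar> powr (p - 1)"
  using powr_minus_one_mult[of "\<bar>t\<bar>" "p - 1"] by (simp add: H_def abs_mult)

lemma H_mono:
  assumes "1 \<le> p" "a \<le> b"
  shows "H p a \<le> H p b"
proof -
  consider "0 \<le> a" | "a \<le> 0" "0 \<le> b" | "b \<le> 0" using assms by linarith
  then show ?thesis
  proof cases
    case 1
    then show ?thesis using assms by (simp add: H_nonneg powr_mono2)
  next
    case 2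
    have "H p a \<le> 0" using H_minus[of p a] H_nonneg[of "- a" p] 2 
      by (smt (verit) powr_ge_zero)
    then show ?thesis using H_nonneg[of b p] 2 by (smt (verit) powr_ge_zero)
  next
    case 3
    have "H p (- b) \<le> H p (- a)" using assms 3 by (simp add: H_nonneg powr_mono2)
    then show ?thesis by (simp add: H_minus)
  qed
qed

definition excess :: "real \<Rightarrow> real \<Rightarrow> real" where
  "excess k a = max (a - k) 0"

lemma excess_nonneg [simp]: "0 \<le> excess k a"
  by (simp add: excess_def)

text \<open>If both values lie above \<open>k\<close>, truncation does not change their difference;
  if both lie below, both sides vanish. In the mixed cases truncation moves the argument of
  \<open>H\<close> towards 0, and monotonicity of \<open>H\<close> together with the sign of the
  remaining factor decides.\<close>

lemma H_excess_le:
  assumes "1 \<le> p" "0 \<le> A" "0 \<le> B"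
  shows "H p (excess k a - excess k b) * (excess k a * A - excess k b * B)
           \<le> H p (a - b) * (excess k a * A - excess k b * B)"
proof -
  consider "k < a \<and> k < b" | "k < a \<and> b \<le> k" | "a \<le> k \<and> k < b" | "a \<le> k \<and> b \<le> k" by linarith
  then show ?thesis
  proof cases
    case 2
    then show ?thesis using assms H_mono[of p "a - k" "a - b"]
      by (auto simp: excess_def intro!: mult_right_mono)
  next
    case 3
    then have "H p (k - b) * - ((b - k) * B) \<le> H p (a - b) * - ((b - k) * B)"
      using assms by (intro mult_right_mono_neg H_mono) auto
    then show ?thesis using 3 by (simp add: excess_def)
  qed (auto simp: excess_def)
qed

text \<open>Ordering the points makes \<open>H p (x - y)\<close> nonnegative. The difference of the
  products splits into a main part \<open>X\<close>, equal to \<open>x - y\<close> times the larger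
  of \<alpha> and \<beta>, and an error \<open>Z\<close> carrying the increment of the cutoff. The
  factor \<open>2 powr (- p - 1)\<close> is 1/2 from Young's inequality times
  \<open>2 powr (- p)\<close> from splitting the power of \<open>X + Z\<close>; in the error
  constant, \<open>(2 * p) powr p\<close> is again Young's, and the added 1 pays for
  \<open>Z\<close> in \<open>X + Z\<close>.\<close>

lemma caccioppoli_pointwise_ordered:
  fixes x y \<alpha> \<beta> p :: real
  assumes p: "1 < p" and xy: "0 \<le> y" "y \<le> x" and ab: "0 \<le> \<alpha>" "0 \<le> \<beta>"
  shows "2 powr (- p - 1) * \<bar>x * \<alpha> - y * \<beta>\<bar> powr p
           - ((2 * p) powr p + 1) * (x powr p + y powr p) * \<bar>\<alpha> - \<beta>\<bar> powr p
         \<le> H p (x - y) * (x * \<alpha> powr p - y * \<beta> powr p)"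
proof -
  have two: "2 powr (- p - 1) * (2 powr p * z) = z / 2" for z :: real
    by (simp add: powr_diff powr_minus field_simps)
  have main: "2 powr (- p - 1) * \<bar>x * \<alpha> - y * \<beta>\<bar> powr p
           - ((2 * p) powr p + 1) * (x powr p + y powr p) * \<bar>\<alpha> - \<beta>\<bar> powr p \<le> G"
    if G: "X powr p / 2 - (2 * p) powr p * Z powr p \<le> G" and "0 \<le> X" "0 \<le> Z"
      and le: "\<bar>x * \<alpha> - y * \<beta>\<bar> \<le> X + Z" and Z: "Z powr p \<le> (x powr p + y powr p) * \<bar>\<alpha> - \<beta>\<bar> powr p"
    for X Z G
  proof -
    have "\<bar>x * \<alpha> - y * \<beta>\<bar> powr p \<le> (X + Z) powr p"
      using le p by (intro powr_mono2) auto
    also have "\<dots> \<le> 2 powr p * (X powr p + Z powr p)"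
      using that p by (intro powr_add_le) auto
    finally have "2 powr (- p - 1) * \<bar>x * \<alpha> - y * \<beta>\<bar> powr p
        \<le> 2 powr (- p - 1) * (2 powr p * (X powr p + Z powr p))"
      by (intro mult_left_mono) auto
    then have 1: "2 powr (- p - 1) * \<bar>x * \<alpha> - y * \<beta>\<bar> powr p \<le> (X powr p + Z powr p) / 2"
      by (simp only: two)
    have "((2 * p) powr p + 1) * Z powr p
        \<le> ((2 * p) powr p + 1) * ((x powr p + y powr p) * \<bar>\<alpha> - \<beta>\<bar> powr p)"
      using Z by (intro mult_left_mono add_nonneg_nonneg) auto
    then have 2: "(2 * p) powr p * Z powr p + Z powr p
        \<le> ((2 * p) powr p + 1) * (x powr p + y powr p) * \<bar>\<alpha> - \<beta>\<bar> powr p"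
      by (simp add: algebra_simps)
    have arith: "l - d \<le> g"
      if "l \<le> (a + b) / 2" "c + b \<le> d" "a / 2 - c \<le> g" "0 \<le> b"
      for a b c d g l :: real
    proof -
      have "2 * l \<le> a + b" "a \<le> 2 * g + 2 * c" using that by auto
      then show ?thesis using that by linarith
    qed
    show ?thesis by (rule arith[OF 1 2 G]) simp
  qed
  have Hxy: "H p (x - y) = (x - y) powr (p - 1)" using xy by (simp add: H_nonneg)
  show ?thesis
  proof (cases "\<beta> \<le> \<alpha>")
    case True
    show ?thesis
    proof (rule main[where X = "(x - y) * \<alpha>" and Z = "y * (\<alpha> - \<beta>)"])
      \<comment> \<open>The favourable case: replacing \<beta> by the larger \<alpha> only lowers
        the right-hand side, so the full power of \<open>X\<close> survives without Young's
        inequality.\<close>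
      have "y * \<beta> powr p \<le> y * \<alpha> powr p"
        using True ab p xy by (intro mult_left_mono powr_mono2) auto
      then have "(x - y) powr (p - 1) * ((x - y) * \<alpha> powr p)
          \<le> (x - y) powr (p - 1) * (x * \<alpha> powr p - y * \<beta> powr p)"
        by (intro mult_left_mono) (auto simp: algebra_simps)
      moreover have "(x - y) powr (p - 1) * ((x - y) * \<alpha> powr p) = ((x - y) * \<alpha>) powr p"
        using powr_minus_one_mult[of "x - y" p] xy ab by (simp add: powr_mult mult.assoc[symmetric])
      moreover have "0 \<le> ((x - y) * \<alpha>) powr p" "0 \<le> (2 * p) powr p * (y * (\<alpha> - \<beta>)) powr p"
        by simp_all
      ultimately show "((x - y) * \<alpha>) powr p / 2 - (2 * p) powr p * (y * (\<alpha> - \<beta>)) powr p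
          \<le> H p (x - y) * (x * \<alpha> powr p - y * \<beta> powr p)"
        unfolding Hxy by linarith
      show "(y * (\<alpha> - \<beta>)) powr p \<le> (x powr p + y powr p) * \<bar>\<alpha> - \<beta>\<bar> powr p"
        using True xy by (simp add: powr_mult distrib_right)
      show "\<bar>x * \<alpha> - y * \<beta>\<bar> \<le> (x - y) * \<alpha> + y * (\<alpha> - \<beta>)"
        using mult_mono[of y x \<beta> \<alpha>] True xy ab by (simp add: algebra_simps)
    qed (use True xy ab in auto)
  next
    case False
    show ?thesis
    proof (rule main[where X = "(x - y) * \<beta>" and Z = "x * (\<beta> - \<alpha>)"])
      \<comment> \<open>The unfavourable case: the increment of the cutoff powers enters with the
        wrong sign. The tangent bound brings it into the form that \<open>young_powr\<close>
        absorbs, with the arguments \<open>(x - y) * \<beta>\<close> and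
        \<open>x * (\<beta> - \<alpha>)\<close>.\<close>
      have "\<beta> powr p - \<alpha> powr p \<le> p * \<beta> powr (p - 1) * (\<beta> - \<alpha>)"
        using False ab p by (intro powr_diff_le) auto
      then have "x * (\<beta> powr p - \<alpha> powr p) \<le> x * (p * \<beta> powr (p - 1) * (\<beta> - \<alpha>))"
        using xy by (intro mult_left_mono) auto
      then have "(x - y) powr (p - 1) * ((x - y) * \<beta> powr p - x * (p * \<beta> powr (p - 1) * (\<beta> - \<alpha>)))
          \<le> (x - y) powr (p - 1) * (x * \<alpha> powr p - y * \<beta> powr p)"
        by (intro mult_left_mono) (auto simp: algebra_simps)
      moreover have "(x - y) powr (p - 1) * ((x - y) * \<beta> powr p) = ((x - y) * \<beta>) powr p"
        using powr_minus_one_mult[of "x - y" p] xy ab by (simp add: powr_mult mult.assoc[symmetric])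
      moreover have "p * ((x - y) * \<beta>) powr (p - 1) * (x * (\<beta> - \<alpha>))
          \<le> ((x - y) * \<beta>) powr p / 2 + (2 * p) powr p * (x * (\<beta> - \<alpha>)) powr p"
        using xy ab p False by (intro young_powr) auto
      moreover have "(x - y) powr (p - 1) * (x * (p * \<beta> powr (p - 1) * (\<beta> - \<alpha>)))
          = p * ((x - y) * \<beta>) powr (p - 1) * (x * (\<beta> - \<alpha>))"
        using xy ab by (simp add: powr_mult)
      ultimately show "((x - y) * \<beta>) powr p / 2 - (2 * p) powr p * (x * (\<beta> - \<alpha>)) powr p
          \<le> H p (x - y) * (x * \<alpha> powr p - y * \<beta> powr p)"
        unfolding Hxy by (simp add: right_diff_distrib)
      have "\<bar>\<alpha> - \<beta>\<bar> = \<beta> - \<alpha>" using False by simp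
      then show "(x * (\<beta> - \<alpha>)) powr p \<le> (x powr p + y powr p) * \<bar>\<alpha> - \<beta>\<bar> powr p"
        using False xy by (simp add: powr_mult distrib_right mult.commute)
      have "0 \<le> (x - y) * \<beta>" "0 \<le> x * (\<beta> - \<alpha>)" using False xy ab by auto
      then show "\<bar>x * \<alpha> - y * \<beta>\<bar> \<le> (x - y) * \<beta> + x * (\<beta> - \<alpha>)"
        by (simp add: algebra_simps)
    qed (use False xy ab in auto)
  qed
qed

text \<open>The ordered inequality is invariant under exchanging the two points because
  \<open>H\<close> is odd; \<open>H_excess_le\<close> then restores the untruncated difference
  inside \<open>H\<close>.\<close>

lemma caccioppoli_pointwise:
  fixes a b k \<alpha> \<beta> p :: real
  assumes p: "1 < p" and ab: "0 \<le> \<alpha>" "0 \<le> \<beta>"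
  shows "2 powr (- p - 1) * \<bar>excess k a * \<alpha> - excess k b * \<beta>\<bar> powr p
           - ((2 * p) powr p + 1) * (excess k a powr p + excess k b powr p) * \<bar>\<alpha> - \<beta>\<bar> powr p
         \<le> H p (a - b) * (excess k a * \<alpha> powr p - excess k b * \<beta> powr p)"
proof -
  define x y where "x = excess k a" and "y = excess k b"
  have "2 powr (- p - 1) * \<bar>x * \<alpha> - y * \<beta>\<bar> powr p
           - ((2 * p) powr p + 1) * (x powr p + y powr p) * \<bar>\<alpha> - \<beta>\<bar> powr p
         \<le> H p (x - y) * (x * \<alpha> powr p - y * \<beta> powr p)"
  proof (cases "y \<le> x")
    case True
    then show ?thesis using p ab by (intro caccioppoli_pointwise_ordered) (auto simp: x_def y_def)
  next
    case False
    then have "2 powr (- p - 1) * \<bar>y * \<beta> - x * \<alpha>\<bar> powr p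
           - ((2 * p) powr p + 1) * (y powr p + x powr p) * \<bar>\<beta> - \<alpha>\<bar> powr p
         \<le> H p (y - x) * (y * \<beta> powr p - x * \<alpha> powr p)"
      using p ab by (intro caccioppoli_pointwise_ordered) (auto simp: x_def y_def)
    moreover have "H p (y - x) * (y * \<beta> powr p - x * \<alpha> powr p)
        = H p (x - y) * (x * \<alpha> powr p - y * \<beta> powr p)"
      using H_minus[of p "x - y"] by (simp add: algebra_simps)
    ultimately show ?thesis by (simp add: abs_minus_commute add.commute)
  qed
  also have "\<dots> \<le> H p (a - b) * (x * \<alpha> powr p - y * \<beta> powr p)"
    unfolding x_def y_def using p by (intro H_excess_le) auto
  finally show ?thesis by (simp add: x_def y_def)
qed

text \<open>Far away only the \<open>(p - 1)\<close>-st power of \<open>u\<close> is controlled, so the \<open>p\<close>-th power of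
  \<open>b\<close> must not appear here.\<close>

lemma H_excess_far:
  assumes "1 < p" "0 \<le> A"
  shows "- (excess k b powr (p - 1) * excess k a * A) \<le> H p (a - b) * (excess k a * A)"
proof (cases "k < a")
  case True
  have "H p (- excess k b) \<le> H p (a - b)"
    using assms True by (intro H_mono) (auto simp: excess_def)
  then have "- (excess k b powr (p - 1)) \<le> H p (a - b)"
    by (simp add: H_minus H_nonneg)
  then have "- (excess k b powr (p - 1)) * (excess k a * A) \<le> H p (a - b) * (excess k a * A)"
    using assms by (intro mult_right_mono) auto
  then show ?thesis by (simp add: mult.assoc)
qed (simp add: excess_def)

section \<open>The singular kernel\<close>

text \<open>At 0 the value is 0, because \<open>0 powr x = 0\<close>; diagonal terms therefore
  vanish. With \<alpha> = p * s this is the model kernel to which \<open>K\<close> is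
  comparable.\<close>

definition frac_kernel :: "real \<Rightarrow> 'a::euclidean_space \<Rightarrow> real" where
  "frac_kernel \<alpha> h = norm h powr (- (real DIM('a) + \<alpha>))"

lemma frac_kernel_nonneg [simp]: "0 \<le> frac_kernel \<alpha> h"
  by (simp add: frac_kernel_def)

lemma frac_kernel_measurable [measurable]: "frac_kernel \<alpha> \<in> borel_measurable borel"
  unfolding frac_kernel_def by measurable

lemma frac_kernel_commute: "frac_kernel \<alpha> (x - y) = frac_kernel \<alpha> (y - x)"
  by (simp add: frac_kernel_def norm_minus_commute)

lemma nn_integral_lborel_diff:
  fixes x :: "'a::euclidean_space"
  assumes [measurable]: "g \<in> borel_measurable borel"
  shows "(\<integral>\<^sup>+y. g (x - y) \<partial>lborel) = (\<integral>\<^sup>+y. g y \<partial>lborel)"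
proof -
  have "(lborel :: 'a measure) = distr lborel borel (\<lambda>y. x - y)"
    using lborel_affine[of "-1" x] by (simp add: density_1)
  then have "(\<integral>\<^sup>+y. g y \<partial>lborel) = (\<integral>\<^sup>+y. g y \<partial>distr lborel borel (\<lambda>y. x - y))"
    by simp
  also have "\<dots> = (\<integral>\<^sup>+y. g (x - y) \<partial>lborel)"
    by (subst nn_integral_distr) auto
  finally show ?thesis ..
qed

text \<open>Balls instead of annuli overcount, which is harmless: each point needs one suitable
  index only, and the weighted volumes are dominated by a geometric series. One statement thus
  serves both the decay at infinity and the singularity at the origin.\<close>

lemma nn_integral_shells:
  fixes f :: "'a::euclidean_space \<Rightarrow> real" and r a :: "nat \<Rightarrow> real"
  assumes cover: "\<And>h. h \<in> D \<Longrightarrow> \<exists>j. norm h < r j \<and> f h \<le> a j"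
    and nonneg: "\<And>j. 0 \<le> a j" "\<And>j. 0 \<le> r j"
    and bound: "\<And>j. a j * r j ^ DIM('a) \<le> b * q ^ j" and q: "0 < q" "q < 1" and "0 \<le> b"
  shows "(\<integral>\<^sup>+h. ennreal (f h) * indicator D h \<partial>lborel)
           \<le> ennreal (unit_ball_vol (real DIM('a)) * b / (1 - q))"
proof -
  let ?w = "unit_ball_vol (real DIM('a))"
  have w: "0 \<le> ?w" by simp
  have "(\<integral>\<^sup>+h. ennreal (f h) * indicator D h \<partial>lborel)
      \<le> (\<integral>\<^sup>+h. (\<Sum>j. ennreal (a j) * indicator (ball (0::'a) (r j)) h) \<partial>lborel)"
  proof (intro nn_integral_mono)
    fix h :: 'a
    show "ennreal (f h) * indicator D h \<le> (\<Sum>j. ennreal (a j) * indicator (ball 0 (r j)) h)"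
    proof (cases "h \<in> D")
      case True
      then obtain j where j: "norm h < r j" "f h \<le> a j" using cover by blast
      have "ennreal (f h) \<le> ennreal (a j) * indicator (ball 0 (r j)) h"
        using j by (simp add: ennreal_leI)
      also have "\<dots> \<le> (\<Sum>j. ennreal (a j) * indicator (ball 0 (r j)) h)"
        using sum_le_suminf[of "\<lambda>j. ennreal (a j) * indicator (ball 0 (r j)) h" "{j}"]
        by (simp del: sum.inter_filter sum_mult_indicator)
      finally show ?thesis using True by simp
    qed simp
  qed
  also have "\<dots> = (\<Sum>j. ennreal (a j) * emeasure lborel (ball (0::'a) (r j)))"
  proof -
    have [measurable]: "ball (0::'a) e \<in> sets borel" for e by simp
    show ?thesis by (subst nn_integral_suminf) (measurable, simp add: nn_integral_cmult_indicator)
  qed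
  also have "\<dots> \<le> (\<Sum>j. ennreal (?w * b * q ^ j))"
  proof (intro suminf_le)
    fix j
    have "?w * (a j * r j ^ DIM('a)) \<le> ?w * (b * q ^ j)"
      using bound[of j] w by (intro mult_left_mono)
    then show "ennreal (a j) * emeasure lborel (ball (0::'a) (r j)) \<le> ennreal (?w * b * q ^ j)"
      using nonneg w by (auto simp: emeasure_ball ennreal_mult[symmetric] mult_ac intro!: ennreal_leI)
  qed auto
  also have "\<dots> = ennreal (?w * b / (1 - q))"
  proof (rule suminf_ennreal_eq)
    show "0 \<le> ?w * b * q ^ j" for j using w q \<open>0 \<le> b\<close> by auto
    have "(\<lambda>j. ?w * b * q ^ j) sums (?w * b * (1 / (1 - q)))"
      using q by (intro sums_mult geometric_sums) auto
    then show "(\<lambda>j. ?w * b * q ^ j) sums (?w * b / (1 - q))" by simp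
  qed
  finally show ?thesis .
qed

lemma dyadic_scale:
  fixes x :: real
  assumes "1 \<le> x"
  shows "\<exists>j. 2 ^ j \<le> x \<and> x < 2 ^ Suc j"
proof -
  define j where "j = (LEAST j. x < 2 ^ Suc j)"
  obtain n where "x < 2 ^ n" using real_arch_pow[of 2 x] by auto
  then have "x < 2 ^ Suc n" by (simp add: less_le_trans)
  then have j: "x < 2 ^ Suc j" unfolding j_def by (rule LeastI)
  have "2 ^ j \<le> x"
  proof (cases j)
    case (Suc i)
    then have "\<not> x < 2 ^ Suc i"
      using not_less_Least[of i "\<lambda>j. x < 2 ^ Suc j"] by (simp add: j_def)
    then show ?thesis using Suc by simp
  qed (use assms in simp)
  then show ?thesis using j by blast
qed

lemma frac_kernel_far:
  assumes "0 < \<alpha>"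
  shows "\<exists>C>0. \<forall>R>0. (\<integral>\<^sup>+h. ennreal (frac_kernel \<alpha> h) * indicator {h::'a::euclidean_space. R \<le> norm h} h \<partial>lborel)
           \<le> ennreal (C * R powr (- \<alpha>))"
proof -
  let ?n = "DIM('a)"
  define q :: real where "q = 2 powr (- \<alpha>)"
  have q: "0 < q" "q < 1" using assms by (auto simp: q_def powr_less_one)
  have "(\<integral>\<^sup>+h. ennreal (frac_kernel \<alpha> h) * indicator {h::'a. R \<le> norm h} h \<partial>lborel)
           \<le> ennreal (unit_ball_vol (real ?n) * (2 ^ ?n * R powr (- \<alpha>)) / (1 - q))" if R: "0 < R" for R
  \<comment> \<open>The shell with index \<open>j\<close> lies between the radii
    \<open>2 ^ j * R\<close> and twice that; the kernel is bounded by its value at the inner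
    radius.\<close>
  proof (rule nn_integral_shells[where r = "\<lambda>j. 2 * (2 ^ j * R)" and a = "\<lambda>j. (2 ^ j * R) powr (- (real ?n + \<alpha>))"])
    fix h :: 'a assume "h \<in> {h. R \<le> norm h}"
    then have "1 \<le> norm h / R" using R by simp
    then obtain j where j: "2 ^ j \<le> norm h / R" "norm h / R < 2 ^ Suc j" using dyadic_scale by blast
    have "norm h powr (- (real ?n + \<alpha>)) \<le> (2 ^ j * R) powr (- (real ?n + \<alpha>))"
      using j R assms by (intro powr_mono2') (auto simp: field_simps)
    then show "\<exists>j. norm h < 2 * (2 ^ j * R) \<and> frac_kernel \<alpha> h \<le> (2 ^ j * R) powr (- (real ?n + \<alpha>))"
      using j R by (intro exI[of _ j]) (auto simp: frac_kernel_def field_simps)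
  next
    fix j :: nat
    let ?t = "2 ^ j * R"
    have t: "0 < ?t" using R by simp
    have "?t powr (- (real ?n + \<alpha>)) * (2 * ?t) ^ ?n = 2 ^ ?n * (?t powr (- (real ?n + \<alpha>)) * ?t powr real ?n)"
      using t by (simp only: powr_realpow power_mult_distrib) (simp add: mult_ac)
    also have "?t powr (- (real ?n + \<alpha>)) * ?t powr real ?n = ?t powr (- \<alpha>)"
      using powr_add[of ?t "- (real ?n + \<alpha>)" "real ?n"] by simp
    also have "\<dots> = R powr (- \<alpha>) * q ^ j"
    proof -
      have "(2 ^ j) powr (- \<alpha>) = q ^ j"
        by (simp add: q_def powr_power powr_realpow[symmetric] powr_powr mult.commute)
      then show ?thesis by (simp add: powr_mult)
    qed
    finally show "?t powr (- (real ?n + \<alpha>)) * (2 * ?t) ^ ?n \<le> 2 ^ ?n * R powr (- \<alpha>) * q ^ j"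
      by simp
  qed (use R q in auto)
  then show ?thesis using q
    by (intro exI[of _ "unit_ball_vol (real ?n) * 2 ^ ?n / (1 - q)"]) (auto simp: mult_ac)
qed

lemma norm_powr_near:
  assumes "0 < \<beta>"
  shows "\<exists>C>0. \<forall>R>0. (\<integral>\<^sup>+h. ennreal (norm h powr (\<beta> - real DIM('a))) * indicator (ball (0::'a::euclidean_space) R) h \<partial>lborel)
           \<le> ennreal (C * R powr \<beta>)"
proof -
  let ?n = "DIM('a)"
  define q :: real where "q = 2 powr (- \<beta>)"
  \<comment> \<open>The exponent \<open>\<beta> - n\<close> may have either sign, so within a dyadic
    shell the power is compared with its value at the outer radius through a factor covering
    both.\<close>
  define c :: real where "c = 2 powr \<bar>\<beta> - real ?n\<bar>"
  have q: "0 < q" "q < 1" using assms by (auto simp: q_def powr_less_one)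
  have "(\<integral>\<^sup>+h. ennreal (norm h powr (\<beta> - real DIM('a))) * indicator (ball (0::'a) R) h \<partial>lborel)
           \<le> ennreal (unit_ball_vol (real ?n) * (c * 2 ^ ?n * R powr \<beta>) / (1 - q))" if R: "0 < R" for R
  proof (rule nn_integral_shells[where r = "\<lambda>j. 2 * (R / 2 ^ j)" and a = "\<lambda>j. c * (R / 2 ^ j) powr (\<beta> - real ?n)"])
    fix h :: 'a assume h: "h \<in> ball 0 R"
    show "\<exists>j. norm h < 2 * (R / 2 ^ j) \<and> norm h powr (\<beta> - real ?n) \<le> c * (R / 2 ^ j) powr (\<beta> - real ?n)"
    proof (cases "h = 0")
      case True
      then show ?thesis using R by (intro exI[of _ 0]) (auto simp: c_def)
    next
      case False
      then have "1 \<le> R / norm h" using h by simp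
      then obtain j where j: "2 ^ j \<le> R / norm h" "R / norm h < 2 ^ Suc j" using dyadic_scale by blast
      define t where "t = norm h / (R / 2 ^ j)"
      have t: "1 / 2 < t" "t \<le> 1" using j False R by (auto simp: t_def field_simps)
      have "t powr (\<beta> - real ?n) \<le> c"
      proof (cases "0 \<le> \<beta> - real ?n")
        case True
        then have "t powr (\<beta> - real ?n) \<le> 1" using t by (intro powr_le1) auto
        also have "1 \<le> c" by (simp add: c_def ge_one_powr_ge_zero)
        finally show ?thesis .
      next
        case False
        then have "t powr (\<beta> - real ?n) \<le> (1 / 2) powr (\<beta> - real ?n)"
          using t by (intro powr_mono2') auto
        also have "\<dots> = c" using False by (simp add: c_def powr_divide powr_minus_divide[symmetric])
        finally show ?thesis .
      qed
      then have "t powr (\<beta> - real ?n) * (R / 2 ^ j) powr (\<beta> - real ?n) \<le> c * (R / 2 ^ j) powr (\<beta> - real ?n)"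
        by (intro mult_right_mono) auto
      moreover have h_eq: "norm h = t * (R / 2 ^ j)" using R by (simp add: t_def)
      moreover have "norm h powr (\<beta> - real ?n) = t powr (\<beta> - real ?n) * (R / 2 ^ j) powr (\<beta> - real ?n)"
        unfolding h_eq by (rule powr_mult)
      moreover have "t * (R / 2 ^ j) < 2 * (R / 2 ^ j)"
        using R t by (intro mult_strict_right_mono) auto
      ultimately have "norm h < 2 * (R / 2 ^ j) \<and> norm h powr (\<beta> - real ?n) \<le> c * (R / 2 ^ j) powr (\<beta> - real ?n)"
        by simp
      then show ?thesis by blast
    qed
  next
    fix j :: nat
    let ?t = "R / 2 ^ j"
    have t: "0 < ?t" using R by simp
    have "c * ?t powr (\<beta> - real ?n) * (2 * ?t) ^ ?n = c * 2 ^ ?n * (?t powr (\<beta> - real ?n) * ?t powr real ?n)"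
      using t by (simp only: powr_realpow power_mult_distrib) (simp add: mult_ac)
    also have "?t powr (\<beta> - real ?n) * ?t powr real ?n = ?t powr \<beta>"
      using powr_add[of ?t "\<beta> - real ?n" "real ?n"] by simp
    also have "\<dots> = R powr \<beta> * q ^ j"
    proof -
      have "(2 ^ j) powr \<beta> = (2 powr \<beta>) ^ j"
        by (simp add: powr_power powr_realpow[symmetric] powr_powr mult.commute)
      then show ?thesis using R by (simp add: powr_divide q_def powr_minus power_inverse field_simps)
    qed
    finally show "c * ?t powr (\<beta> - real ?n) * (2 * ?t) ^ ?n \<le> c * 2 ^ ?n * R powr \<beta> * q ^ j"
      by (simp only: mult.assoc order_refl)
  qed (use R q in \<open>auto simp: c_def\<close>)
  then show ?thesis using q
    by (intro exI[of _ "unit_ball_vol (real ?n) * c * 2 ^ ?n / (1 - q)"]) (auto simp: mult_ac c_def)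
qed

text \<open>The integral is split at norm \<open>1 / L\<close>, where the minimum switches. Inside,
  the power \<open>p - p * s - n\<close> is integrable because \<open>s < 1\<close>; outside, the
  kernel is integrable because \<open>p * s > 0\<close>; both pieces scale like
  \<open>L powr (p * s)\<close>. With \<open>L\<close> the inverse width of the transition zone this
  is the kernel mass seen by a cutoff.\<close>

lemma frac_kernel_truncated:
  assumes "0 < s" "s < 1" "0 < p"
  shows "\<exists>C>0. \<forall>L>0. (\<integral>\<^sup>+h. ennreal (min 1 (L * norm h) powr p * frac_kernel (p * s) (h::'a::euclidean_space)) \<partial>lborel)
           \<le> ennreal (C * L powr (p * s))"
proof -
  let ?n = "DIM('a)"
  have pos: "0 < p * s" "0 < p - p * s" using assms by auto
  obtain C1 where C1: "C1 > 0" "\<And>R. R > 0 \<Longrightarrow> (\<integral>\<^sup>+h. ennreal (frac_kernel (p * s) h) * indicator {h::'a. R \<le> norm h} h \<partial>lborel)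
           \<le> ennreal (C1 * R powr (- (p * s)))" using frac_kernel_far[OF pos(1)] by blast
  obtain C2 where C2: "C2 > 0" "\<And>R. R > 0 \<Longrightarrow> (\<integral>\<^sup>+h. ennreal (norm h powr (p - p * s - real ?n)) * indicator (ball (0::'a) R) h \<partial>lborel)
           \<le> ennreal (C2 * R powr (p - p * s))" using norm_powr_near[OF pos(2)] by blast
  show ?thesis
  proof (intro exI[of _ "C1 + C2"] conjI allI impI)
    fix L :: real assume L: "0 < L"
    have "(\<integral>\<^sup>+h. ennreal (min 1 (L * norm h) powr p * frac_kernel (p * s) (h::'a)) \<partial>lborel)
       \<le> (\<integral>\<^sup>+h. ennreal (frac_kernel (p * s) h) * indicator {h::'a. 1 / L \<le> norm h} h
          + ennreal (L powr p) * (ennreal (norm h powr (p - p * s - real ?n)) * indicator (ball 0 (1 / L)) h) \<partial>lborel)"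
    proof (intro nn_integral_mono)
      fix h :: 'a
      show "ennreal (min 1 (L * norm h) powr p * frac_kernel (p * s) h)
        \<le> ennreal (frac_kernel (p * s) h) * indicator {h. 1 / L \<le> norm h} h
          + ennreal (L powr p) * (ennreal (norm h powr (p - p * s - real ?n)) * indicator (ball 0 (1 / L)) h)"
      proof (cases "1 / L \<le> norm h")
        case True
        then have "1 \<le> L * norm h" using L by (simp add: field_simps)
        then show ?thesis using True by simp
      next
        case False
        then have "L * norm h < 1" using L by (simp add: field_simps)
        then have "min 1 (L * norm h) powr p * frac_kernel (p * s) h = L powr p * norm h powr (p - p * s - real ?n)"
          using L by (simp add: powr_mult frac_kernel_def powr_add[symmetric] algebra_simps)
        then show ?thesis using False by (simp add: ennreal_mult)
      qed
    qed
    also have "\<dots> = (\<integral>\<^sup>+h. ennreal (frac_kernel (p * s) h) * indicator {h::'a. 1 / L \<le> norm h} h \<partial>lborel)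
       + ennreal (L powr p) * (\<integral>\<^sup>+h. ennreal (norm h powr (p - p * s - real ?n)) * indicator (ball (0::'a) (1 / L)) h \<partial>lborel)"
    proof -
      have "{h::'a. 1 / L \<le> norm h} \<in> sets borel"
        by (intro borel_closed closed_Collect_le continuous_intros)
      then have m1: "(\<lambda>h::'a. ennreal (frac_kernel (p * s) h) * indicator {h. 1 / L \<le> norm h} h) \<in> borel_measurable lborel"
        by (intro borel_measurable_times_ennreal borel_measurable_indicator) measurable
      have m2: "(\<lambda>h::'a. ennreal (norm h powr (p - p * s - real ?n)) * indicator (ball 0 (1 / L)) h) \<in> borel_measurable lborel"
        by (intro borel_measurable_times_ennreal borel_measurable_indicator) (auto intro: borel_open)
      show ?thesis
        by (subst nn_integral_add[OF m1 borel_measurable_times_ennreal[OF borel_measurable_const m2]])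
          (simp only: nn_integral_cmult[OF m2])
    qed
    also have "\<dots> \<le> ennreal (C1 * (1 / L) powr (- (p * s))) + ennreal (L powr p) * ennreal (C2 * (1 / L) powr (p - p * s))"
      using C1(2)[of "1 / L"] C2(2)[of "1 / L"] L by (intro add_mono mult_left_mono) auto
    also have "\<dots> = ennreal (C1 * (1 / L) powr (- (p * s)) + L powr p * (C2 * (1 / L) powr (p - p * s)))"
      using C1 C2 by (subst ennreal_plus) (auto simp: ennreal_mult)
    also have "C1 * (1 / L) powr (- (p * s)) + L powr p * (C2 * (1 / L) powr (p - p * s)) = (C1 + C2) * L powr (p * s)"
    proof -
      have "(1 / L) powr (- (p * s)) = L powr (p * s)" using L by (simp add: powr_divide powr_minus_divide)
      moreover have "(1 / L) powr (p - p * s) = L powr (p * s - p)"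
        using L powr_minus_divide[of L "p - p * s"] by (simp add: powr_divide)
      moreover have "L powr p * L powr (p * s - p) = L powr (p * s)" by (simp add: powr_add[symmetric])
      ultimately show ?thesis by (simp add: algebra_simps)
    qed
    finally show "(\<integral>\<^sup>+h. ennreal (min 1 (L * norm h) powr p * frac_kernel (p * s) (h::'a)) \<partial>lborel)
       \<le> ennreal ((C1 + C2) * L powr (p * s))" .
  qed (use C1 C2 in simp)
qed

text \<open>This lower bound replaces the fractional Sobolev inequality: a set of small measure
  cannot absorb much of the singular mass of the kernel.\<close>

lemma frac_kernel_lower:
  fixes x :: "'a::euclidean_space"
  assumes "0 \<le> \<alpha>" "0 < R" and [measurable]: "A \<in> sets borel"
    and A: "emeasure lborel A \<le> ennreal (unit_ball_vol (real DIM('a)) / 2 * R ^ DIM('a))"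
  shows "ennreal (unit_ball_vol (real DIM('a)) / 2 * R powr (- \<alpha>))
    \<le> (\<integral>\<^sup>+y. ennreal (frac_kernel \<alpha> (x - y)) * indicator (ball x R - A) y \<partial>lborel)"
proof -
  let ?n = "DIM('a)" and ?w = "unit_ball_vol (real DIM('a))"
  have w: "0 \<le> ?w" by simp
  have "ennreal (?w / 2 * R ^ ?n) = ennreal (?w * R ^ ?n) - ennreal (?w / 2 * R ^ ?n)"
    using w \<open>0 < R\<close> by (subst ennreal_minus) (auto simp: field_simps)
  also have "\<dots> \<le> emeasure lborel (ball x R) - emeasure lborel A"
    using A \<open>0 < R\<close> by (simp add: emeasure_ball ennreal_minus_mono)
  also have "\<dots> \<le> emeasure lborel (ball x R - A)"
  proof -
    have "emeasure lborel A < \<infinity>" using A by (simp add: order_le_less_trans)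
    have "emeasure lborel (ball x R) \<le> emeasure lborel ((ball x R - A) \<union> A)"
      by (intro emeasure_mono) auto
    also have "\<dots> \<le> emeasure lborel (ball x R - A) + emeasure lborel A"
      by (intro emeasure_subadditive) auto
    finally have "emeasure lborel (ball x R) \<le> emeasure lborel A + emeasure lborel (ball x R - A)"
      by (simp add: add.commute)
    then show ?thesis using \<open>emeasure lborel A < \<infinity>\<close> by (auto simp: ennreal_minus_le_iff)
  qed
  finally have m: "ennreal (?w / 2 * R ^ ?n) \<le> emeasure lborel (ball x R - A)" .
  have "ennreal (?w / 2 * R powr (- \<alpha>)) = ennreal (R powr (- (real ?n + \<alpha>))) * ennreal (?w / 2 * R ^ ?n)"
  proof -
    have "R powr (- \<alpha>) = R powr (- (real ?n + \<alpha>)) * R ^ ?n"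
      using \<open>0 < R\<close> by (simp add: powr_realpow[symmetric] powr_add[symmetric])
    then show ?thesis using w \<open>0 < R\<close> by (simp add: ennreal_mult[symmetric] mult_ac)
  qed
  \<comment> \<open>The centre \<open>x\<close> is removed because the kernel is 0 there by
    convention, which would violate the pointwise lower bound; a single point has measure 0.\<close>
  also have "\<dots> \<le> ennreal (R powr (- (real ?n + \<alpha>))) * emeasure lborel (ball x R - A - {x})"
  proof -
    have "emeasure lborel (ball x R - A - {x}) = emeasure lborel (ball x R - A)"
      by (rule emeasure_Diff_null_set) auto
    then show ?thesis using m by (intro mult_left_mono) auto
  qed
  also have "\<dots> = (\<integral>\<^sup>+y. ennreal (R powr (- (real ?n + \<alpha>))) * indicator (ball x R - A - {x}) y \<partial>lborel)"
    by (subst nn_integral_cmult_indicator) auto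
  also have "\<dots> \<le> (\<integral>\<^sup>+y. ennreal (frac_kernel \<alpha> (x - y)) * indicator (ball x R - A) y \<partial>lborel)"
  proof (intro nn_integral_mono)
    fix y
    have "R powr (- (real ?n + \<alpha>)) \<le> frac_kernel \<alpha> (x - y)" if "y \<in> ball x R" "y \<noteq> x"
      unfolding frac_kernel_def using that assms
      by (intro powr_mono2') (auto simp: dist_norm)
    then show "ennreal (R powr (- (real ?n + \<alpha>))) * indicator (ball x R - A - {x}) y
      \<le> ennreal (frac_kernel \<alpha> (x - y)) * indicator (ball x R - A) y"
      by (auto simp: indicator_def intro!: ennreal_leI)
  qed
  finally show ?thesis .
qed

section \<open>De Giorgi iteration\<close>

definition cutoff :: "'a::real_normed_vector \<Rightarrow> real \<Rightarrow> real \<Rightarrow> 'a \<Rightarrow> real" where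
  "cutoff z r1 r2 x = max 0 (min 1 ((r2 - norm (x - z)) / (r2 - r1)))"

lemma cutoff_nonneg [simp]: "0 \<le> cutoff z r1 r2 x"
  and cutoff_le_1 [simp]: "cutoff z r1 r2 x \<le> 1"
  by (simp_all add: cutoff_def)

lemma cutoff_measurable [measurable]:
  "cutoff (z::'a::euclidean_space) r1 r2 \<in> borel_measurable borel"
  unfolding cutoff_def by measurable

lemma cutoff_eq_1: "r1 < r2 \<Longrightarrow> norm (x - z) \<le> r1 \<Longrightarrow> cutoff z r1 r2 x = 1"
  by (simp add: cutoff_def)

lemma cutoff_eq_0: "r1 < r2 \<Longrightarrow> r2 \<le> norm (x - z) \<Longrightarrow> cutoff z r1 r2 x = 0"
  using divide_nonpos_pos[of "r2 - norm (x - z)" "r2 - r1"] by (simp add: cutoff_def)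

lemma cutoff_diff_le:
  assumes "r1 < r2"
  shows "\<bar>cutoff z r1 r2 x - cutoff z r1 r2 y\<bar> \<le> min 1 (1 / (r2 - r1) * norm (x - y))"
proof -
  have "\<bar>max 0 (min 1 a) - max 0 (min 1 b)\<bar> \<le> min 1 \<bar>a - b\<bar>" for a b :: real
    by linarith
  then have "\<bar>cutoff z r1 r2 x - cutoff z r1 r2 y\<bar>
      \<le> min 1 \<bar>(r2 - norm (x - z)) / (r2 - r1) - (r2 - norm (y - z)) / (r2 - r1)\<bar>"
    unfolding cutoff_def .
  also have "\<bar>(r2 - norm (x - z)) / (r2 - r1) - (r2 - norm (y - z)) / (r2 - r1)\<bar>
      = 1 / (r2 - r1) * \<bar>norm (y - z) - norm (x - z)\<bar>"
    using assms by (simp add: diff_divide_distrib[symmetric] abs_divide)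
  also have "min 1 \<dots> \<le> min 1 (1 / (r2 - r1) * norm (x - y))"
    using norm_triangle_ineq3[of "y - z" "x - z"] assms
    by (intro min.mono mult_left_mono) (auto simp: norm_minus_commute)
  finally show ?thesis .
qed

lemma excess_measurable [measurable (raw)]:
  "f \<in> borel_measurable M \<Longrightarrow> (\<lambda>x. excess k (f x)) \<in> borel_measurable M"
  unfolding excess_def by (intro borel_measurable_max borel_measurable_diff) auto

lemma excess_antimono: "k \<le> l \<Longrightarrow> excess l a \<le> excess k a"
  by (simp add: excess_def)

text \<open>The only consequence of the equation used by the iteration. In the second term on the
  right the far values of \<open>u\<close> enter with the power \<open>p - 1\<close> only.\<close>

definition degiorgi_class ::
    "real \<Rightarrow> real \<Rightarrow> real \<Rightarrow> 'a::euclidean_space set \<Rightarrow> ('a \<Rightarrow> real) \<Rightarrow> bool" where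
  "degiorgi_class s p C \<Omega> u \<longleftrightarrow> u \<in> borel_measurable borel \<and>
    (\<forall>k z r1 r2 \<sigma>. 0 \<le> k \<longrightarrow> 0 < r1 \<longrightarrow> r1 < r2 \<longrightarrow> r2 < \<sigma> \<longrightarrow> ball z \<sigma> \<subseteq> \<Omega> \<longrightarrow>
      (\<integral>\<^sup>+x. \<integral>\<^sup>+y. ennreal (\<bar>excess k (u x) * cutoff z r1 r2 x - excess k (u y) * cutoff z r1 r2 y\<bar> powr p
          * frac_kernel (p * s) (x - y)) * indicator (ball z \<sigma>) x * indicator (ball z \<sigma>) y \<partial>lborel \<partial>lborel)
      \<le> ennreal C *
       ((\<integral>\<^sup>+x. \<integral>\<^sup>+y. ennreal ((excess k (u x) powr p + excess k (u y) powr p)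
          * \<bar>cutoff z r1 r2 x - cutoff z r1 r2 y\<bar> powr p * frac_kernel (p * s) (x - y))
          * indicator (ball z \<sigma>) x * indicator (ball z \<sigma>) y \<partial>lborel \<partial>lborel)
       + (\<integral>\<^sup>+x. \<integral>\<^sup>+y. ennreal (excess k (u x) * cutoff z r1 r2 x powr p * excess k (u y) powr (p - 1)
          * frac_kernel (p * s) (x - y)) * indicator (ball z \<sigma>) x * indicator (- ball z \<sigma>) y \<partial>lborel \<partial>lborel)))"

text \<open>For \<open>x\<close> in the inner ball with \<open>w x > 2 * t\<close> the cutoff is 1,
  so at every nearby \<open>y\<close> with \<open>w y \<le> t\<close> the two products differ by at
  least \<open>w x / 2\<close>; \<open>frac_kernel_lower\<close> integrates the kernel over those
  \<open>y\<close>. The condition \<open>R \<le> \<sigma> - r1\<close> keeps \<open>ball x R\<close>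
  inside \<open>ball z \<sigma>\<close>, and \<open>2 powr (- p)\<close> is the price of
  halving.\<close>

lemma degiorgi_lower:
  fixes z :: "'a::euclidean_space"
  assumes [measurable]: "w \<in> borel_measurable borel" and w: "\<And>x. 0 \<le> w x"
    and ps: "0 < p" "0 < s" and r: "0 < r1" "r1 < r2" "0 < R" "R \<le> \<sigma> - r1"
    and t: "0 \<le> t"
    and A: "emeasure lborel {x \<in> ball z \<sigma>. t < w x} \<le> ennreal (unit_ball_vol (real DIM('a)) / 2 * R ^ DIM('a))"
  shows "ennreal (unit_ball_vol (real DIM('a)) / 2 * 2 powr (- p) * R powr (- (p * s)))
      * (\<integral>\<^sup>+x. ennreal (w x powr p) * indicator {x \<in> ball z r1. 2 * t < w x} x \<partial>lborel)
    \<le> (\<integral>\<^sup>+x. \<integral>\<^sup>+y. ennreal (\<bar>w x * cutoff z r1 r2 x - w y * cutoff z r1 r2 y\<bar> powr p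
          * frac_kernel (p * s) (x - y)) * indicator (ball z \<sigma>) x * indicator (ball z \<sigma>) y \<partial>lborel \<partial>lborel)"
proof -
  let ?w = "unit_ball_vol (real DIM('a))" and ?J = "frac_kernel (p * s) :: 'a \<Rightarrow> real"
  let ?A = "{x \<in> ball z \<sigma>. t < w x}"
  have [measurable]: "ball z e \<in> sets borel" for e by simp
  have [measurable]: "ball x e \<in> sets borel" for x :: 'a and e by simp
  have [measurable]: "?A \<in> sets borel"
  proof -
    have "{x. t < w x} \<in> sets borel" by measurable
    then have "ball z \<sigma> \<inter> {x. t < w x} \<in> sets borel" by auto
    then show ?thesis by (simp add: Int_def)
  qed
  have [measurable]: "{x \<in> ball z r1. 2 * t < w x} \<in> sets borel"
  proof -
    have "{x. 2 * t < w x} \<in> sets borel" by measurable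
    then have "ball z r1 \<inter> {x. 2 * t < w x} \<in> sets borel" by auto
    then show ?thesis by (simp add: Int_def)
  qed
  have "ennreal (?w / 2 * 2 powr (- p) * R powr (- (p * s)))
      * (\<integral>\<^sup>+x. ennreal (w x powr p) * indicator {x \<in> ball z r1. 2 * t < w x} x \<partial>lborel)
     = (\<integral>\<^sup>+x. ennreal (?w / 2 * 2 powr (- p) * R powr (- (p * s))) *
         (ennreal (w x powr p) * indicator {x \<in> ball z r1. 2 * t < w x} x) \<partial>lborel)"
    by (rule nn_integral_cmult[symmetric]) measurable
  also have "\<dots> \<le> (\<integral>\<^sup>+x. \<integral>\<^sup>+y. ennreal (\<bar>w x * cutoff z r1 r2 x - w y * cutoff z r1 r2 y\<bar> powr p
          * ?J (x - y)) * indicator (ball z \<sigma>) x * indicator (ball z \<sigma>) y \<partial>lborel \<partial>lborel)"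
  proof (intro nn_integral_mono)
    fix x :: 'a
    show "ennreal (?w / 2 * 2 powr (- p) * R powr (- (p * s))) *
         (ennreal (w x powr p) * indicator {x \<in> ball z r1. 2 * t < w x} x)
      \<le> (\<integral>\<^sup>+y. ennreal (\<bar>w x * cutoff z r1 r2 x - w y * cutoff z r1 r2 y\<bar> powr p
          * ?J (x - y)) * indicator (ball z \<sigma>) x * indicator (ball z \<sigma>) y \<partial>lborel)"
    proof (cases "x \<in> ball z r1 \<and> 2 * t < w x")
      case True
      have "ennreal (?w / 2 * 2 powr (- p) * R powr (- (p * s))) *
         (ennreal (w x powr p) * indicator {x \<in> ball z r1. 2 * t < w x} x)
        = ennreal ((w x / 2) powr p) * ennreal (?w / 2 * R powr (- (p * s)))"
        using True w[of x] by (simp add: ennreal_mult'[symmetric] powr_divide powr_minus_divide mult_ac)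
      also have "\<dots> \<le> ennreal ((w x / 2) powr p) * (\<integral>\<^sup>+y. ennreal (?J (x - y)) * indicator (ball x R - ?A) y \<partial>lborel)"
        using ps r A by (intro mult_left_mono frac_kernel_lower) auto
      also have "\<dots> = (\<integral>\<^sup>+y. ennreal ((w x / 2) powr p) * (ennreal (?J (x - y)) * indicator (ball x R - ?A) y) \<partial>lborel)"
        by (rule nn_integral_cmult[symmetric]) measurable
      also have "\<dots> \<le> (\<integral>\<^sup>+y. ennreal (\<bar>w x * cutoff z r1 r2 x - w y * cutoff z r1 r2 y\<bar> powr p
          * ?J (x - y)) * indicator (ball z \<sigma>) x * indicator (ball z \<sigma>) y \<partial>lborel)"
      proof (intro nn_integral_mono)
        fix y :: 'a
        show "ennreal ((w x / 2) powr p) * (ennreal (?J (x - y)) * indicator (ball x R - ?A) y)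
          \<le> ennreal (\<bar>w x * cutoff z r1 r2 x - w y * cutoff z r1 r2 y\<bar> powr p
              * ?J (x - y)) * indicator (ball z \<sigma>) x * indicator (ball z \<sigma>) y"
        proof (cases "y \<in> ball x R - ?A")
          case y: True
          have "dist z y \<le> dist z x + dist x y" by (rule dist_triangle)
          then have yB: "y \<in> ball z \<sigma>" using y True r by auto
          have xB: "x \<in> ball z \<sigma>" using True r by auto
          have "w y * cutoff z r1 r2 y \<le> w y * 1" using w by (intro mult_left_mono) auto
          also have "\<dots> \<le> t" using y yB by auto
          finally have "w y * cutoff z r1 r2 y \<le> w x / 2" using True by simp
          moreover have "cutoff z r1 r2 x = 1"
            using True r by (intro cutoff_eq_1) (auto simp: dist_norm norm_minus_commute)
          ultimately have "w x / 2 \<le> \<bar>w x * cutoff z r1 r2 x - w y * cutoff z r1 r2 y\<bar>"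
            by (simp only: mult_1_right)
          then have "(w x / 2) powr p \<le> \<bar>w x * cutoff z r1 r2 x - w y * cutoff z r1 r2 y\<bar> powr p"
            using w[of x] ps by (intro powr_mono2) auto
          then have "(w x / 2) powr p * ?J (x - y)
              \<le> \<bar>w x * cutoff z r1 r2 x - w y * cutoff z r1 r2 y\<bar> powr p * ?J (x - y)"
            by (intro mult_right_mono) auto
          then show ?thesis using y xB yB
            by (auto simp: ennreal_mult[symmetric] intro!: ennreal_leI)
        qed simp
      qed
      finally show ?thesis .
    qed auto
  qed
  finally show ?thesis .
qed

text \<open>The increment of the cutoff is at most the truncated linear function whose kernel mass
  is bounded by \<open>C\<close>. The contributions of \<open>w x\<close> and \<open>w y\<close> are
  mirror images under Fubini, hence the factor 2.\<close>

lemma degiorgi_near: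
  fixes z :: "'a::euclidean_space"
  assumes [measurable]: "w \<in> borel_measurable borel" and "0 < p" "r1 < r2"
    and C: "(\<integral>\<^sup>+h. ennreal (min 1 (1 / (r2 - r1) * norm h) powr p * frac_kernel \<alpha> (h::'a)) \<partial>lborel) \<le> ennreal C"
  shows "(\<integral>\<^sup>+x. \<integral>\<^sup>+y. ennreal ((w x powr p + w y powr p) * \<bar>cutoff z r1 r2 x - cutoff z r1 r2 y\<bar> powr p
            * frac_kernel \<alpha> (x - y)) * indicator (ball z \<sigma>) x * indicator (ball z \<sigma>) y \<partial>lborel \<partial>lborel)
    \<le> ennreal (2 * C) * (\<integral>\<^sup>+x. ennreal (w x powr p) * indicator (ball z \<sigma>) x \<partial>lborel)"
proof -
  let ?J = "frac_kernel \<alpha> :: 'a \<Rightarrow> real"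
  have [measurable]: "ball z e \<in> sets borel" for e by simp
  define G where "G x y = ennreal (w x powr p) * indicator (ball z \<sigma>) x *
      ennreal (min 1 (1 / (r2 - r1) * norm (x - y)) powr p * ?J (x - y))" for x y
  have [measurable]: "case_prod G \<in> borel_measurable (lborel \<Otimes>\<^sub>M lborel)"
    unfolding G_def by measurable
  have meas [measurable]: "G x \<in> borel_measurable borel" "(\<lambda>y. G y x) \<in> borel_measurable borel" for x
    unfolding G_def by measurable
  have int_G: "(\<integral>\<^sup>+y. G x y \<partial>lborel) \<le> ennreal (w x powr p) * indicator (ball z \<sigma>) x * ennreal C" for x
  proof -
    have "(\<integral>\<^sup>+y. G x y \<partial>lborel) = ennreal (w x powr p) * indicator (ball z \<sigma>) x *
       (\<integral>\<^sup>+y. ennreal (min 1 (1 / (r2 - r1) * norm (x - y)) powr p * ?J (x - y)) \<partial>lborel)"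
      unfolding G_def by (rule nn_integral_cmult) measurable
    also have "(\<integral>\<^sup>+y. ennreal (min 1 (1 / (r2 - r1) * norm (x - y)) powr p * ?J (x - y)) \<partial>lborel)
       = (\<integral>\<^sup>+h. ennreal (min 1 (1 / (r2 - r1) * norm h) powr p * ?J h) \<partial>lborel)"
      by (rule nn_integral_lborel_diff[where g = "\<lambda>h. ennreal (min 1 (1 / (r2 - r1) * norm h) powr p * ?J h)"]) measurable
    also have "\<dots> \<le> ennreal C" by (rule C)
    finally show ?thesis by (simp add: mult_left_mono)
  qed
  have "(\<integral>\<^sup>+x. \<integral>\<^sup>+y. ennreal ((w x powr p + w y powr p) * \<bar>cutoff z r1 r2 x - cutoff z r1 r2 y\<bar> powr p
            * ?J (x - y)) * indicator (ball z \<sigma>) x * indicator (ball z \<sigma>) y \<partial>lborel \<partial>lborel)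
     \<le> (\<integral>\<^sup>+x. \<integral>\<^sup>+y. G x y + G y x \<partial>lborel \<partial>lborel)"
  proof (intro nn_integral_mono)
    fix x y :: 'a
    let ?m = "min 1 (1 / (r2 - r1) * norm (x - y))"
    have "\<bar>cutoff z r1 r2 x - cutoff z r1 r2 y\<bar> powr p \<le> ?m powr p"
      using cutoff_diff_le[OF \<open>r1 < r2\<close>, of z x y] \<open>0 < p\<close> by (intro powr_mono2) auto
    then have "(w x powr p + w y powr p) * \<bar>cutoff z r1 r2 x - cutoff z r1 r2 y\<bar> powr p * ?J (x - y)
      \<le> (w x powr p + w y powr p) * ?m powr p * ?J (x - y)"
      by (intro mult_right_mono mult_left_mono) auto
    also have "\<dots> = w x powr p * (?m powr p * ?J (x - y)) + w y powr p * (?m powr p * ?J (x - y))"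
      by (simp add: algebra_simps)
    finally have *: "ennreal ((w x powr p + w y powr p) * \<bar>cutoff z r1 r2 x - cutoff z r1 r2 y\<bar> powr p * ?J (x - y))
      \<le> ennreal (w x powr p) * ennreal (?m powr p * ?J (x - y)) + ennreal (w y powr p) * ennreal (?m powr p * ?J (x - y))"
      by (simp add: ennreal_mult[symmetric] ennreal_plus[symmetric] ennreal_leI del: ennreal_plus)
    show "ennreal ((w x powr p + w y powr p) * \<bar>cutoff z r1 r2 x - cutoff z r1 r2 y\<bar> powr p
            * ?J (x - y)) * indicator (ball z \<sigma>) x * indicator (ball z \<sigma>) y \<le> G x y + G y x"
    proof (cases "x \<in> ball z \<sigma> \<and> y \<in> ball z \<sigma>")
      case True
      then show ?thesis using *
        by (simp add: G_def norm_minus_commute[of y x] frac_kernel_commute[of _ y x])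
    qed auto
  qed
  also have "\<dots> = (\<integral>\<^sup>+x. (\<integral>\<^sup>+y. G x y \<partial>lborel) + (\<integral>\<^sup>+y. G y x \<partial>lborel) \<partial>lborel)"
    by (subst nn_integral_add) auto
  also have "\<dots> = (\<integral>\<^sup>+x. \<integral>\<^sup>+y. G x y \<partial>lborel \<partial>lborel) + (\<integral>\<^sup>+x. \<integral>\<^sup>+y. G y x \<partial>lborel \<partial>lborel)"
    by (subst nn_integral_add) (measurable)
  also have "(\<integral>\<^sup>+x. \<integral>\<^sup>+y. G y x \<partial>lborel \<partial>lborel) = (\<integral>\<^sup>+x. \<integral>\<^sup>+y. G x y \<partial>lborel \<partial>lborel)"
    by (rule lborel_pair.Fubini') measurable
  also have "(\<integral>\<^sup>+x. \<integral>\<^sup>+y. G x y \<partial>lborel \<partial>lborel) + (\<integral>\<^sup>+x. \<integral>\<^sup>+y. G x y \<partial>lborel \<partial>lborel)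
      = 2 * (\<integral>\<^sup>+x. \<integral>\<^sup>+y. G x y \<partial>lborel \<partial>lborel)"
    by (simp add: mult_2)
  also have "\<dots> \<le> 2 * (\<integral>\<^sup>+x. ennreal (w x powr p) * indicator (ball z \<sigma>) x * ennreal C \<partial>lborel)"
    by (intro mult_left_mono nn_integral_mono int_G) auto
  also have "\<dots> = 2 * ((\<integral>\<^sup>+x. ennreal (w x powr p) * indicator (ball z \<sigma>) x \<partial>lborel) * ennreal C)"
    by (subst nn_integral_multc) measurable
  also have "\<dots> = ennreal (2 * C) * (\<integral>\<^sup>+x. ennreal (w x powr p) * indicator (ball z \<sigma>) x \<partial>lborel)"
  proof -
    have "ennreal (2 * C) = 2 * ennreal C" by (simp add: ennreal_mult')
    then show ?thesis by (simp only: mult_ac)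
  qed
  finally show ?thesis .
qed

text \<open>Where the cutoff does not vanish, \<open>x\<close> is within \<open>r2\<close> of
  \<open>z\<close>, while \<open>y\<close> is at distance at least \<sigma>; hence |x - y| is at
  least (1 - r2 / \<sigma>) * |y - z|. Centring the kernel at \<open>z\<close> in this way makes the
  double integral factorise.\<close>

lemma degiorgi_far:
  fixes z :: "'a::euclidean_space"
  assumes [measurable]: "w \<in> borel_measurable borel" and w: "\<And>x. 0 \<le> w x"
    and r: "0 < r1" "r1 < r2" "r2 < \<sigma>" and "0 < \<alpha>" "0 < p"
  shows "(\<integral>\<^sup>+x. \<integral>\<^sup>+y. ennreal (w x * cutoff z r1 r2 x powr p * w y powr (p - 1)
          * frac_kernel \<alpha> (x - y)) * indicator (ball z \<sigma>) x * indicator (- ball z \<sigma>) y \<partial>lborel \<partial>lborel)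
    \<le> ennreal ((\<sigma> / (\<sigma> - r2)) powr (real DIM('a) + \<alpha>))
       * (\<integral>\<^sup>+y. ennreal (w y powr (p - 1) * frac_kernel \<alpha> (y - z)) * indicator (- ball z \<sigma>) y \<partial>lborel)
       * (\<integral>\<^sup>+x. ennreal (w x) * indicator (ball z \<sigma>) x \<partial>lborel)"
proof -
  let ?J = "frac_kernel \<alpha> :: 'a \<Rightarrow> real" and ?q = "(\<sigma> / (\<sigma> - r2)) powr (real DIM('a) + \<alpha>)"
  let ?T = "\<integral>\<^sup>+y. ennreal (w y powr (p - 1) * ?J (y - z)) * indicator (- ball z \<sigma>) y \<partial>lborel"
  have [measurable]: "ball z e \<in> sets borel" for e by simp
  have pw: "ennreal (w x * cutoff z r1 r2 x powr p * w y powr (p - 1)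
          * ?J (x - y)) * indicator (ball z \<sigma>) x * indicator (- ball z \<sigma>) y
      \<le> (ennreal ?q * (ennreal (w x) * indicator (ball z \<sigma>) x)) *
         (ennreal (w y powr (p - 1) * ?J (y - z)) * indicator (- ball z \<sigma>) y)" for x y
  proof (cases "x \<in> ball z \<sigma> \<and> y \<notin> ball z \<sigma>")
    case True
    show ?thesis
    proof (cases "norm (x - z) < r2")
      case xr: True
      have y: "\<sigma> \<le> norm (y - z)" using True by (simp add: dist_norm norm_minus_commute)
      have "norm (y - z) \<le> norm (x - y) + norm (x - z)"
        using norm_triangle_ineq4[of "x - z" "x - y"] by simp
      moreover have "r2 * \<sigma> \<le> r2 * norm (y - z)"
        using y r by (intro mult_left_mono) auto
      moreover have "\<sigma> * (norm (y - z) - r2) \<le> \<sigma> * norm (x - y)"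
        using xr r calculation(1) by (intro mult_left_mono) auto
      ultimately have "(\<sigma> - r2) * norm (y - z) \<le> \<sigma> * norm (x - y)"
        unfolding left_diff_distrib right_diff_distrib by (simp only: mult.commute[of \<sigma> r2])
      then have "(\<sigma> - r2) / \<sigma> * norm (y - z) \<le> norm (x - y)"
        using r by (simp add: pos_divide_le_eq mult.commute)
      moreover have "0 < (\<sigma> - r2) / \<sigma> * norm (y - z)"
        using y r by (intro mult_pos_pos divide_pos_pos) auto
      ultimately have "?J (x - y) \<le> ((\<sigma> - r2) / \<sigma> * norm (y - z)) powr (- (real DIM('a) + \<alpha>))"
        unfolding frac_kernel_def using \<open>0 < \<alpha>\<close> by (intro powr_mono2') auto
      also have "\<dots> = ?q * ?J (y - z)"
        using r by (simp add: frac_kernel_def powr_mult powr_divide powr_minus_divide del: minus_add_distrib)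
      finally have J: "?J (x - y) \<le> ?q * ?J (y - z)" .
      have "cutoff z r1 r2 x powr p \<le> 1" using \<open>0 < p\<close> by (intro powr_le1) auto
      then have "w x * cutoff z r1 r2 x powr p * w y powr (p - 1) * ?J (x - y)
          \<le> w x * 1 * w y powr (p - 1) * (?q * ?J (y - z))"
        using w[of x] J by (intro mult_mono mult_nonneg_nonneg) auto
      then have "ennreal (w x * cutoff z r1 r2 x powr p * w y powr (p - 1) * ?J (x - y))
          \<le> ennreal (?q * w x * (w y powr (p - 1) * ?J (y - z)))"
        by (intro ennreal_leI) (simp add: mult_ac)
      also have "\<dots> = (ennreal ?q * ennreal (w x)) * ennreal (w y powr (p - 1) * ?J (y - z))"
        using w[of x] by (simp add: ennreal_mult)
      finally show ?thesis using True by simp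
    next
      case False
      then show ?thesis using cutoff_eq_0[of r1 r2 x z] r \<open>0 < p\<close> by simp
    qed
  qed auto
  have "(\<integral>\<^sup>+x. \<integral>\<^sup>+y. ennreal (w x * cutoff z r1 r2 x powr p * w y powr (p - 1)
          * ?J (x - y)) * indicator (ball z \<sigma>) x * indicator (- ball z \<sigma>) y \<partial>lborel \<partial>lborel)
    \<le> (\<integral>\<^sup>+x. \<integral>\<^sup>+y. (ennreal ?q * (ennreal (w x) * indicator (ball z \<sigma>) x)) *
         (ennreal (w y powr (p - 1) * ?J (y - z)) * indicator (- ball z \<sigma>) y) \<partial>lborel \<partial>lborel)"
    by (intro nn_integral_mono pw)
  also have "\<dots> = (\<integral>\<^sup>+x. (ennreal ?q * (ennreal (w x) * indicator (ball z \<sigma>) x)) * ?T \<partial>lborel)"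
    by (subst nn_integral_cmult) auto
  also have "\<dots> = (\<integral>\<^sup>+x. ennreal ?q * (ennreal (w x) * indicator (ball z \<sigma>) x) \<partial>lborel) * ?T"
    by (rule nn_integral_multc) measurable
  also have "(\<integral>\<^sup>+x. ennreal ?q * (ennreal (w x) * indicator (ball z \<sigma>) x) \<partial>lborel)
      = ennreal ?q * (\<integral>\<^sup>+x. ennreal (w x) * indicator (ball z \<sigma>) x \<partial>lborel)"
    by (rule nn_integral_cmult) measurable
  finally show ?thesis by (simp add: mult_ac)
qed

text \<open>The energy is taken at the intermediate level \<open>k + 2 * t\<close>. Comparing it
  with level \<open>k\<close> bounds the measure of \<open>{?w > t}\<close> by Chebyshev's
  inequality and turns the linear far term into a p-th power; the remaining rise to
  \<open>k + 4 * t\<close> is the condition \<open>2 * t < ?w\<close> of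
  \<open>degiorgi_lower\<close>. The radius drops by \<open>2 * d\<close>: one \<open>d\<close> for
  the slope of the cutoff, one to separate its support from the far region.\<close>

lemma degiorgi_step:
  fixes u :: "'a::euclidean_space \<Rightarrow> real"
  assumes dg: "degiorgi_class s p C1 \<Omega> u" and ps: "1 < p" "0 < s"
    and k: "0 \<le> k" and d: "0 < d" "2 * d < \<sigma>" and R: "0 < R" "R \<le> d" and t: "0 < t"
    and sub: "ball z \<sigma> \<subseteq> \<Omega>"
    and C3: "(\<integral>\<^sup>+h. ennreal (min 1 (1 / d * norm h) powr p * frac_kernel (p * s) (h::'a)) \<partial>lborel) \<le> ennreal (C3 * d powr (- (p * s)))"
    and nonneg: "0 \<le> C1" "0 \<le> C3" "0 \<le> \<tau>"
    and far: "(\<integral>\<^sup>+y. ennreal (excess 0 (u y) powr (p - 1) * frac_kernel (p * s) (y - z)) * indicator (- ball z \<sigma>) y \<partial>lborel) \<le> ennreal \<tau>"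
    and small: "(\<integral>\<^sup>+x. ennreal (excess k (u x) powr p) * indicator (ball z \<sigma>) x \<partial>lborel)
        \<le> ennreal (unit_ball_vol (real DIM('a)) / 2 * R ^ DIM('a) * t powr p)"
  shows "(\<integral>\<^sup>+x. ennreal (excess (k + 4 * t) (u x) powr p) * indicator (ball z (\<sigma> - 2 * d)) x \<partial>lborel)
    \<le> ennreal (C1 * 2 powr p * 2 / unit_ball_vol (real DIM('a)) * R powr (p * s)
        * (2 * C3 * d powr (- (p * s)) + (\<sigma> / d) powr (real DIM('a) + p * s) * \<tau> * (2 * t) powr (1 - p)))
      * (\<integral>\<^sup>+x. ennreal (excess k (u x) powr p) * indicator (ball z \<sigma>) x \<partial>lborel)"
proof -
  let ?w = "\<lambda>x. excess (k + 2 * t) (u x)" and ?vol = "unit_ball_vol (real DIM('a))"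
    and ?J = "frac_kernel (p * s) :: 'a \<Rightarrow> real" and ?e = "real DIM('a) + p * s"
    and ?\<eta> = "cutoff z (\<sigma> - 2 * d) (\<sigma> - d)"
  let ?Y = "\<integral>\<^sup>+x. ennreal (excess k (u x) powr p) * indicator (ball z \<sigma>) x \<partial>lborel"
  have vol: "0 < ?vol" by simp
  have [measurable]: "u \<in> borel_measurable borel" using dg by (simp add: degiorgi_class_def)
  have [measurable]: "ball x e \<in> sets borel" for x :: 'a and e by simp
  have pos: "0 < p * s" using ps by simp
  let ?A = "{x \<in> ball z \<sigma>. t < ?w x}"
  have A_sets [measurable]: "?A \<in> sets borel"
  proof -
    have "{x. t < ?w x} \<in> sets borel" by measurable
    then have "ball z \<sigma> \<inter> {x. t < ?w x} \<in> sets borel" by auto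
    then show ?thesis by (simp add: Int_def)
  qed
  have A: "emeasure lborel ?A \<le> ennreal (?vol / 2 * R ^ DIM('a))"
  proof -
    have "ennreal (t powr p) * emeasure lborel ?A = (\<integral>\<^sup>+x. ennreal (t powr p) * indicator ?A x \<partial>lborel)"
      by (simp add: nn_integral_cmult_indicator)
    also have "\<dots> \<le> ?Y"
    proof (intro nn_integral_mono)
      fix x
      have "t powr p \<le> excess k (u x) powr p" if "t < ?w x"
        using that t ps by (intro powr_mono2) (auto simp: excess_def max_def split: if_splits)
      then show "ennreal (t powr p) * indicator ?A x \<le> ennreal (excess k (u x) powr p) * indicator (ball z \<sigma>) x"
        by (auto simp: indicator_def intro!: ennreal_leI)
    qed
    also have "\<dots> \<le> ennreal (?vol / 2 * R ^ DIM('a) * t powr p)" by (rule small)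
    finally have *: "ennreal (t powr p) * emeasure lborel ?A \<le> ennreal (t powr p) * ennreal (?vol / 2 * R ^ DIM('a))"
      using vol R by (simp add: ennreal_mult[symmetric] mult_ac)
    have "emeasure lborel ?A \<noteq> \<infinity>"
    proof -
      have "emeasure lborel ?A \<le> emeasure lborel (ball z \<sigma>)" by (intro emeasure_mono) auto
      then show ?thesis using emeasure_lborel_ball_finite[of z \<sigma>] by (metis leD infinity_ennreal_def)
    qed
    then obtain a where a: "emeasure lborel ?A = ennreal a" "0 \<le> a"
      by (metis ennreal_cases infinity_ennreal_def)
    have "t powr p * a \<le> t powr p * (?vol / 2 * R ^ DIM('a))"
      using * a vol R by (simp add: ennreal_mult[symmetric])
    then have "a \<le> ?vol / 2 * R ^ DIM('a)" using t by simp
    then show ?thesis using a by (simp add: ennreal_leI)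
  qed
  have wY: "(\<integral>\<^sup>+x. ennreal (?w x powr p) * indicator (ball z \<sigma>) x \<partial>lborel) \<le> ?Y"
    using t ps by (intro nn_integral_mono mult_right_mono ennreal_leI powr_mono2 excess_antimono) auto
  have w1: "(\<integral>\<^sup>+x. ennreal (?w x) * indicator (ball z \<sigma>) x \<partial>lborel) \<le> ennreal ((2 * t) powr (1 - p)) * ?Y"
  proof -
    have "(\<integral>\<^sup>+x. ennreal (?w x) * indicator (ball z \<sigma>) x \<partial>lborel)
      \<le> (\<integral>\<^sup>+x. ennreal ((2 * t) powr (1 - p)) * (ennreal (excess k (u x) powr p) * indicator (ball z \<sigma>) x) \<partial>lborel)"
    proof (intro nn_integral_mono)
      fix x
      \<comment> \<open>Where \<open>?w\<close> is positive, the excess over \<open>k\<close> is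
        above \<open>2 * t\<close>, and the power with exponent \<open>1 - p\<close> is
        decreasing.\<close>
      have "?w x \<le> (2 * t) powr (1 - p) * excess k (u x) powr p"
      proof (cases "k + 2 * t < u x")
        case True
        let ?e = "excess k (u x)"
        have e: "2 * t < ?e" using True t by (auto simp: excess_def)
        have "?w x \<le> ?e" using t by (intro excess_antimono) auto
        also have "\<dots> = (?e powr (1 - p) * ?e powr (p - 1)) * ?e"
          using e t by (simp add: powr_add[symmetric])
        also have "\<dots> \<le> ((2 * t) powr (1 - p) * ?e powr (p - 1)) * ?e"
          using e t ps by (intro mult_right_mono powr_mono2') auto
        also have "\<dots> = (2 * t) powr (1 - p) * ?e powr p"
          using powr_minus_one_mult[of ?e p] by simp
        finally show ?thesis .
      qed (simp add: excess_def)
      then show "ennreal (?w x) * indicator (ball z \<sigma>) x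
        \<le> ennreal ((2 * t) powr (1 - p)) * (ennreal (excess k (u x) powr p) * indicator (ball z \<sigma>) x)"
        by (auto simp: indicator_def ennreal_mult[symmetric] intro!: ennreal_leI)
    qed
    also have "\<dots> = ennreal ((2 * t) powr (1 - p)) * ?Y"
      by (rule nn_integral_cmult) measurable
    finally show ?thesis .
  qed
  let ?c = "?vol / 2 * 2 powr (- p) * R powr (- (p * s))"
  let ?Z = "\<integral>\<^sup>+x. ennreal (excess (k + 4 * t) (u x) powr p) * indicator (ball z (\<sigma> - 2 * d)) x \<partial>lborel"
  have "ennreal ?c * ?Z
      \<le> ennreal ?c * (\<integral>\<^sup>+x. ennreal (?w x powr p) * indicator {x \<in> ball z (\<sigma> - 2 * d). 2 * t < ?w x} x \<partial>lborel)"
  proof (intro mult_left_mono nn_integral_mono)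
    fix x
    show "ennreal (excess (k + 4 * t) (u x) powr p) * indicator (ball z (\<sigma> - 2 * d)) x
       \<le> ennreal (?w x powr p) * indicator {x \<in> ball z (\<sigma> - 2 * d). 2 * t < ?w x} x"
    proof (cases "k + 4 * t < u x")
      case True
      then have "2 * t < ?w x" by (auto simp: excess_def)
      moreover have "excess (k + 4 * t) (u x) powr p \<le> ?w x powr p"
        using t ps by (intro powr_mono2 excess_antimono) auto
      ultimately show ?thesis by (auto simp: indicator_def intro!: ennreal_leI)
    qed (simp add: excess_def)
  qed simp
  also have "\<dots> \<le> (\<integral>\<^sup>+x. \<integral>\<^sup>+y. ennreal (\<bar>?w x * ?\<eta> x - ?w y * ?\<eta> y\<bar> powr p
          * ?J (x - y)) * indicator (ball z \<sigma>) x * indicator (ball z \<sigma>) y \<partial>lborel \<partial>lborel)"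
    using ps d R t A by (intro degiorgi_lower) auto
  also have "\<dots> \<le> ennreal C1 *
       ((\<integral>\<^sup>+x. \<integral>\<^sup>+y. ennreal ((?w x powr p + ?w y powr p)
          * \<bar>?\<eta> x - ?\<eta> y\<bar> powr p * ?J (x - y))
          * indicator (ball z \<sigma>) x * indicator (ball z \<sigma>) y \<partial>lborel \<partial>lborel)
       + (\<integral>\<^sup>+x. \<integral>\<^sup>+y. ennreal (?w x * ?\<eta> x powr p * ?w y powr (p - 1)
          * ?J (x - y)) * indicator (ball z \<sigma>) x * indicator (- ball z \<sigma>) y \<partial>lborel \<partial>lborel))"
    using dg k t d sub unfolding degiorgi_class_def by auto
  also have "\<dots> \<le> ennreal C1 * (ennreal (2 * (C3 * d powr (- (p * s)))) * ?Y
      + ennreal ((\<sigma> / d) powr ?e) * ennreal \<tau> * (ennreal ((2 * t) powr (1 - p)) * ?Y))"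
  proof (intro mult_left_mono add_mono)
    have "(\<integral>\<^sup>+x. \<integral>\<^sup>+y. ennreal ((?w x powr p + ?w y powr p) * \<bar>?\<eta> x - ?\<eta> y\<bar> powr p * ?J (x - y))
          * indicator (ball z \<sigma>) x * indicator (ball z \<sigma>) y \<partial>lborel \<partial>lborel)
      \<le> ennreal (2 * (C3 * d powr (- (p * s)))) * (\<integral>\<^sup>+x. ennreal (?w x powr p) * indicator (ball z \<sigma>) x \<partial>lborel)"
      using ps d C3 by (intro degiorgi_near) auto
    also have "\<dots> \<le> ennreal (2 * (C3 * d powr (- (p * s)))) * ?Y"
      by (intro mult_left_mono wY) auto
    finally show "(\<integral>\<^sup>+x. \<integral>\<^sup>+y. ennreal ((?w x powr p + ?w y powr p) * \<bar>?\<eta> x - ?\<eta> y\<bar> powr p * ?J (x - y))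
          * indicator (ball z \<sigma>) x * indicator (ball z \<sigma>) y \<partial>lborel \<partial>lborel)
        \<le> ennreal (2 * (C3 * d powr (- (p * s)))) * ?Y" .
  next
    have T: "(\<integral>\<^sup>+y. ennreal (?w y powr (p - 1) * ?J (y - z)) * indicator (- ball z \<sigma>) y \<partial>lborel) \<le> ennreal \<tau>"
    proof (rule order.trans[OF _ far], intro nn_integral_mono mult_right_mono ennreal_leI powr_mono2)
      show "?w y \<le> excess 0 (u y)" for y using k t by (intro excess_antimono) auto
    qed (use ps in auto)
    have "(\<integral>\<^sup>+x. \<integral>\<^sup>+y. ennreal (?w x * ?\<eta> x powr p * ?w y powr (p - 1)
          * ?J (x - y)) * indicator (ball z \<sigma>) x * indicator (- ball z \<sigma>) y \<partial>lborel \<partial>lborel)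
      \<le> ennreal ((\<sigma> / (\<sigma> - (\<sigma> - d))) powr (real DIM('a) + p * s))
       * (\<integral>\<^sup>+y. ennreal (?w y powr (p - 1) * ?J (y - z)) * indicator (- ball z \<sigma>) y \<partial>lborel)
       * (\<integral>\<^sup>+x. ennreal (?w x) * indicator (ball z \<sigma>) x \<partial>lborel)"
      using ps d pos by (intro degiorgi_far) auto
    also have "\<dots> \<le> ennreal ((\<sigma> / d) powr ?e) * ennreal \<tau> * (ennreal ((2 * t) powr (1 - p)) * ?Y)"
      using T w1 by (intro mult_mono) auto
    finally show "(\<integral>\<^sup>+x. \<integral>\<^sup>+y. ennreal (?w x * ?\<eta> x powr p * ?w y powr (p - 1)
          * ?J (x - y)) * indicator (ball z \<sigma>) x * indicator (- ball z \<sigma>) y \<partial>lborel \<partial>lborel)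
        \<le> ennreal ((\<sigma> / d) powr ?e) * ennreal \<tau> * (ennreal ((2 * t) powr (1 - p)) * ?Y)" .
  qed simp
  also have "\<dots> = ennreal (C1 * (2 * C3 * d powr (- (p * s)) + (\<sigma> / d) powr ?e * \<tau> * (2 * t) powr (1 - p))) * ?Y"
  proof -
    have "ennreal (C1 * (2 * C3 * d powr (- (p * s)) + (\<sigma> / d) powr ?e * \<tau> * (2 * t) powr (1 - p)))
      = ennreal C1 * (ennreal (2 * (C3 * d powr (- (p * s)))) + ennreal ((\<sigma> / d) powr ?e) * ennreal \<tau> * ennreal ((2 * t) powr (1 - p)))"
      using nonneg by (simp add: ennreal_mult mult.assoc)
    then show ?thesis by (simp only: mult.assoc distrib_left distrib_right)
  qed
  finally have main: "ennreal ?c * ?Z \<le> ennreal (C1 * (2 * C3 * d powr (- (p * s)) + (\<sigma> / d) powr ?e * \<tau> * (2 * t) powr (1 - p))) * ?Y" .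
  have c: "0 < ?c" using vol R by simp
  have inv: "1 / ?c = 2 powr p * 2 / ?vol * R powr (p * s)"
    using vol by (simp add: powr_minus_divide)
  have cancel: "Z = ennreal (1 / c) * (ennreal c * Z)" if "0 < c" for c Z
    using that by (simp add: mult.assoc[symmetric] ennreal_mult[symmetric])
  have "?Z = ennreal (1 / ?c) * (ennreal ?c * ?Z)" by (rule cancel[OF c])
  also have "\<dots> \<le> ennreal (1 / ?c) * (ennreal (C1 * (2 * C3 * d powr (- (p * s)) + (\<sigma> / d) powr ?e * \<tau> * (2 * t) powr (1 - p))) * ?Y)"
    by (intro mult_left_mono main) auto
  also have "\<dots> = ennreal (1 / ?c * (C1 * (2 * C3 * d powr (- (p * s)) + (\<sigma> / d) powr ?e * \<tau> * (2 * t) powr (1 - p)))) * ?Y"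
    using nonneg c by (subst ennreal_mult) (auto simp: mult.assoc intro!: mult_nonneg_nonneg add_nonneg_nonneg)
  also have "1 / ?c * (C1 * (2 * C3 * d powr (- (p * s)) + (\<sigma> / d) powr ?e * \<tau> * (2 * t) powr (1 - p)))
      = C1 * 2 powr p * 2 / ?vol * R powr (p * s)
        * (2 * C3 * d powr (- (p * s)) + (\<sigma> / d) powr ?e * \<tau> * (2 * t) powr (1 - p))"
    unfolding inv by (simp add: mult_ac)
  finally show ?thesis .
qed

lemma degiorgi_local_bound:
  assumes ps: "1 < p" "0 < s" "s < 1" and C1: "0 < C1"
  shows "\<exists>c>0. \<forall>\<Omega> (u :: 'a::euclidean_space \<Rightarrow> real) z \<rho> M. degiorgi_class s p C1 \<Omega> u \<longrightarrow> 0 < \<rho> \<longrightarrow> 0 < M \<longrightarrow>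
      ball z (2 * \<rho>) \<subseteq> \<Omega> \<longrightarrow>
      (\<integral>\<^sup>+x. ennreal (excess 0 (u x) powr p) * indicator (ball z (2 * \<rho>)) x \<partial>lborel)
        \<le> ennreal (c * \<rho> ^ DIM('a) * M powr p) \<longrightarrow>
      (\<integral>\<^sup>+y. ennreal (excess 0 (u y) powr (p - 1) * frac_kernel (p * s) (y - z)) * indicator (- ball z \<rho>) y \<partial>lborel)
        \<le> ennreal (\<rho> powr (- (p * s)) * M powr (p - 1)) \<longrightarrow>
      (AE x in lborel. x \<in> ball z \<rho> \<longrightarrow> u x \<le> M)"
proof -
  let ?n = "DIM('a)" and ?J = "frac_kernel (p * s) :: 'a \<Rightarrow> real" and ?vol = "unit_ball_vol (real DIM('a))"
  have vol: "0 < ?vol" by simp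
  have a: "0 < p * s" using ps by simp
  obtain C3 where C3: "C3 > 0" "\<And>L. 0 < L \<Longrightarrow> (\<integral>\<^sup>+h. ennreal (min 1 (L * norm h) powr p * ?J h) \<partial>lborel)
      \<le> ennreal (C3 * L powr (p * s))"
    using frac_kernel_truncated[where 'a = 'a, of s p] ps by auto
  \<comment> \<open>\<open>e\<close> is the growth in \<open>X\<close> of the factor of one step:
    \<open>n + p * s\<close> from the ratio \<open>\<sigma> / d\<close> and \<open>p - 1\<close>
    from \<open>(2 * t) powr (1 - p)\<close>. The near term grows only like
    \<open>X powr (p * s)\<close>, which is no worse.\<close>
  define e where "e = real ?n + p * s + p - 1"
  \<comment> \<open>Taking \<open>R\<close> proportional to \<open>X powr (- (e / (p * s)))\<close>
    makes \<open>R powr (p * s)\<close> cancel \<open>X powr e\<close>. Then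
    \<open>R ^ n * t powr p\<close> decays exactly like \<open>X powr (- g)\<close>, so
    \<open>g\<close> is the decay rate that the induction has to reproduce.\<close>
  define g where "g = p + e / (p * s) * real ?n"
  \<comment> \<open>The numbers come from \<open>d = \<rho> / (4 * X)\<close>,
    \<open>\<sigma> / d \<le> 8 * X\<close> and \<open>2 * t = M / (4 * X)\<close>.\<close>
  define B where "B = 2 * C3 * 4 powr (p * s) + 8 powr (real ?n + p * s) * 4 powr (p - 1)"
  define D where "D = C1 * 2 powr p * 2 / ?vol * B"
  \<comment> \<open>The entry 1/4 ensures \<open>R \<le> d\<close>; the other entry makes the factor
    of one step at most \<open>2 powr (- g)\<close>, which is what doubling \<open>X\<close>
    requires.\<close>
  define \<kappa> where "\<kappa> = min (1 / 4) ((2 powr (- g) / D) powr (1 / (p * s)))"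
  \<comment> \<open>With this value the smallness hypothesis of \<open>degiorgi_step\<close>
    coincides with the induction hypothesis, see \<open>Rn\<close> below.\<close>
  define c where "c = ?vol / 2 * \<kappa> ^ ?n * (1 / 8) powr p"
  have e: "p * s \<le> e" "0 < e"
  proof -
    show "p * s \<le> e" using ps by (simp add: e_def)
    then show "0 < e" using a by linarith
  qed
  have g: "0 < g" using e ps a unfolding g_def by (intro add_pos_nonneg mult_nonneg_nonneg divide_nonneg_pos less_imp_le[OF e(2)] a) (use ps in auto)
  have B: "0 < B" using C3 by (auto simp: B_def intro!: add_pos_pos)
  have D: "0 < D" using B C1 vol by (simp add: D_def)
  have \<kappa>: "0 < \<kappa>" "\<kappa> \<le> 1 / 4" "D * \<kappa> powr (p * s) \<le> 2 powr (- g)"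
  proof -
    show "0 < \<kappa>" "\<kappa> \<le> 1 / 4" using D by (auto simp: \<kappa>_def)
    have "\<kappa> powr (p * s) \<le> ((2 powr (- g) / D) powr (1 / (p * s))) powr (p * s)"
      using \<open>0 < \<kappa>\<close> a by (intro powr_mono2) (auto simp: \<kappa>_def)
    also have "\<dots> = 2 powr (- g) / D" using ps D by (simp add: powr_powr)
    finally show "D * \<kappa> powr (p * s) \<le> 2 powr (- g)" using D by (simp add: field_simps)
  qed
  have c: "0 < c" using vol \<kappa> by (simp add: c_def)
  show ?thesis
  proof (intro exI[of _ c] conjI allI impI)
    fix \<Omega> :: "'a set" and u z \<rho> M
    assume dg: "degiorgi_class s p C1 \<Omega> u" and \<rho>: "0 < \<rho>" and M: "0 < M" and sub: "ball z (2 * \<rho>) \<subseteq> \<Omega>"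
      and init: "(\<integral>\<^sup>+x. ennreal (excess 0 (u x) powr p) * indicator (ball z (2 * \<rho>)) x \<partial>lborel)
        \<le> ennreal (c * \<rho> ^ ?n * M powr p)"
      and far: "(\<integral>\<^sup>+y. ennreal (excess 0 (u y) powr (p - 1) * ?J (y - z)) * indicator (- ball z \<rho>) y \<partial>lborel)
        \<le> ennreal (\<rho> powr (- (p * s)) * M powr (p - 1))"
    have [measurable]: "u \<in> borel_measurable borel" using dg by (simp add: degiorgi_class_def)
    have [measurable]: "ball x e \<in> sets borel" for x :: 'a and e by simp
    \<comment> \<open>\<open>X = 1\<close> gives level 0 and radius \<open>2 * \<rho>\<close>. One
      step doubles \<open>X\<close>: the choices \<open>t = M / (8 * X)\<close> and
      \<open>d = \<rho> / (4 * X)\<close> make \<open>4 * t\<close> and \<open>2 * d\<close> exactly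
      the change of level and of radius.\<close>
    define Y where "Y X = (\<integral>\<^sup>+x. ennreal (excess (M * (1 - 1 / X)) (u x) powr p) * indicator (ball z (\<rho> * (1 + 1 / X))) x \<partial>lborel)" for X
    have step: "Y (2 * X) \<le> ennreal (c * \<rho> ^ ?n * M powr p * (2 * X) powr (- g))"
      if X: "1 \<le> X" and IH: "Y X \<le> ennreal (c * \<rho> ^ ?n * M powr p * X powr (- g))" for X
    proof -
      define R where "R = \<rho> * \<kappa> * X powr (- (e / (p * s)))"
      define d where "d = \<rho> / (4 * X)"
      define t where "t = M / (8 * X)"
      define \<sigma> where "\<sigma> = \<rho> * (1 + 1 / X)"
      define k where "k = M * (1 - 1 / X)"
      have pos: "0 < R" "0 < d" "0 < t" using X \<rho> M \<kappa> by (auto simp: R_def d_def t_def)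
      have "R \<le> d"
      proof -
        have "X powr (- (e / (p * s))) \<le> X powr (- 1)"
          using X e a by (intro powr_mono) auto
        then have "\<kappa> * X powr (- (e / (p * s))) \<le> 1 / 4 * (1 / X)"
          using \<kappa> X by (intro mult_mono) (auto simp: powr_minus_divide)
        then have "\<rho> * (\<kappa> * X powr (- (e / (p * s)))) \<le> \<rho> * (1 / 4 * (1 / X))"
          using \<rho> by (intro mult_left_mono) auto
        then show ?thesis by (simp add: R_def d_def mult.assoc)
      qed
      have Rn: "?vol / 2 * R ^ ?n * t powr p = c * \<rho> ^ ?n * M powr p * X powr (- g)"
      proof -
        have "R ^ ?n = \<rho> ^ ?n * \<kappa> ^ ?n * X powr (- (e / (p * s) * real ?n))"
          using X by (simp add: R_def power_mult_distrib powr_power mult.commute)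
        moreover have "t powr p = M powr p * (1 / 8) powr p * X powr (- p)"
          by (simp add: t_def powr_mult powr_divide powr_minus_divide)
        moreover have "X powr (- (e / (p * s) * real ?n)) * X powr (- p) = X powr (- g)"
          by (simp add: g_def powr_add[symmetric] algebra_simps)
        ultimately show ?thesis by (simp add: c_def mult_ac)
      qed
      have "ball z \<sigma> \<subseteq> ball z (2 * \<rho>)"
        using X \<rho> by (intro subset_ball) (auto simp: \<sigma>_def field_simps)
      then have sub': "ball z \<sigma> \<subseteq> \<Omega>" using sub by auto
      have "ball z \<rho> \<subseteq> ball z \<sigma>" using X \<rho> by (intro subset_ball) (auto simp: \<sigma>_def field_simps)
      then have far': "(\<integral>\<^sup>+y. ennreal (excess 0 (u y) powr (p - 1) * ?J (y - z)) * indicator (- ball z \<sigma>) y \<partial>lborel)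
          \<le> ennreal (\<rho> powr (- (p * s)) * M powr (p - 1))"
        by (intro order.trans[OF _ far] nn_integral_mono mult_left_mono) (auto simp: indicator_def)
      let ?F = "2 * C3 * d powr (- (p * s)) + (\<sigma> / d) powr (real ?n + p * s) * (\<rho> powr (- (p * s)) * M powr (p - 1)) * (2 * t) powr (1 - p)"
      have "(\<integral>\<^sup>+x. ennreal (excess (k + 4 * t) (u x) powr p) * indicator (ball z (\<sigma> - 2 * d)) x \<partial>lborel)
        \<le> ennreal (C1 * 2 powr p * 2 / ?vol * R powr (p * s) * ?F)
          * (\<integral>\<^sup>+x. ennreal (excess k (u x) powr p) * indicator (ball z \<sigma>) x \<partial>lborel)"
      proof (rule degiorgi_step[OF dg])
        show "0 \<le> k" using X M by (simp add: k_def)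
        show "2 * d < \<sigma>" using X \<rho> by (simp add: d_def \<sigma>_def field_simps add_pos_nonneg)
        show "(\<integral>\<^sup>+h. ennreal (min 1 (1 / d * norm h) powr p * ?J h) \<partial>lborel) \<le> ennreal (C3 * d powr (- (p * s)))"
          using C3(2)[of "1 / d"] pos by (simp add: powr_divide powr_minus_divide)
        show "(\<integral>\<^sup>+x. ennreal (excess k (u x) powr p) * indicator (ball z \<sigma>) x \<partial>lborel)
            \<le> ennreal (?vol / 2 * R ^ ?n * t powr p)"
          using IH unfolding Rn Y_def k_def \<sigma>_def .
      qed (use ps pos \<open>R \<le> d\<close> sub' far' C1 C3 in auto)
      moreover have "k + 4 * t = M * (1 - 1 / (2 * X))" "\<sigma> - 2 * d = \<rho> * (1 + 1 / (2 * X))"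
        using X by (auto simp: k_def t_def \<sigma>_def d_def field_simps)
      ultimately have 1: "Y (2 * X) \<le> ennreal (C1 * 2 powr p * 2 / ?vol * R powr (p * s) * ?F) * Y X"
        by (simp add: Y_def k_def \<sigma>_def)
      have F: "?F \<le> \<rho> powr (- (p * s)) * B * X powr e"
      proof -
        have "d powr (- (p * s)) = \<rho> powr (- (p * s)) * 4 powr (p * s) * X powr (p * s)"
          using X \<rho> by (simp add: d_def powr_divide powr_mult powr_minus_divide)
        also have "\<dots> \<le> \<rho> powr (- (p * s)) * 4 powr (p * s) * X powr e"
          using X e by (intro mult_left_mono powr_mono) auto
        finally have near: "2 * C3 * d powr (- (p * s)) \<le> 2 * C3 * (\<rho> powr (- (p * s)) * 4 powr (p * s) * X powr e)"
          using C3 by (intro mult_left_mono) auto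
        have far1: "(\<sigma> / d) powr (real ?n + p * s) * (\<rho> powr (- (p * s)) * M powr (p - 1)) * (2 * t) powr (1 - p)
           \<le> (8 * X) powr (real ?n + p * s) * (\<rho> powr (- (p * s)) * M powr (p - 1)) * (2 * t) powr (1 - p)"
          using X \<rho> a by (intro mult_right_mono powr_mono2) (auto simp: \<sigma>_def d_def field_simps)
        have far2: "(8 * X) powr (real ?n + p * s) * (\<rho> powr (- (p * s)) * M powr (p - 1)) * (2 * t) powr (1 - p)
            = \<rho> powr (- (p * s)) * (8 powr (real ?n + p * s) * 4 powr (p - 1)) * X powr e"
        proof -
          have "2 * t = M / (4 * X)" by (simp add: t_def)
          then have t: "(2 * t) powr (1 - p) = M powr (1 - p) * 4 powr (p - 1) * X powr (p - 1)"
            using M X powr_minus_divide[of "4 * X" "1 - p"]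
            by (simp add: powr_divide powr_mult mult.assoc)
          have "M powr (p - 1) * M powr (1 - p) = 1" using M by (simp add: powr_add[symmetric])
          moreover have "X powr (real ?n + p * s) * X powr (p - 1) = X powr e"
            by (simp add: e_def powr_add[symmetric] add_diff_eq)
          moreover have "(8 * X) powr (real ?n + p * s) = 8 powr (real ?n + p * s) * X powr (real ?n + p * s)"
            by (rule powr_mult)
          moreover have "a * b * (r * m) * (m' * f * x) = r * (a * f) * (b * x) * (m * m')" for a b r m m' f x :: real
            by simp
          ultimately show ?thesis unfolding t by (simp only: mult_1_right)
        qed
        have "?F \<le> 2 * C3 * (\<rho> powr (- (p * s)) * 4 powr (p * s) * X powr e)
            + \<rho> powr (- (p * s)) * (8 powr (real ?n + p * s) * 4 powr (p - 1)) * X powr e"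
          by (intro add_mono near order.trans[OF far1 eq_refl[OF far2]])
        also have "\<dots> = \<rho> powr (- (p * s)) * B * X powr e"
          by (simp only: B_def distrib_left distrib_right mult_ac)
        finally show ?thesis .
      qed
      have "C1 * 2 powr p * 2 / ?vol * R powr (p * s) * ?F \<le> C1 * 2 powr p * 2 / ?vol * R powr (p * s) * (\<rho> powr (- (p * s)) * B * X powr e)"
        using C1 vol by (intro mult_left_mono[OF F]) auto
      also have "\<dots> = D * \<kappa> powr (p * s)"
      proof -
        have "R powr (p * s) = \<rho> powr (p * s) * \<kappa> powr (p * s) * X powr (- e)"
          using ps by (simp add: R_def powr_mult powr_powr)
        moreover have "\<rho> powr (p * s) * \<rho> powr (- (p * s)) = 1" "X powr (- e) * X powr e = 1"
          using X \<rho> by (simp_all add: powr_add[symmetric])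
        ultimately show ?thesis by (simp add: D_def mult_ac)
      qed
      also have "\<dots> \<le> 2 powr (- g)" by (rule \<kappa>)
      finally have "Y (2 * X) \<le> ennreal (2 powr (- g)) * ennreal (c * \<rho> ^ ?n * M powr p * X powr (- g))"
        by (intro order.trans[OF 1] mult_mono IH ennreal_leI) auto
      also have "\<dots> = ennreal (c * \<rho> ^ ?n * M powr p * (2 * X) powr (- g))"
        using c \<rho> by (simp add: ennreal_mult[symmetric] powr_mult mult_ac)
      finally show ?thesis .
    qed
    have Y: "Y (2 ^ j) \<le> ennreal (c * \<rho> ^ ?n * M powr p * (2 ^ j) powr (- g))" for j
    proof (induction j)
      case 0
      then show ?case using init by (simp add: Y_def mult.commute)
    next
      case (Suc j)
      show ?case using step[OF _ Suc.IH] by simp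
    qed
    let ?I = "\<integral>\<^sup>+x. ennreal (excess M (u x) powr p) * indicator (ball z \<rho>) x \<partial>lborel"
    have IY: "?I \<le> Y (2 ^ j)" for j
    proof -
      have k: "M * (1 - 1 / 2 ^ j) \<le> M" and r: "\<rho> \<le> \<rho> * (1 + 1 / 2 ^ j)"
        using M \<rho> by (auto simp: mult_le_cancel_left1 mult_le_cancel_left2)
      have "excess M (u x) powr p \<le> excess (M * (1 - 1 / 2 ^ j)) (u x) powr p" for x
        using ps by (intro powr_mono2 excess_antimono k) auto
      moreover have "ball z \<rho> \<subseteq> ball z (\<rho> * (1 + 1 / 2 ^ j))" using r by (rule subset_ball)
      ultimately show ?thesis unfolding Y_def
        by (intro nn_integral_mono) (auto simp: indicator_def intro!: ennreal_leI)
    qed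
    have "(\<lambda>j. c * \<rho> ^ ?n * M powr p * (2 ^ j) powr (- g)) \<longlonglongrightarrow> 0"
    proof -
      have "(2 ^ j) powr (- g) = (2 powr (- g)) ^ j" for j
        by (simp add: powr_power powr_realpow[symmetric] powr_powr mult.commute)
      moreover have "(\<lambda>j. (2 powr (- g)) ^ j) \<longlonglongrightarrow> 0"
        using g by (intro LIMSEQ_realpow_zero) (auto simp: powr_less_one)
      ultimately show ?thesis by (simp add: tendsto_mult_right_zero)
    qed
    then have "(\<lambda>j. ennreal (c * \<rho> ^ ?n * M powr p * (2 ^ j) powr (- g))) \<longlonglongrightarrow> ennreal 0"
      by (rule tendsto_ennrealI)
    then have "?I \<le> ennreal 0"
      by (rule tendsto_lowerbound) (use IY Y in \<open>auto intro: order.trans intro!: always_eventually\<close>)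
    then have "?I = 0" by simp
    then have "AE x in lborel. ennreal (excess M (u x) powr p) * indicator (ball z \<rho>) x = 0"
      by (subst (asm) nn_integral_0_iff_AE) auto
    then show "AE x in lborel. x \<in> ball z \<rho> \<longrightarrow> u x \<le> M"
    proof eventually_elim
      case (elim x)
      then show ?case by (auto simp: indicator_def excess_def max_def split: if_splits)
    qed
  qed (rule c)
qed

section \<open>Lebesgue measure on products and potentials\<close>

text \<open>A consequence of completeness; it carries measurability from Borel representatives back
  to \<open>u\<close> and \<open>K\<close>.\<close>

lemma lebesgue_measurable_AE_cong:
  assumes f: "f \<in> borel_measurable lebesgue" and ae: "AE x in lebesgue. f x = g x"
  shows "g \<in> borel_measurable lebesgue"
proof (rule measurableI)
  fix A :: "'b set" assume A: "A \<in> sets borel"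
  have "f -` A \<inter> space lebesgue \<in> sets lebesgue" using f A by (rule measurable_sets)
  then show "g -` A \<inter> space lebesgue \<in> sets lebesgue"
    by (rule completion.in_sets_AE[rotated]) (use ae in \<open>auto elim!: eventually_mono\<close>)
qed simp

lemma AE_lebesgue_null_set:
  assumes "AE x in lebesgue. P x"
  shows "\<exists>N\<in>null_sets lborel. \<forall>x. x \<notin> N \<longrightarrow> P x"
proof -
  have "AE x in lborel. P x" using assms by (simp add: AE_completion_iff)
  then obtain N where "{x \<in> space lborel. \<not> P x} \<subseteq> N" "emeasure lborel N = 0" "N \<in> sets lborel"
    by (rule AE_E)
  then show ?thesis by (intro bexI[of _ N]) auto
qed

text \<open>Lebesgue measure on the product is the completion of the product of the Borel measures,
  not the product of the completions. Sections are therefore examined on a Borel set enclosing the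
  exceptional set.\<close>

lemma AE_lborel_prod:
  fixes P :: "'a::euclidean_space \<times> 'b::euclidean_space \<Rightarrow> bool"
  assumes N: "{z. \<not> P z} \<subseteq> N" "N \<in> sets borel" and ae: "AE x in lborel. AE y in lborel. (x, y) \<notin> N"
  shows "AE z in lebesgue. P z"
proof -
  have "{z \<in> space (lborel \<Otimes>\<^sub>M lborel). z \<notin> N} = - N" by (auto simp: lborel_prod)
  moreover have "- N \<in> sets (lborel \<Otimes>\<^sub>M lborel)" by (subst lborel_prod) (use N in auto)
  ultimately have "AE z in lborel \<Otimes>\<^sub>M lborel. z \<notin> N"
    using ae by (intro lborel_pair.AE_pair_measure) auto
  then have "AE z in lborel. z \<notin> N" by (subst (asm) lborel_prod)
  then have "AE z in lborel. P z" by (rule eventually_mono) (use N in auto)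
  then show ?thesis by (rule AE_completion)
qed

lemma AE_lebesgue_fst:
  fixes P :: "'a::euclidean_space \<Rightarrow> bool"
  assumes "AE x in lebesgue. P x"
  shows "AE z in lebesgue. P (fst (z :: 'a \<times> 'b::euclidean_space))"
proof -
  obtain N where N: "N \<in> null_sets lborel" "\<And>x. x \<notin> N \<Longrightarrow> P x" 
    using AE_lebesgue_null_set[OF assms] by blast
  have [measurable]: "N \<in> sets borel" using N by auto
  have "fst -` N \<inter> space borel \<in> sets (borel :: ('a \<times> 'b) measure)"
    by (rule measurable_sets[where A = borel]) (auto simp: borel_prod[symmetric])
  then show ?thesis using AE_not_in[OF N(1)] N(2)
    by (intro AE_lborel_prod[of _ "fst -` N"]) auto
qed

lemma AE_lebesgue_snd:
  fixes P :: "'b::euclidean_space \<Rightarrow> bool"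
  assumes "AE x in lebesgue. P x"
  shows "AE z in lebesgue. P (snd (z :: 'a::euclidean_space \<times> 'b))"
proof -
  obtain N where N: "N \<in> null_sets lborel" "\<And>x. x \<notin> N \<Longrightarrow> P x" 
    using AE_lebesgue_null_set[OF assms] by blast
  have [measurable]: "N \<in> sets borel" using N by auto
  have "snd -` N \<inter> space borel \<in> sets (borel :: ('a \<times> 'b) measure)"
    by (rule measurable_sets[where A = borel]) (auto simp: borel_prod[symmetric])
  then show ?thesis using AE_not_in[OF N(1)] N(2)
    by (intro AE_lborel_prod[of _ "snd -` N"]) auto
qed

text \<open>Each section of the preimage of a null set under subtraction is a reflected translate of
  that set, hence null.\<close>

lemma AE_lebesgue_diff:
  fixes P :: "'a::euclidean_space \<Rightarrow> bool"
  assumes "AE x in lebesgue. P x"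
  shows "AE z in lebesgue. P (fst z - snd z)"
proof -
  obtain N where N: "N \<in> null_sets lborel" "\<And>x. x \<notin> N \<Longrightarrow> P x" 
    using AE_lebesgue_null_set[OF assms] by blast
  have [measurable]: "N \<in> sets borel" using N by auto
  have "(\<lambda>z::'a\<times>'a. fst z - snd z) -` N \<inter> space borel \<in> sets borel"
    by (rule measurable_sets[where A = borel]) (auto simp: borel_prod[symmetric])
  moreover have "AE y in lborel. x - y \<notin> N" for x
  proof -
    have "(\<integral>\<^sup>+y. indicator N (x - y) \<partial>lborel) = (\<integral>\<^sup>+y. indicator N y \<partial>lborel)"
      by (rule nn_integral_lborel_diff) measurable
    also have "\<dots> = 0" using N by auto
    finally have "AE y in lborel. indicator N (x - y) = (0 :: ennreal)"
      by (subst (asm) nn_integral_0_iff_AE) auto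
    then show ?thesis by (auto elim!: eventually_mono split: split_indicator_asm)
  qed
  ultimately show ?thesis using N(2)
    by (intro AE_lborel_prod[of _ "(\<lambda>z. fst z - snd z) -` N"]) auto
qed

text \<open>Composing a merely Lebesgue measurable function with a continuous map can destroy
  measurability. Subtraction pulls null sets back to null sets, so \<open>K\<close> may be replaced
  by a Borel version.\<close>

lemma lebesgue_measurable_diff:
  fixes K :: "'a::euclidean_space \<Rightarrow> real"
  assumes "K \<in> borel_measurable lebesgue"
  shows "(\<lambda>z. K (fst z - snd z)) \<in> borel_measurable lebesgue"
proof -
  obtain K' where K': "K' \<in> borel_measurable lborel" "AE x in lborel. K x = K' x"
    using completion_ex_borel_measurable_real[OF assms] by blast
  have "(\<lambda>z::'a\<times>'a. K' (fst z - snd z)) \<in> borel_measurable borel"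
    using K'(1) by (auto simp: borel_prod[symmetric])
  then have "(\<lambda>z. K' (fst z - snd z)) \<in> borel_measurable lebesgue"
    by (intro measurable_completion) auto
  moreover have "AE z in lebesgue. K' (fst z - snd z) = K (fst z - snd z)"
    using K'(2) by (intro AE_lebesgue_diff) (auto intro!: AE_completion elim!: eventually_mono)
  ultimately show ?thesis by (rule lebesgue_measurable_AE_cong)
qed

section \<open>Nonnegativity of the potential\<close>

lemma cube_cover:
  fixes E :: "(real ^ 'n) set"
  assumes E: "E \<in> sets lebesgue" "E \<notin> null_sets lebesgue"
  shows "\<exists>Q\<in>cubes. E \<inter> Q \<notin> null_sets lebesgue"
proof (rule ccontr)
  assume *: "\<not> ?thesis"
  define Q where "Q m = cbox (\<chi> i. - real (Suc m)) (\<chi> i. real (Suc m) :: real ^ 'n)" for m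
  have "Q m = cbox (\<chi> i. - real (Suc m)) ((\<chi> i. - real (Suc m)) + (\<chi> i. 2 * real (Suc m)))" for m
    by (auto simp: Q_def vec_eq_iff intro!: arg_cong2[where f = cbox])
  then have "Q m \<in> cubes" for m unfolding cubes_def by fastforce
  then have "E \<inter> Q m \<in> null_sets lebesgue" for m using * by blast
  then have "(\<Union>m. E \<inter> Q m) \<in> null_sets lebesgue" by (rule null_sets_UN)
  moreover have "(\<Union>m. E \<inter> Q m) = E"
  proof -
    have "x \<in> Q (nat \<lceil>norm x\<rceil>)" for x
    proof -
      define r where "r = real (Suc (nat \<lceil>norm x\<rceil>))"
      have "\<bar>x $ i\<bar> \<le> r" for i
        using component_le_norm_cart[of x i] real_nat_ceiling_ge[of "norm x"]
        unfolding r_def of_nat_Suc by linarith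
      then have "- r \<le> x $ i" "x $ i \<le> r" for i
        by (simp_all only: abs_le_iff minus_le_iff)
      then show ?thesis unfolding Q_def r_def[symmetric] by (simp add: mem_box_cart)
    qed
    then show ?thesis by blast
  qed
  ultimately show False using E by simp
qed

text \<open>\<open>V\<^sub>-\<close> and \<open>V\<^sub>+\<close> have disjoint supports, so the weight
  \<open>V\<^sub>+\<^sup>b\<^sup>,\<^sup>i\<close> vanishes wherever \<open>V\<^sub>- > 0\<close>; the two-weight condition then forces \<open>V\<^sub>- = 0\<close>.\<close>

lemma potentials_AE_nonneg:
  assumes V: "V \<in> potentials q"
  shows "AE x in lebesgue. 0 \<le> V x"
proof -
  obtain b where b: "A1_pair (neg_part V) (truncated_potential V b 1)"
    using V unfolding potentials_def by blast
  let ?w = "truncated_potential V b 1" and ?E = "{x. 0 < neg_part V x}"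
  have v_meas: "neg_part V \<in> borel_measurable lebesgue" and w_meas: "?w \<in> borel_measurable lebesgue"
    using b by (auto simp: A1_pair_def weight_def Lloc_def)
  have E: "?E \<in> sets lebesgue"
  proof -
    have "neg_part V -` {0<..} \<inter> space lebesgue \<in> sets lebesgue"
      using v_meas by (rule measurable_sets) auto
    then show ?thesis by (simp add: vimage_def)
  qed
  have "?E \<in> null_sets lebesgue"
  proof (rule ccontr)
    assume "?E \<notin> null_sets lebesgue"
    then obtain Q where Q: "Q \<in> cubes" and EQ: "?E \<inter> Q \<notin> null_sets lebesgue"
      using cube_cover[OF E] by blast
    obtain a l where al: "Q = cbox a (a + (\<chi> i. l))" "0 < l" using Q by (auto simp: cubes_def)
    have Q_sets: "Q \<in> sets lebesgue" using al by simp
    have finite: "emeasure lebesgue Q < \<infinity>" using al emeasure_lborel_cbox_finite by simp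
    let ?r = "restrict_space lebesgue Q"
    define S where "S = esssup ?r (\<lambda>x. inverse (ennreal (?w x)))"
    \<comment> \<open>\<open>b\<close> is positive only almost everywhere, but the positive part of
      \<open>V\<close> is 0 at such \<open>x\<close>, so the value of the quotient in front of it is
      immaterial.\<close>
    have w0: "?w x = 0" if "x \<in> ?E" for x
      using that by (simp add: truncated_potential_def pos_part_def neg_part_def max_def split: if_splits)
    have "S = \<infinity>"
    proof (rule ccontr)
      assume "S \<noteq> \<infinity>"
      have "AE x in ?r. inverse (ennreal (?w x)) \<le> S" unfolding S_def by (rule esssup_AE)
      then have "AE x in lebesgue. x \<in> Q \<longrightarrow> inverse (ennreal (?w x)) \<le> S"
        using Q_sets by (simp add: AE_restrict_space_iff)
      then have "AE x in lebesgue. x \<notin> ?E \<inter> Q"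
      proof (rule eventually_mono)
        fix x assume x: "x \<in> Q \<longrightarrow> inverse (ennreal (?w x)) \<le> S"
        show "x \<notin> ?E \<inter> Q"
        proof
          assume "x \<in> ?E \<inter> Q"
          then have "inverse (0 :: ennreal) \<le> S" using x w0[of x] by simp
          then show False using \<open>S \<noteq> \<infinity>\<close> by (simp add: top_unique)
        qed
      qed
      then have "?E \<inter> Q \<in> null_sets lebesgue"
        using E Q_sets by (simp add: completion.null_sets_iff_AE)
      then show False using EQ by simp
    qed
    have int_pos: "(\<integral>\<^sup>+x\<in>Q. ennreal (neg_part V x) \<partial>lebesgue) \<noteq> 0"
    proof
      assume "(\<integral>\<^sup>+x\<in>Q. ennreal (neg_part V x) \<partial>lebesgue) = 0"
      then have "AE x in lebesgue. ennreal (neg_part V x) * indicator Q x = 0"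
        using v_meas Q_sets by (subst (asm) nn_integral_0_iff_AE) auto
      then have "AE x in lebesgue. x \<notin> ?E \<inter> Q"
        by (rule eventually_mono) (auto simp: ennreal_eq_0_iff split: split_indicator_asm)
      then have "?E \<inter> Q \<in> null_sets lebesgue"
        using E Q_sets by (simp add: completion.null_sets_iff_AE)
      then show False using EQ by simp
    qed
    have "(SUP Q\<in>cubes. (\<integral>\<^sup>+x\<in>Q. ennreal (neg_part V x) \<partial>lebesgue) / emeasure lebesgue Q
        * esssup (restrict_space lebesgue Q) (\<lambda>x. inverse (ennreal (?w x)))) < \<infinity>"
      using b by (simp add: A1_pair_def)
    then have "(\<integral>\<^sup>+x\<in>Q. ennreal (neg_part V x) \<partial>lebesgue) / emeasure lebesgue Q * S < \<infinity>"
      unfolding S_def by (rule le_less_trans[OF SUP_upper[OF Q]])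
    moreover have "(\<integral>\<^sup>+x\<in>Q. ennreal (neg_part V x) \<partial>lebesgue) / emeasure lebesgue Q \<noteq> 0"
      using int_pos finite by (auto simp: ennreal_divide_eq_0_iff)
    ultimately show False using \<open>S = \<infinity>\<close> by (simp add: ennreal_mult_eq_top_iff less_top[symmetric])
  qed
  then have "AE x in lebesgue. x \<notin> ?E" by (rule AE_not_in)
  then show ?thesis by (rule eventually_mono) (simp add: neg_part_def max_def split: if_splits)
qed

section \<open>The Gagliardo quotient in terms of the model kernel\<close>

lemma frac_kernel_cart:
  "frac_kernel \<alpha> (h :: real ^ 'n) = 1 / norm h powr (real CARD('n) + \<alpha>)"
  by (simp add: frac_kernel_def powr_minus_divide del: minus_add_distrib)

lemma gagliardo_eq:
  "gagliardo s p v z = \<bar>v (fst z) - v (snd z)\<bar> powr p * frac_kernel (p * s) (fst z - snd z)"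
  by (simp add: gagliardo_def frac_kernel_cart split_beta)

lemma gagliardo_measurable:
  fixes v :: "real ^ 'n \<Rightarrow> real"
  assumes "v \<in> borel_measurable borel"
  shows "gagliardo s p v \<in> borel_measurable borel"
  using assms unfolding gagliardo_eq[abs_def] borel_prod[symmetric] by measurable

section \<open>Energy inequality for subsolutions\<close>

text \<open>Bridge between the iterated integrals of \<open>degiorgi_class\<close> and the single
  integral over the product space in \<open>weak_subsolution\<close>.\<close>

lemma nn_integral_iterated_lebesgue:
  fixes f :: "'a::euclidean_space \<times> 'b::euclidean_space \<Rightarrow> ennreal"
  assumes "f \<in> borel_measurable borel"
  shows "(\<integral>\<^sup>+x. \<integral>\<^sup>+y. f (x, y) \<partial>lborel \<partial>lborel) = (\<integral>\<^sup>+z. f z \<partial>lebesgue)"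
proof -
  have "f \<in> borel_measurable (lborel \<Otimes>\<^sub>M lborel)" using assms by (subst lborel_prod) simp
  then have "(\<integral>\<^sup>+x. \<integral>\<^sup>+y. f (x, y) \<partial>lborel \<partial>lborel) = (\<integral>\<^sup>+z. f z \<partial>(lborel \<Otimes>\<^sub>M lborel))"
    by (rule lborel.nn_integral_fst)
  then show ?thesis by (subst (asm) lborel_prod) (simp add: nn_integral_completion)
qed

text \<open>By translation and reflection invariance the inner integral does not depend on the first
  variable, which decouples the factors.\<close>

lemma nn_integral_convolution_fst:
  fixes f g :: "'a::euclidean_space \<Rightarrow> ennreal"
  assumes f [measurable]: "f \<in> borel_measurable borel" and g [measurable]: "g \<in> borel_measurable borel"
  shows "(\<integral>\<^sup>+z. f (fst z) * g (fst z - snd z) \<partial>lebesgue) = (\<integral>\<^sup>+x. f x \<partial>lborel) * (\<integral>\<^sup>+x. g x \<partial>lborel)"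
proof -
  have "(\<lambda>z. f (fst z) * g (fst z - snd z)) \<in> borel_measurable borel"
    by (subst borel_prod[symmetric]) measurable
  from nn_integral_iterated_lebesgue[OF this]
  have "(\<integral>\<^sup>+z. f (fst z) * g (fst z - snd z) \<partial>lebesgue) = (\<integral>\<^sup>+x. \<integral>\<^sup>+y. f x * g (x - y) \<partial>lborel \<partial>lborel)"
    by simp
  also have "\<dots> = (\<integral>\<^sup>+x. f x * (\<integral>\<^sup>+y. g y \<partial>lborel) \<partial>lborel)"
    by (simp add: nn_integral_cmult nn_integral_lborel_diff[OF g])
  also have "\<dots> = (\<integral>\<^sup>+x. f x \<partial>lborel) * (\<integral>\<^sup>+x. g x \<partial>lborel)"
    by (rule nn_integral_multc) simp
  finally show ?thesis .
qed

lemma nn_integral_swap_lebesgue: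
  fixes f :: "'a::euclidean_space \<times> 'b::euclidean_space \<Rightarrow> ennreal"
  assumes "f \<in> borel_measurable borel"
  shows "(\<integral>\<^sup>+z. f (snd z, fst z) \<partial>lebesgue) = (\<integral>\<^sup>+z. f z \<partial>lebesgue)"
proof -
  have f: "f \<in> borel_measurable (lborel \<Otimes>\<^sub>M lborel)" using assms by (subst lborel_prod) simp
  have "(\<lambda>z. f (snd z, fst z)) \<in> borel_measurable borel"
    using assms by (auto simp: borel_prod[symmetric])
  from nn_integral_iterated_lebesgue[OF this]
  have "(\<integral>\<^sup>+z. f (snd z, fst z) \<partial>lebesgue) = (\<integral>\<^sup>+y. \<integral>\<^sup>+x. f (x, y) \<partial>lborel \<partial>lborel)"
    by simp
  also have "\<dots> = (\<integral>\<^sup>+x. \<integral>\<^sup>+y. f (x, y) \<partial>lborel \<partial>lborel)"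
    using f by (rule lborel_pair.Fubini)
  also have "\<dots> = (\<integral>\<^sup>+z. f z \<partial>lebesgue)" using assms by (rule nn_integral_iterated_lebesgue)
  finally show ?thesis .
qed

text \<open>If \<open>N\<close> has infinite integral there is nothing to show; otherwise
  \<open>P\<close> lies between 0 and \<open>F + N\<close>, hence is integrable, and the integrals
  may be compared as reals. Finiteness of the energy terms thus never has to be established
  beforehand.\<close>

lemma nn_integral_le_of_integral_nonpos:
  fixes P N F :: "'a \<Rightarrow> real"
  assumes F: "integrable M F" "(\<integral>x. F x \<partial>M) \<le> 0"
    and P: "P \<in> borel_measurable M" "\<And>x. 0 \<le> P x" and N: "N \<in> borel_measurable M" "\<And>x. 0 \<le> N x"
    and le: "\<And>x. P x - N x \<le> F x"
  shows "(\<integral>\<^sup>+x. P x \<partial>M) \<le> (\<integral>\<^sup>+x. N x \<partial>M)"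
proof (cases "(\<integral>\<^sup>+x. N x \<partial>M) < \<infinity>")
  case True
  then have iN: "integrable M N" using N by (intro integrableI_nonneg) auto
  have iP: "integrable M P"
  proof (rule Bochner_Integration.integrable_bound)
    show "integrable M (\<lambda>x. F x + N x)" using F iN by simp
    have "\<bar>P x\<bar> \<le> \<bar>F x + N x\<bar>" for x using le[of x] P(2)[of x] by linarith
    then show "AE x in M. norm (P x) \<le> norm (F x + N x)" by simp
  qed (rule P)
  have "(\<integral>x. P x \<partial>M) \<le> (\<integral>x. F x + N x \<partial>M)"
  proof (rule integral_mono)
    show "P x \<le> F x + N x" for x using le[of x] by linarith
  qed (use iP iN F in auto)
  also have "\<dots> = (\<integral>x. F x \<partial>M) + (\<integral>x. N x \<partial>M)" using F iN by simp
  also have "\<dots> \<le> (\<integral>x. N x \<partial>M)" using F by simp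
  finally show ?thesis using iP iN P N by (simp add: nn_integral_eq_integral ennreal_leI)
qed (simp add: less_top[symmetric])

lemma borel_representative:
  fixes u :: "real ^ 'n \<Rightarrow> real"
  assumes sub: "weak_subsolution s p K V \<Omega> g u" and V: "V \<in> potentials q"
    and K: "K \<in> borel_measurable lebesgue" and \<Omega>: "open \<Omega>"
  shows "\<exists>v. v \<in> borel_measurable borel \<and> (AE x in lebesgue. u x = v x) \<and> v \<in> Y_space s p V \<Omega> \<and>
    (\<forall>\<phi>\<in>Y0_space s p V \<Omega>. \<phi> \<in> borel_measurable borel \<longrightarrow> (\<forall>x. 0 \<le> \<phi> x) \<longrightarrow> (\<forall>x. \<phi> x \<noteq> 0 \<longrightarrow> 0 \<le> v x) \<longrightarrow>
      (\<integral>z. H p (v (fst z) - v (snd z)) * (\<phi> (fst z) - \<phi> (snd z)) * K (fst z - snd z) \<partial>lebesgue) \<le> 0)"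
proof -
  have uY: "u \<in> Y_space s p V \<Omega>" using sub by (simp add: weak_subsolution_def Yg_minus_space_def)
  have u: "u \<in> borel_measurable lebesgue" using uY by (simp add: Y_space_def X_space_def)
  have V_meas: "pos_part V \<in> borel_measurable lebesgue" "neg_part V \<in> borel_measurable lebesgue"
    using V by (auto simp: potentials_def Lloc_def)
  obtain v where v_lborel: "v \<in> borel_measurable lborel" and "AE x in lborel. u x = v x"
    using completion_ex_borel_measurable_real[OF u] by blast
  then have ae: "AE x in lebesgue. u x = v x" and vb: "v \<in> borel_measurable borel"
    by (auto intro: AE_completion)
  have vl: "v \<in> borel_measurable lebesgue" using v_lborel by (rule measurable_completion)
  have ae2: "AE z in lebesgue. u (fst z) = v (fst z) \<and> u (snd z) = v (snd z)"
    using AE_lebesgue_fst[OF ae] AE_lebesgue_snd[OF ae] by eventually_elim auto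
  have \<Omega>_sets: "\<Omega> \<in> sets lebesgue" using \<Omega> by auto
  have "open (- ((- \<Omega>) \<times> (- \<Omega>)))" using \<Omega> by (intro open_Compl closed_Times closed_Compl)
  then have S_sets: "- ((- \<Omega>) \<times> (- \<Omega>)) \<in> sets lebesgue" by auto
  have gv: "gagliardo s p v \<in> borel_measurable lebesgue"
    using gagliardo_measurable[OF vb] by (intro measurable_completion) simp
  have gae: "AE z in lebesgue. gagliardo s p v z = gagliardo s p u z"
    using ae2 by eventually_elim (simp add: gagliardo_eq)
  have gu: "gagliardo s p u \<in> borel_measurable lebesgue"
    by (rule lebesgue_measurable_AE_cong[OF gv gae])
  have vY: "v \<in> Y_space s p V \<Omega>"
  proof -
    have "set_integrable lebesgue \<Omega> (\<lambda>x. \<bar>u x\<bar> powr p) = set_integrable lebesgue \<Omega> (\<lambda>x. \<bar>v x\<bar> powr p)"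
      using u vl \<Omega>_sets ae by (intro set_integrable_cong_AE) (auto elim!: eventually_mono)
    moreover have "set_integrable lebesgue \<Omega> (\<lambda>x. \<bar>u x\<bar> powr p * pos_part V x) = set_integrable lebesgue \<Omega> (\<lambda>x. \<bar>v x\<bar> powr p * pos_part V x)"
      using u vl V_meas \<Omega>_sets ae by (intro set_integrable_cong_AE) (auto elim!: eventually_mono)
    moreover have "set_integrable lebesgue \<Omega> (\<lambda>x. \<bar>u x\<bar> powr p * neg_part V x) = set_integrable lebesgue \<Omega> (\<lambda>x. \<bar>v x\<bar> powr p * neg_part V x)"
      using u vl V_meas \<Omega>_sets ae by (intro set_integrable_cong_AE) (auto elim!: eventually_mono)
    moreover have "set_integrable lebesgue (- ((- \<Omega>) \<times> (- \<Omega>))) (gagliardo s p u)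
        = set_integrable lebesgue (- ((- \<Omega>) \<times> (- \<Omega>))) (gagliardo s p v)"
      using gu gv S_sets gae by (intro set_integrable_cong_AE) (auto elim!: eventually_mono)
    ultimately show ?thesis using uY vl by (simp add: Y_space_def X_space_def LpV_def)
  qed
  have "(\<integral>z. H p (v (fst z) - v (snd z)) * (\<phi> (fst z) - \<phi> (snd z)) * K (fst z - snd z) \<partial>lebesgue) \<le> 0"
    if \<phi>: "\<phi> \<in> Y0_space s p V \<Omega>" "\<phi> \<in> borel_measurable borel" "\<And>x. 0 \<le> \<phi> x" "\<And>x. \<phi> x \<noteq> 0 \<Longrightarrow> 0 \<le> v x" for \<phi>
  proof -
    let ?F = "\<lambda>u z. H p (u (fst z) - u (snd z)) * (\<phi> (fst z) - \<phi> (snd z)) * K (fst z - snd z)"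
    have "(\<lambda>z. H p (v (fst z) - v (snd z)) * (\<phi> (fst z) - \<phi> (snd z))) \<in> borel_measurable borel"
      using vb \<phi>(2) unfolding H_def borel_prod[symmetric] by measurable
    then have "(\<lambda>z. H p (v (fst z) - v (snd z)) * (\<phi> (fst z) - \<phi> (snd z))) \<in> borel_measurable lebesgue"
      by (intro measurable_completion) simp
    then have Fv: "?F v \<in> borel_measurable lebesgue"
      using lebesgue_measurable_diff[OF K] by (rule borel_measurable_times)
    have Fae: "AE z in lebesgue. ?F v z = ?F u z" using ae2 by eventually_elim simp
    have Fu: "?F u \<in> borel_measurable lebesgue" by (rule lebesgue_measurable_AE_cong[OF Fv Fae])
    have "integral\<^sup>L lebesgue (?F v) = integral\<^sup>L lebesgue (?F u)"
      by (rule integral_cong_AE[OF Fv Fu Fae])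
    also have "\<dots> \<le> 0"
    proof -
      have "0 \<le> (\<integral>x. V x * \<bar>u x\<bar> powr (p - 2) * u x * \<phi> x \<partial>lebesgue)"
      proof (rule integral_nonneg_AE)
        show "AE x in lebesgue. 0 \<le> V x * \<bar>u x\<bar> powr (p - 2) * u x * \<phi> x"
          using potentials_AE_nonneg[OF V] ae
        proof eventually_elim
          case (elim x)
          show ?case using elim \<phi>(3)[of x] \<phi>(4)[of x] by (cases "\<phi> x = 0") auto
        qed
      qed
      moreover have "(\<integral>(x, y). H p (u x - u y) * (\<phi> x - \<phi> y) * K (x - y) \<partial>lebesgue)
        + (\<integral>x. V x * \<bar>u x\<bar> powr (p - 2) * u x * \<phi> x \<partial>lebesgue) \<le> 0"
        using sub \<phi> unfolding weak_subsolution_def by blast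
      ultimately show ?thesis unfolding case_prod_beta' by linarith
    qed
    finally show ?thesis .
  qed
  then show ?thesis using vb ae vY by blast
qed

section \<open>Admissibility of the truncated test function\<close>

lemma abs_powr_diff_le:
  fixes a b p :: real
  assumes "1 \<le> p" "0 \<le> a" "a \<le> 1" "0 \<le> b" "b \<le> 1"
  shows "\<bar>a powr p - b powr p\<bar> \<le> p * \<bar>a - b\<bar>"
proof -
  have *: "\<bar>a powr p - b powr p\<bar> \<le> p * \<bar>a - b\<bar>" if "b \<le> a" "0 \<le> b" "a \<le> 1" for a b :: real
  proof -
    have "a powr (p - 1) \<le> 1" using that assms by (intro powr_le1) auto
    then have "p * a powr (p - 1) * (a - b) \<le> p * 1 * (a - b)"
      using that assms by (intro mult_right_mono mult_left_mono) auto
    moreover have "b powr p \<le> a powr p" using that assms by (intro powr_mono2) auto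
    moreover have "a powr p - b powr p \<le> p * a powr (p - 1) * (a - b)"
      using that assms by (intro powr_diff_le) auto
    ultimately show ?thesis using that by (simp only: mult_1_right abs_of_nonneg diff_ge_0_iff_ge)
  qed
  show ?thesis using *[of b a] *[of a b] assms by (cases "b \<le> a") (auto simp: abs_minus_commute)
qed

text \<open>A discrete product rule in which the undifferenced excess appears at \<open>x\<close>
  alone. The asymmetry is deliberate: \<open>v\<close> is known to be p-integrable only inside
  \<Omega>, and for a pair with one point outside, the point inside can be given the role of
  \<open>x\<close>.\<close>

lemma test_function_diff_powr_le:
  fixes v :: "'a::real_normed_vector \<Rightarrow> real" and k p r1 r2 :: real and x y z :: 'a
  assumes p: "1 < p" and r: "r1 < r2"
  defines "\<phi> \<equiv> \<lambda>x. excess k (v x) * cutoff z r1 r2 x powr p"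
  shows "\<bar>\<phi> x - \<phi> y\<bar> powr p \<le> 2 powr p * (\<bar>v x - v y\<bar> powr p
      + p powr p * (excess k (v x) powr p * min 1 (1 / (r2 - r1) * norm (x - y)) powr p))"
proof -
  let ?w = "\<lambda>x. excess k (v x)" and ?\<eta> = "cutoff z r1 r2" and ?m = "min 1 (1 / (r2 - r1) * norm (x - y))"
  have m: "0 \<le> ?m" using r by simp
  have "\<bar>?\<eta> x powr p - ?\<eta> y powr p\<bar> \<le> p * \<bar>?\<eta> x - ?\<eta> y\<bar>"
    using p by (intro abs_powr_diff_le) auto
  also have "\<dots> \<le> p * ?m" using cutoff_diff_le[OF r] p by (intro mult_left_mono) auto
  finally have 1: "?w x * \<bar>?\<eta> x powr p - ?\<eta> y powr p\<bar> \<le> ?w x * (p * ?m)"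
    by (intro mult_left_mono) auto
  have "?\<eta> y powr p \<le> 1" using p by (intro powr_le1) auto
  then have "\<bar>?w x - ?w y\<bar> * ?\<eta> y powr p \<le> \<bar>?w x - ?w y\<bar> * 1"
    by (intro mult_left_mono) auto
  also have "\<dots> \<le> \<bar>v x - v y\<bar>" unfolding excess_def mult_1_right by linarith
  finally have 2: "\<bar>?w x - ?w y\<bar> * ?\<eta> y powr p \<le> \<bar>v x - v y\<bar>" .
  have "\<phi> x - \<phi> y = ?w x * (?\<eta> x powr p - ?\<eta> y powr p) + (?w x - ?w y) * ?\<eta> y powr p"
    by (simp add: \<phi>_def algebra_simps)
  then have "\<bar>\<phi> x - \<phi> y\<bar> \<le> \<bar>?w x * (?\<eta> x powr p - ?\<eta> y powr p)\<bar> + \<bar>(?w x - ?w y) * ?\<eta> y powr p\<bar>"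
    by (simp only: abs_triangle_ineq)
  also have "\<dots> = ?w x * \<bar>?\<eta> x powr p - ?\<eta> y powr p\<bar> + \<bar>?w x - ?w y\<bar> * ?\<eta> y powr p"
    by (simp add: abs_mult)
  also have "\<dots> \<le> \<bar>v x - v y\<bar> + ?w x * (p * ?m)" using 1 2 by linarith
  finally have "\<bar>\<phi> x - \<phi> y\<bar> powr p \<le> (\<bar>v x - v y\<bar> + ?w x * (p * ?m)) powr p"
    using p by (intro powr_mono2) auto
  also have "\<dots> \<le> 2 powr p * (\<bar>v x - v y\<bar> powr p + (?w x * (p * ?m)) powr p)"
    using p m by (intro powr_add_le mult_nonneg_nonneg) auto
  also have "(?w x * (p * ?m)) powr p = p powr p * (?w x powr p * ?m powr p)"
    by (simp add: powr_mult mult_ac)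
  finally show ?thesis .
qed

text \<open>The values are dominated by those of \<open>v\<close>. For the Gagliardo energy the
  product rule leaves the energy of \<open>v\<close> plus the terms \<open>G\<close>, whose integral
  factorises into the mass of the excess in \<Omega> and the truncated kernel mass.\<close>

lemma test_function_in_Y0_space:
  fixes v :: "real ^ 'n \<Rightarrow> real"
  assumes vb: "v \<in> borel_measurable borel" and vY: "v \<in> Y_space s p V \<Omega>" and V: "V \<in> potentials q"
    and \<Omega>: "open \<Omega>" and ps: "1 < p" "0 < s" "s < 1" and k: "0 \<le> k"
    and r: "0 < r1" "r1 < r2" "r2 < \<sigma>" and sub: "ball z \<sigma> \<subseteq> \<Omega>"
  shows "(\<lambda>x. excess k (v x) * cutoff z r1 r2 x powr p) \<in> Y0_space s p V \<Omega>"
proof -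
  define \<phi> where "\<phi> = (\<lambda>x. excess k (v x) * cutoff z r1 r2 x powr p)"
  let ?w = "\<lambda>x. excess k (v x)" and ?J = "frac_kernel (p * s) :: real ^ 'n \<Rightarrow> real"
  let ?m = "\<lambda>h :: real ^ 'n. min 1 (1 / (r2 - r1) * norm h)" and ?S = "- ((- \<Omega>) \<times> (- \<Omega>))"
  have [measurable]: "v \<in> borel_measurable borel" "\<Omega> \<in> sets borel" using vb \<Omega> by auto
  have \<phi>b [measurable]: "\<phi> \<in> borel_measurable borel" unfolding \<phi>_def by measurable
  have \<phi>l: "\<phi> \<in> borel_measurable lebesgue" by (intro measurable_completion) simp
  have vl: "v \<in> borel_measurable lebesgue" using vb by (intro measurable_completion) simp
  have V_meas: "pos_part V \<in> borel_measurable lebesgue" "neg_part V \<in> borel_measurable lebesgue"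
    using V by (auto simp: potentials_def Lloc_def)
  have \<Omega>_sets: "\<Omega> \<in> sets lebesgue" using \<Omega> by auto
  have S_open: "open ?S" using \<Omega> by (intro open_Compl closed_Times closed_Compl)
  have w_le: "?w x \<le> \<bar>v x\<bar>" for x using k by (simp add: excess_def)
  have \<phi>_le: "\<bar>\<phi> x\<bar> powr p \<le> \<bar>v x\<bar> powr p" for x
  proof -
    have "cutoff z r1 r2 x powr p \<le> 1" using ps by (intro powr_le1) auto
    then have "\<phi> x \<le> ?w x * 1" unfolding \<phi>_def by (intro mult_left_mono) auto
    moreover have "0 \<le> \<phi> x" by (simp add: \<phi>_def)
    ultimately show ?thesis using w_le[of x] ps by (intro powr_mono2) auto
  qed
  have set_int: "set_integrable lebesgue \<Omega> (\<lambda>x. \<bar>\<phi> x\<bar> powr p * W x)"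
    if "set_integrable lebesgue \<Omega> (\<lambda>x. \<bar>v x\<bar> powr p * W x)" "W \<in> borel_measurable lebesgue" for W
  proof (rule set_integrable_bound[OF that(1)])
    show "set_borel_measurable lebesgue \<Omega> (\<lambda>x. \<bar>\<phi> x\<bar> powr p * W x)"
      unfolding set_borel_measurable_def using \<phi>l that(2) \<Omega>_sets by measurable
    show "AE x in lebesgue. x \<in> \<Omega> \<longrightarrow> norm (\<bar>\<phi> x\<bar> powr p * W x) \<le> norm (\<bar>v x\<bar> powr p * W x)"
      using \<phi>_le by (intro AE_I2) (auto simp: abs_mult intro!: mult_right_mono)
  qed
  have v1: "set_integrable lebesgue \<Omega> (\<lambda>x. \<bar>v x\<bar> powr p)" and vg: "set_integrable lebesgue ?S (gagliardo s p v)"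
    and vV: "set_integrable lebesgue \<Omega> (\<lambda>x. \<bar>v x\<bar> powr p * pos_part V x)"
      "set_integrable lebesgue \<Omega> (\<lambda>x. \<bar>v x\<bar> powr p * neg_part V x)"
    using vY by (auto simp: Y_space_def X_space_def LpV_def)
  have \<phi>1: "set_integrable lebesgue \<Omega> (\<lambda>x. \<bar>\<phi> x\<bar> powr p)"
    using set_int[of "\<lambda>_. 1"] v1 by simp
  have \<phi>0: "\<phi> x = 0" if "x \<notin> \<Omega>" for x
  proof -
    have "x \<notin> ball z \<sigma>" using that sub by auto
    then show ?thesis using r cutoff_eq_0[of r1 r2 x z] ps
      by (simp add: \<phi>_def dist_norm norm_minus_commute)
  qed
  define G where "G x h = indicator \<Omega> x * ?w x powr p * (?m h powr p * ?J h)" for x h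
  have G_nonneg: "0 \<le> G x h" for x h by (simp add: G_def)
  have Gm: "(\<lambda>z. G (fst z) (fst z - snd z)) \<in> borel_measurable borel" "(\<lambda>z. G (snd z) (fst z - snd z)) \<in> borel_measurable borel"
    unfolding G_def borel_prod[symmetric] by measurable
  have G_fin: "(\<integral>\<^sup>+z. ennreal (G (fst z) (fst z - snd z)) \<partial>lebesgue) < \<infinity>"
  proof -
    have "(\<integral>\<^sup>+z. ennreal (G (fst z) (fst z - snd z)) \<partial>lebesgue)
        = (\<integral>\<^sup>+z. ennreal (indicator \<Omega> (fst z) * ?w (fst z) powr p) * ennreal (?m (fst z - snd z) powr p * ?J (fst z - snd z)) \<partial>lebesgue)"
      by (simp add: G_def ennreal_mult)
    also have "\<dots> = (\<integral>\<^sup>+x. ennreal (indicator \<Omega> x * ?w x powr p) \<partial>lborel) * (\<integral>\<^sup>+h. ennreal (?m h powr p * ?J h) \<partial>lborel)"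
      by (rule nn_integral_convolution_fst) measurable
    also have "\<dots> < \<infinity>"
    proof -
      have "(\<integral>\<^sup>+x. ennreal (indicator \<Omega> x * ?w x powr p) \<partial>lborel) \<le> (\<integral>\<^sup>+x. ennreal (norm (indicator \<Omega> x *\<^sub>R \<bar>v x\<bar> powr p)) \<partial>lebesgue)"
        unfolding nn_integral_completion using w_le ps
        by (intro nn_integral_mono ennreal_leI) (auto simp: indicator_def intro!: powr_mono2)
      also have "\<dots> < \<infinity>" using v1 by (simp only: set_integrable_def integrable_iff_bounded)
      finally have "(\<integral>\<^sup>+x. ennreal (indicator \<Omega> x * ?w x powr p) \<partial>lborel) < \<infinity>" .
      moreover obtain C where "(\<integral>\<^sup>+h. ennreal (?m h powr p * ?J h) \<partial>lborel) \<le> ennreal (C * (1 / (r2 - r1)) powr (p * s))"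
      proof -
        have "\<exists>C>0. \<forall>L>0. (\<integral>\<^sup>+h. ennreal (min 1 (L * norm h) powr p * ?J h) \<partial>lborel) \<le> ennreal (C * L powr (p * s))"
          using ps by (intro frac_kernel_truncated) auto
        moreover have "0 < 1 / (r2 - r1)" using r by simp
        ultimately show ?thesis using that by blast
      qed
      ultimately show ?thesis by (auto simp: ennreal_mult_less_top intro: le_less_trans)
    qed
    finally show ?thesis .
  qed
  have G1: "integrable lebesgue (\<lambda>z. G (fst z) (fst z - snd z))"
    using Gm(1) G_fin G_nonneg by (intro integrableI_nonneg measurable_completion) auto
  have G2: "integrable lebesgue (\<lambda>z. G (snd z) (fst z - snd z))"
  proof -
    have "(\<integral>\<^sup>+z. ennreal (G (snd z) (fst z - snd z)) \<partial>lebesgue) = (\<integral>\<^sup>+z. ennreal (G (fst z) (fst z - snd z)) \<partial>lebesgue)"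
      using nn_integral_swap_lebesgue[of "\<lambda>z. ennreal (G (fst z) (fst z - snd z))"] Gm(1)
      by (simp add: G_def norm_minus_commute frac_kernel_commute[of _ "snd _"])
    then show ?thesis using Gm(2) G_fin G_nonneg by (intro integrableI_nonneg measurable_completion) auto
  qed
  have "set_integrable lebesgue ?S (gagliardo s p \<phi>)"
    unfolding set_integrable_def
  proof (rule Bochner_Integration.integrable_bound)
    show "integrable lebesgue (\<lambda>z. 2 powr p * (indicator ?S z *\<^sub>R gagliardo s p v z
        + p powr p * (G (fst z) (fst z - snd z) + G (snd z) (fst z - snd z))))"
      using vg G1 G2 unfolding set_integrable_def
      by (intro integrable_mult_right Bochner_Integration.integrable_add)
    have "gagliardo s p \<phi> \<in> borel_measurable lebesgue"
      using gagliardo_measurable[OF \<phi>b] by (intro measurable_completion) simp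
    then show "(\<lambda>z. indicator ?S z *\<^sub>R gagliardo s p \<phi> z) \<in> borel_measurable lebesgue"
      using S_open by (intro borel_measurable_scaleR borel_measurable_indicator) auto
    show "AE z in lebesgue. norm (indicator ?S z *\<^sub>R gagliardo s p \<phi> z)
        \<le> norm (2 powr p * (indicator ?S z *\<^sub>R gagliardo s p v z
        + p powr p * (G (fst z) (fst z - snd z) + G (snd z) (fst z - snd z))))"
    proof (rule AE_I2)
      fix xy :: "(real ^ 'n) \<times> (real ^ 'n)"
      obtain x y where xy: "xy = (x, y)" by (cases xy)
      have gn: "0 \<le> gagliardo s p f xy" for f by (simp add: gagliardo_eq)
      have rhs: "0 \<le> 2 powr p * (indicator ?S xy *\<^sub>R gagliardo s p v xy + p powr p * (G x (x - y) + G y (x - y)))"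
        using gn G_nonneg by (intro mult_nonneg_nonneg add_nonneg_nonneg) auto
      have "indicator ?S xy *\<^sub>R gagliardo s p \<phi> xy
          \<le> 2 powr p * (indicator ?S xy *\<^sub>R gagliardo s p v xy + p powr p * (G x (x - y) + G y (x - y)))"
      proof (cases "x \<in> \<Omega> \<or> y \<in> \<Omega>")
        case True
        have "\<bar>\<phi> x - \<phi> y\<bar> powr p * ?J (x - y)
            \<le> 2 powr p * (\<bar>v x - v y\<bar> powr p * ?J (x - y) + p powr p * (G x (x - y) + G y (x - y)))"
        proof (cases "x \<in> \<Omega>")
          case True
          have "\<bar>\<phi> x - \<phi> y\<bar> powr p * ?J (x - y) \<le> 2 powr p * (\<bar>v x - v y\<bar> powr p
              + p powr p * (?w x powr p * ?m (x - y) powr p)) * ?J (x - y)"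
            unfolding \<phi>_def using ps r by (intro mult_right_mono test_function_diff_powr_le) auto
          also have "\<dots> = 2 powr p * (\<bar>v x - v y\<bar> powr p * ?J (x - y) + p powr p * G x (x - y))"
            using True by (simp add: G_def algebra_simps)
          also have "\<dots> \<le> 2 powr p * (\<bar>v x - v y\<bar> powr p * ?J (x - y) + p powr p * (G x (x - y) + G y (x - y)))"
            using G_nonneg by (intro mult_left_mono add_left_mono) auto
          finally show ?thesis .
        next
          case False
          then have y: "y \<in> \<Omega>" using True by simp
          have "\<bar>\<phi> y - \<phi> x\<bar> powr p * ?J (x - y) \<le> 2 powr p * (\<bar>v y - v x\<bar> powr p
              + p powr p * (?w y powr p * ?m (y - x) powr p)) * ?J (x - y)"
            unfolding \<phi>_def using ps r by (intro mult_right_mono test_function_diff_powr_le) auto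
          also have "\<dots> = 2 powr p * (\<bar>v x - v y\<bar> powr p * ?J (x - y) + p powr p * G y (x - y))"
            using y by (simp add: G_def algebra_simps norm_minus_commute abs_minus_commute)
          also have "\<dots> \<le> 2 powr p * (\<bar>v x - v y\<bar> powr p * ?J (x - y) + p powr p * (G x (x - y) + G y (x - y)))"
            using G_nonneg by (intro mult_left_mono add_left_mono) auto
          finally show ?thesis by (simp add: abs_minus_commute)
        qed
        then show ?thesis using True by (simp add: gagliardo_eq xy)
      next
        case False
        then show ?thesis using rhs by (simp add: xy)
      qed
      then show "norm (indicator ?S xy *\<^sub>R gagliardo s p \<phi> xy)
        \<le> norm (2 powr p * (indicator ?S xy *\<^sub>R gagliardo s p v xy
        + p powr p * (G (fst xy) (fst xy - snd xy) + G (snd xy) (fst xy - snd xy))))"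
        using gn[of \<phi>] rhs unfolding xy fst_conv snd_conv real_norm_def by (simp only: abs_of_nonneg scaleR_nonneg_nonneg indicator_pos_le)
    qed
  qed
  then show ?thesis using \<phi>l \<phi>1 set_int[OF vV(1) V_meas(1)] set_int[OF vV(2) V_meas(2)] \<phi>0
    unfolding \<phi>_def[symmetric] by (auto simp: Y0_space_def X0_space_def X_space_def LpV_def)
qed

section \<open>From the weak formulation to the De Giorgi class\<close>

lemma kernel_const_pos:
  assumes "0 < n" "0 < p" "s < 1"
  shows "0 < kernel_const n p s"
  using assms by (auto simp: kernel_const_def intro!: mult_pos_pos divide_pos_pos Gamma_real_pos)

text \<open>With \<open>a\<close> and \<open>b\<close> the sizes of the increments of
  \<open>v\<close> and of the test function, \<open>a powr (p - 1) * b\<close> is at most the p-th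
  power of the larger one, so the two Gagliardo energies dominate. Integrability rules out the
  default value 0 of the Bochner integral, which would make its nonpositivity empty.\<close>

lemma energy_integrable:
  fixes v \<phi> :: "real ^ 'n \<Rightarrow> real"
  assumes K: "admissible_kernel s p lam Lam K" and vb: "v \<in> borel_measurable borel" and \<phi>b: "\<phi> \<in> borel_measurable borel"
    and v: "v \<in> X_space s p \<Omega>" and \<phi>: "\<phi> \<in> X_space s p \<Omega>" "\<And>x. x \<notin> \<Omega> \<Longrightarrow> \<phi> x = 0"
    and ps: "1 < p" "0 < s" "s < 1" and lam: "0 < lam" "0 \<le> Lam"
  shows "integrable lebesgue (\<lambda>z. H p (v (fst z) - v (snd z)) * (\<phi> (fst z) - \<phi> (snd z)) * K (fst z - snd z))"
proof (rule Bochner_Integration.integrable_bound)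
  let ?S = "- ((- \<Omega>) \<times> (- \<Omega>))" and ?c = "kernel_const (real CARD('n)) p s"
  have c: "0 < ?c" using ps by (intro kernel_const_pos) auto
  show "integrable lebesgue (\<lambda>z. ?c * Lam * (indicator ?S z *\<^sub>R gagliardo s p v z + indicator ?S z *\<^sub>R gagliardo s p \<phi> z))"
    using v \<phi>(1) by (intro integrable_mult_right Bochner_Integration.integrable_add) (auto simp: X_space_def set_integrable_def)
  have "(\<lambda>z. H p (v (fst z) - v (snd z)) * (\<phi> (fst z) - \<phi> (snd z))) \<in> borel_measurable borel"
    using vb \<phi>b unfolding H_def borel_prod[symmetric] by measurable
  then have "(\<lambda>z. H p (v (fst z) - v (snd z)) * (\<phi> (fst z) - \<phi> (snd z))) \<in> borel_measurable lebesgue"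
    by (intro measurable_completion) simp
  then show "(\<lambda>z. H p (v (fst z) - v (snd z)) * (\<phi> (fst z) - \<phi> (snd z)) * K (fst z - snd z)) \<in> borel_measurable lebesgue"
    by (rule borel_measurable_times) (use K in \<open>auto intro!: lebesgue_measurable_diff simp: admissible_kernel_def\<close>)
  show "AE z in lebesgue. norm (H p (v (fst z) - v (snd z)) * (\<phi> (fst z) - \<phi> (snd z)) * K (fst z - snd z))
    \<le> norm (?c * Lam * (indicator ?S z *\<^sub>R gagliardo s p v z + indicator ?S z *\<^sub>R gagliardo s p \<phi> z))"
  proof (rule AE_I2)
    fix z :: "(real ^ 'n) \<times> (real ^ 'n)"
    let ?F = "H p (v (fst z) - v (snd z)) * (\<phi> (fst z) - \<phi> (snd z)) * K (fst z - snd z)"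
    let ?J = "frac_kernel (p * s) (fst z - snd z)"
    have g: "0 \<le> gagliardo s p f z" for f by (simp add: gagliardo_eq)
    have rhs: "0 \<le> ?c * Lam * (indicator ?S z *\<^sub>R gagliardo s p v z + indicator ?S z *\<^sub>R gagliardo s p \<phi> z)"
      using g c lam by (intro mult_nonneg_nonneg add_nonneg_nonneg) auto
    have "\<bar>?F\<bar> \<le> ?c * Lam * (indicator ?S z *\<^sub>R gagliardo s p v z + indicator ?S z *\<^sub>R gagliardo s p \<phi> z)"
    \<comment> \<open>Nothing is assumed about \<open>K 0\<close>, so the diagonal is set apart;
      there, as for two points outside \<Omega>, the increment of the test function is 0.\<close>
    proof (cases "z \<in> ?S \<and> fst z \<noteq> snd z")
      case True
      then have "fst z - snd z \<noteq> 0" by simp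
      then have "?c * lam / norm (fst z - snd z) powr (real CARD('n) + p * s) \<le> K (fst z - snd z)"
          "K (fst z - snd z) \<le> ?c * Lam / norm (fst z - snd z) powr (real CARD('n) + p * s)"
        using K unfolding admissible_kernel_def by blast+
      moreover have "0 \<le> ?c * lam / norm (fst z - snd z) powr (real CARD('n) + p * s)"
        using c lam by simp
      ultimately have K_le: "\<bar>K (fst z - snd z)\<bar> \<le> ?c * Lam * ?J"
        by (simp add: frac_kernel_cart)
      let ?a = "\<bar>v (fst z) - v (snd z)\<bar>" and ?b = "\<bar>\<phi> (fst z) - \<phi> (snd z)\<bar>"
      have "?a powr (p - 1) * ?b \<le> ?a powr p + ?b powr p"
      proof (cases "?a \<le> ?b")
        case True
        then have "?a powr (p - 1) * ?b \<le> ?b powr (p - 1) * ?b"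
          using ps by (intro mult_right_mono powr_mono2) auto
        also have "\<dots> = ?b powr p" by (rule powr_minus_one_mult) simp
        finally show ?thesis by (simp add: add_increasing)
      next
        case False
        then have "?a powr (p - 1) * ?b \<le> ?a powr (p - 1) * ?a"
          by (intro mult_left_mono) auto
        also have "\<dots> = ?a powr p" by (rule powr_minus_one_mult) simp
        finally show ?thesis by (simp add: add_increasing2)
      qed
      then have "?a powr (p - 1) * ?b * \<bar>K (fst z - snd z)\<bar> \<le> (?a powr p + ?b powr p) * (?c * Lam * ?J)"
        using K_le by (intro mult_mono) auto
      moreover have "\<bar>?F\<bar> = ?a powr (p - 1) * ?b * \<bar>K (fst z - snd z)\<bar>" by (simp add: abs_mult abs_H)
      ultimately show ?thesis using True by (simp add: gagliardo_eq algebra_simps)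
    next
      case False
      then have "\<phi> (fst z) - \<phi> (snd z) = 0" using \<phi>(2) by (cases z) auto
      then show ?thesis using rhs by simp
    qed
    then show "norm ?F \<le> norm (?c * Lam * (indicator ?S z *\<^sub>R gagliardo s p v z + indicator ?S z *\<^sub>R gagliardo s p \<phi> z))"
      by simp
  qed
qed

text \<open>On \<open>B\<close> times \<open>B\<close> this is \<open>caccioppoli_pointwise\<close>
  multiplied by \<open>K\<close>, with the lower kernel bound on the good term and the upper one on
  the error. If exactly one point lies in \<open>B\<close>, the cutoff vanishes at the other and
  \<open>H_excess_far\<close> applies; either point may be the outer one, hence two far
  terms.\<close>

lemma subsolution_pointwise:
  fixes v :: "real ^ 'n \<Rightarrow> real" and k r1 r2 \<sigma> :: real and x y z :: "real ^ 'n"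
  assumes K: "admissible_kernel s p lam Lam K" and ps: "1 < p" "0 < s" "s < 1" and lam: "0 < lam" "0 \<le> Lam"
    and r: "r1 < r2" "r2 < \<sigma>"
  defines "w \<equiv> \<lambda>x. excess k (v x)" and "\<eta> \<equiv> cutoff z r1 r2" and "J \<equiv> frac_kernel (p * s)"
    and "\<kappa> \<equiv> kernel_const (real CARD('n)) p s" and "B \<equiv> ball z \<sigma>"
  shows "\<kappa> * lam * 2 powr (- p - 1) * (\<bar>w x * \<eta> x - w y * \<eta> y\<bar> powr p * J (x - y) * (indicator B x * indicator B y))
      - \<kappa> * Lam * (((2 * p) powr p + 1) * ((w x powr p + w y powr p) * \<bar>\<eta> x - \<eta> y\<bar> powr p * J (x - y) * (indicator B x * indicator B y))
         + (w x * \<eta> x powr p * w y powr (p - 1) * J (x - y) * (indicator B x * indicator (- B) y)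
          + w y * \<eta> y powr p * w x powr (p - 1) * J (y - x) * (indicator B y * indicator (- B) x)))
    \<le> H p (v x - v y) * (w x * \<eta> x powr p - w y * \<eta> y powr p) * K (x - y)"
\<comment> \<open>The kernel bounds hold only off the diagonal; on it both sides are 0.\<close>
proof (cases "x = y")
  case True
  then show ?thesis by (auto simp: J_def frac_kernel_def)
next
  case False
  have \<kappa>: "0 < \<kappa>" unfolding \<kappa>_def using ps by (intro kernel_const_pos) auto
  have "x - y \<noteq> 0" using False by simp
  then have Kb: "\<kappa> * lam * J (x - y) \<le> K (x - y)" "K (x - y) \<le> \<kappa> * Lam * J (x - y)"
  proof -
    have "\<kappa> * lam / norm (x - y) powr (real CARD('n) + p * s) \<le> K (x - y)"
        "K (x - y) \<le> \<kappa> * Lam / norm (x - y) powr (real CARD('n) + p * s)"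
      using K \<open>x - y \<noteq> 0\<close> unfolding admissible_kernel_def \<kappa>_def by blast+
    then show "\<kappa> * lam * J (x - y) \<le> K (x - y)" "K (x - y) \<le> \<kappa> * Lam * J (x - y)"
      by (simp_all add: J_def frac_kernel_cart)
  qed
  have J: "0 \<le> J h" for h by (simp add: J_def)
  have Kn: "0 \<le> K (x - y)"
    by (rule order.trans[OF _ Kb(1)]) (use J \<kappa> lam in auto)
  have \<eta>: "0 \<le> \<eta> x" for x by (simp add: \<eta>_def)
  have w: "0 \<le> w x" for x by (simp add: w_def)
  have \<eta>0: "\<eta> x = 0" if "x \<notin> B" for x
    using that r by (auto simp: \<eta>_def B_def dist_norm norm_minus_commute intro!: cutoff_eq_0)
  have far: "- (\<kappa> * Lam * (w a * \<eta> a powr p * w b powr (p - 1) * J (x - y)))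
      \<le> H p (v a - v b) * (w a * \<eta> a powr p) * K (x - y)" for a b
  proof -
    let ?t = "w b powr (p - 1) * w a * \<eta> a powr p"
    have t: "0 \<le> ?t" using w by auto
    have "- ?t \<le> H p (v a - v b) * (w a * \<eta> a powr p)"
      unfolding w_def using ps by (intro H_excess_far) auto
    then have 1: "- ?t * K (x - y) \<le> H p (v a - v b) * (w a * \<eta> a powr p) * K (x - y)"
      using Kn by (intro mult_right_mono)
    have 2: "?t * K (x - y) \<le> ?t * (\<kappa> * Lam * J (x - y))"
      using Kb t by (intro mult_left_mono)
    have "- (\<kappa> * Lam * (w a * \<eta> a powr p * w b powr (p - 1) * J (x - y))) = - (?t * (\<kappa> * Lam * J (x - y)))"
      by (simp add: mult_ac)
    also have "\<dots> \<le> - (?t * K (x - y))" using 2 by (simp only: neg_le_iff_le)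
    also have "\<dots> = - ?t * K (x - y)" by (simp only: minus_mult_left)
    also note 1
    finally show ?thesis .
  qed
  consider "x \<in> B" "y \<in> B" | "x \<in> B" "y \<notin> B" | "x \<notin> B" "y \<in> B" | "x \<notin> B" "y \<notin> B" by blast
  then show ?thesis
  proof cases
    case 1
    let ?a = "\<bar>w x * \<eta> x - w y * \<eta> y\<bar> powr p" and ?n = "(w x powr p + w y powr p) * \<bar>\<eta> x - \<eta> y\<bar> powr p"
    let ?c = "2 powr (- p - 1) :: real" and ?C = "(2 * p) powr p + 1"
    let ?h = "H p (v x - v y) * (w x * \<eta> x powr p - w y * \<eta> y powr p)"
    have "?c * ?a - ?C * (w x powr p + w y powr p) * \<bar>\<eta> x - \<eta> y\<bar> powr p \<le> ?h"
      unfolding w_def using ps \<eta> by (intro caccioppoli_pointwise) auto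
    then have "(?c * ?a - ?C * ?n) * K (x - y) \<le> ?h * K (x - y)"
      using Kn by (intro mult_right_mono) (auto simp: mult.assoc)
    moreover have "?c * ?a * (\<kappa> * lam * J (x - y)) \<le> ?c * ?a * K (x - y)"
      using Kb by (intro mult_left_mono) auto
    moreover have "?C * ?n * K (x - y) \<le> ?C * ?n * (\<kappa> * Lam * J (x - y))"
      using Kb by (intro mult_left_mono mult_nonneg_nonneg add_nonneg_nonneg) auto
    ultimately have "?c * ?a * (\<kappa> * lam * J (x - y)) - ?C * ?n * (\<kappa> * Lam * J (x - y)) \<le> ?h * K (x - y)"
      unfolding left_diff_distrib by linarith
    moreover have "\<kappa> * lam * ?c * (?a * J (x - y)) = ?c * ?a * (\<kappa> * lam * J (x - y))"
      "\<kappa> * Lam * (?C * (?n * J (x - y))) = ?C * ?n * (\<kappa> * Lam * J (x - y))"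
      by (simp_all only: mult_ac)
    ultimately have "\<kappa> * lam * ?c * (?a * J (x - y)) - \<kappa> * Lam * (?C * (?n * J (x - y))) \<le> ?h * K (x - y)"
      by (simp only:)
    then show ?thesis using 1 by simp
  next
    case 2
    then show ?thesis using far[of x y] \<eta>0[of y] ps by simp
  next
    case 3
    have "H p (v y - v x) * (w y * \<eta> y powr p) = H p (v x - v y) * (- (w y * \<eta> y powr p))"
      using H_minus[of p "v x - v y"] by simp
    moreover have "J (y - x) = J (x - y)" by (simp add: J_def frac_kernel_commute)
    ultimately show ?thesis using 3 far[of y x] \<eta>0[of x] ps by simp
  next
    case 4
    then show ?thesis using \<eta>0[of x] \<eta>0[of y] ps by simp
  qed
qed

text \<open>The 3 is the 1 of the pointwise error constant plus 2 for the far term, which occurs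
  twice by symmetry. The factor \<open>kernel_const\<close> sits in both kernel bounds and cancels,
  so of the kernel only the ratio of \<open>Lam\<close> and \<open>lam\<close> enters.\<close>

lemma degiorgi_class_of_subsolution:
  fixes v :: "real ^ 'n \<Rightarrow> real"
  assumes K: "admissible_kernel s p lam Lam K" and vb: "v \<in> borel_measurable borel"
    and vY: "v \<in> Y_space s p V \<Omega>" and V: "V \<in> potentials q" and \<Omega>: "open \<Omega>"
    and ps: "1 < p" "0 < s" "s < 1" and lam: "0 < lam" "0 \<le> Lam"
    and test: "\<forall>\<phi>\<in>Y0_space s p V \<Omega>. \<phi> \<in> borel_measurable borel \<longrightarrow> (\<forall>x. 0 \<le> \<phi> x) \<longrightarrow> (\<forall>x. \<phi> x \<noteq> 0 \<longrightarrow> 0 \<le> v x) \<longrightarrow>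
      (\<integral>z. H p (v (fst z) - v (snd z)) * (\<phi> (fst z) - \<phi> (snd z)) * K (fst z - snd z) \<partial>lebesgue) \<le> 0"
  shows "degiorgi_class s p (Lam / (lam * 2 powr (- p - 1)) * ((2 * p) powr p + 3)) \<Omega> v"
  unfolding degiorgi_class_def
proof (intro conjI allI impI)
  fix k r1 r2 \<sigma> :: real and z :: "real ^ 'n"
  assume k: "0 \<le> k" and r: "0 < r1" "r1 < r2" "r2 < \<sigma>" and sub: "ball z \<sigma> \<subseteq> \<Omega>"
  let ?w = "\<lambda>x. excess k (v x)" and ?\<eta> = "cutoff z r1 r2" and ?J = "frac_kernel (p * s) :: real ^ 'n \<Rightarrow> real"
    and ?\<kappa> = "kernel_const (real CARD('n)) p s" and ?B = "ball z \<sigma>"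
  let ?c = "2 powr (- p - 1) :: real" and ?C = "(2 * p) powr p + 1"
  have \<kappa>: "0 < ?\<kappa>" using ps by (intro kernel_const_pos) auto
  have [measurable]: "v \<in> borel_measurable borel" by (rule vb)
  have [measurable]: "?B \<in> sets borel" by simp
  define A where "A xy = \<bar>?w (fst xy) * ?\<eta> (fst xy) - ?w (snd xy) * ?\<eta> (snd xy)\<bar> powr p * ?J (fst xy - snd xy)
      * (indicator ?B (fst xy) * indicator ?B (snd xy))" for xy
  define N where "N xy = (?w (fst xy) powr p + ?w (snd xy) powr p) * \<bar>?\<eta> (fst xy) - ?\<eta> (snd xy)\<bar> powr p * ?J (fst xy - snd xy)
      * (indicator ?B (fst xy) * indicator ?B (snd xy))" for xy
  define M where "M xy = ?w (fst xy) * ?\<eta> (fst xy) powr p * ?w (snd xy) powr (p - 1) * ?J (fst xy - snd xy)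
      * (indicator ?B (fst xy) * indicator (- ?B) (snd xy))" for xy
  have b: "A \<in> borel_measurable borel" "N \<in> borel_measurable borel" "M \<in> borel_measurable borel"
    "(\<lambda>xy. M (snd xy, fst xy)) \<in> borel_measurable borel"
    unfolding A_def[abs_def] N_def[abs_def] M_def[abs_def] fst_conv snd_conv borel_prod[symmetric] by measurable
  have l: "A \<in> borel_measurable lebesgue" "N \<in> borel_measurable lebesgue" "M \<in> borel_measurable lebesgue"
    "(\<lambda>xy. M (snd xy, fst xy)) \<in> borel_measurable lebesgue"
    using b by (auto intro: measurable_completion)
  have nn: "0 \<le> A xy" "0 \<le> N xy" "0 \<le> M xy" for xy by (auto simp: A_def N_def M_def)
  let ?\<phi> = "\<lambda>x. ?w x * ?\<eta> x powr p"
  have \<phi>: "?\<phi> \<in> Y0_space s p V \<Omega>"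
    by (rule test_function_in_Y0_space[OF vb vY V \<Omega> ps k r sub])
  have \<phi>b: "?\<phi> \<in> borel_measurable borel" by measurable
  let ?F = "\<lambda>xy. H p (v (fst xy) - v (snd xy)) * (?\<phi> (fst xy) - ?\<phi> (snd xy)) * K (fst xy - snd xy)"
  have F_int: "integrable lebesgue ?F"
  proof (rule energy_integrable[OF K vb \<phi>b _ _ _ ps lam])
    show "v \<in> X_space s p \<Omega>" using vY by (simp add: Y_space_def)
    show "?\<phi> \<in> X_space s p \<Omega>" using \<phi> by (simp add: Y0_space_def X0_space_def)
    fix x assume "x \<notin> \<Omega>"
    then have "x \<notin> ?B" using sub by auto
    then show "?\<phi> x = 0" using cutoff_eq_0[of r1 r2 x z] r ps by (simp add: dist_norm norm_minus_commute)
  qed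
  have F_le: "integral\<^sup>L lebesgue ?F \<le> 0"
  proof -
    \<comment> \<open>\<open>k \<ge> 0\<close> places the support of the test function where
      \<open>v\<close> is nonnegative, as the sign condition in \<open>test\<close> demands.\<close>
    have "0 \<le> v x" if "?\<phi> x \<noteq> 0" for x using that k by (auto simp: excess_def max_def split: if_splits)
    moreover have "0 \<le> ?\<phi> x" for x by simp
    ultimately show ?thesis using test \<phi> \<phi>b by blast
  qed
  have "(\<integral>\<^sup>+xy. ennreal (?\<kappa> * lam * ?c * A xy) \<partial>lebesgue)
      \<le> (\<integral>\<^sup>+xy. ennreal (?\<kappa> * Lam * (?C * N xy + (M xy + M (snd xy, fst xy)))) \<partial>lebesgue)"
  proof (rule nn_integral_le_of_integral_nonpos[OF F_int F_le])
    show "?\<kappa> * lam * ?c * A xy - ?\<kappa> * Lam * (?C * N xy + (M xy + M (snd xy, fst xy))) \<le> ?F xy" for xy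
      unfolding A_def N_def M_def fst_conv snd_conv
      by (rule subsolution_pointwise[OF K ps lam r(2,3)])
    show "0 \<le> ?\<kappa> * lam * ?c * A xy" for xy using \<kappa> lam nn by auto
    show "0 \<le> ?\<kappa> * Lam * (?C * N xy + (M xy + M (snd xy, fst xy)))" for xy
      using \<kappa> lam nn by (intro mult_nonneg_nonneg add_nonneg_nonneg) auto
  qed (use l in measurable)
  also have "(\<integral>\<^sup>+xy. ennreal (?\<kappa> * lam * ?c * A xy) \<partial>lebesgue) = ennreal (?\<kappa> * lam * ?c) * (\<integral>\<^sup>+xy. ennreal (A xy) \<partial>lebesgue)"
    using l(1) nn(1) \<kappa> lam by (simp add: nn_integral_cmult ennreal_mult)
  also have "(\<integral>\<^sup>+xy. ennreal (?\<kappa> * Lam * (?C * N xy + (M xy + M (snd xy, fst xy)))) \<partial>lebesgue)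
      = ennreal (?\<kappa> * Lam) * (ennreal ?C * (\<integral>\<^sup>+xy. ennreal (N xy) \<partial>lebesgue)
         + ((\<integral>\<^sup>+xy. ennreal (M xy) \<partial>lebesgue) + (\<integral>\<^sup>+xy. ennreal (M (snd xy, fst xy)) \<partial>lebesgue)))"
  proof -
    have "ennreal (?\<kappa> * Lam * (?C * N xy + (M xy + M (snd xy, fst xy))))
        = ennreal (?\<kappa> * Lam) * (ennreal ?C * ennreal (N xy) + (ennreal (M xy) + ennreal (M (snd xy, fst xy))))" for xy
      using nn[of xy] nn(3)[of "(snd xy, fst xy)"] \<kappa> lam
      by (subst ennreal_mult) (auto simp: ennreal_mult[symmetric] simp flip: ennreal_plus)
    then show ?thesis using l by (simp add: nn_integral_cmult nn_integral_add)
  qed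
  also have "(\<integral>\<^sup>+xy. ennreal (M (snd xy, fst xy)) \<partial>lebesgue) = (\<integral>\<^sup>+xy. ennreal (M xy) \<partial>lebesgue)"
    using b(3) by (intro nn_integral_swap_lebesgue[of "\<lambda>xy. ennreal (M xy)"]) simp
  finally have main: "ennreal (?\<kappa> * lam * ?c) * (\<integral>\<^sup>+xy. ennreal (A xy) \<partial>lebesgue)
      \<le> ennreal (?\<kappa> * Lam) * (ennreal ?C * (\<integral>\<^sup>+xy. ennreal (N xy) \<partial>lebesgue)
         + ((\<integral>\<^sup>+xy. ennreal (M xy) \<partial>lebesgue) + (\<integral>\<^sup>+xy. ennreal (M xy) \<partial>lebesgue)))" .
  have combine: "X \<le> ennreal (Lam / (lam * ?c) * (?C + 2)) * (Y + Z)"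
    if "ennreal (?\<kappa> * lam * ?c) * X \<le> ennreal (?\<kappa> * Lam) * (ennreal ?C * Y + (Z + Z))" for X Y Z :: ennreal
  proof -
    have pos: "0 < ?\<kappa> * lam * ?c" using \<kappa> lam by simp
    have cancel: "X = ennreal (1 / c) * (ennreal c * X)" if "0 < c" for c
      using that by (simp add: mult.assoc[symmetric] ennreal_mult[symmetric])
    have "X = ennreal (1 / (?\<kappa> * lam * ?c)) * (ennreal (?\<kappa> * lam * ?c) * X)"
      by (rule cancel[OF pos])
    also have "\<dots> \<le> ennreal (1 / (?\<kappa> * lam * ?c)) * (ennreal (?\<kappa> * Lam) * (ennreal ?C * Y + (Z + Z)))"
      using that by (intro mult_left_mono) auto
    also have "ennreal ?C * Y + (Z + Z) \<le> ennreal (?C + 2) * (Y + Z)"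
    proof -
      have "Z + Z = ennreal 2 * Z" by (simp add: mult_2)
      moreover have "ennreal ?C * Y + ennreal 2 * Z \<le> ennreal (?C + 2) * Y + ennreal (?C + 2) * Z"
      proof (intro add_mono mult_right_mono ennreal_leI)
        show "2 \<le> ?C + 2" using powr_ge_zero[of "2 * p" p] by linarith
      qed simp_all
      ultimately have "ennreal ?C * Y + (Z + Z) \<le> ennreal (?C + 2) * Y + ennreal (?C + 2) * Z"
        by (simp only:)
      then show ?thesis by (simp only: distrib_left)
    qed
    then have "ennreal (1 / (?\<kappa> * lam * ?c)) * (ennreal (?\<kappa> * Lam) * (ennreal ?C * Y + (Z + Z)))
        \<le> ennreal (1 / (?\<kappa> * lam * ?c)) * (ennreal (?\<kappa> * Lam) * (ennreal (?C + 2) * (Y + Z)))"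
      by (intro mult_left_mono) auto
    also have "\<dots> = ennreal (1 / (?\<kappa> * lam * ?c) * (?\<kappa> * Lam) * (?C + 2)) * (Y + Z)"
    proof -
      have "ennreal a * (ennreal b * (ennreal c * T)) = ennreal (a * b * c) * T"
        if "0 \<le> a" "0 \<le> b" "0 \<le> c" for a b c T
        using that by (simp add: ennreal_mult mult.assoc)
      then show ?thesis using \<kappa> lam by (auto simp del: ennreal_plus)
    qed
    also have "1 / (?\<kappa> * lam * ?c) * (?\<kappa> * Lam) = Lam / (lam * ?c)" using \<kappa> by simp
    finally show ?thesis .
  qed
  have C: "?C + 2 = (2 * p) powr p + 3" by simp
  have ind: "ennreal (t * (indicator S x * indicator T y)) = ennreal t * indicator S x * indicator T y"
    for t :: real and S T :: "(real ^ 'n) set" and x y by (auto simp: indicator_def)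
  have it: "(\<integral>\<^sup>+x. \<integral>\<^sup>+y. ennreal (f (x, y)) \<partial>lborel \<partial>lborel) = (\<integral>\<^sup>+xy. ennreal (f xy) \<partial>lebesgue)"
    if "f \<in> borel_measurable borel" for f :: "(real ^ 'n) \<times> (real ^ 'n) \<Rightarrow> real"
    using that by (intro nn_integral_iterated_lebesgue) simp
  show "(\<integral>\<^sup>+x. \<integral>\<^sup>+y. ennreal (\<bar>?w x * ?\<eta> x - ?w y * ?\<eta> y\<bar> powr p * ?J (x - y)) * indicator ?B x * indicator ?B y \<partial>lborel \<partial>lborel)
      \<le> ennreal (Lam / (lam * ?c) * ((2 * p) powr p + 3)) *
       ((\<integral>\<^sup>+x. \<integral>\<^sup>+y. ennreal ((?w x powr p + ?w y powr p) * \<bar>?\<eta> x - ?\<eta> y\<bar> powr p * ?J (x - y))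
          * indicator ?B x * indicator ?B y \<partial>lborel \<partial>lborel)
       + (\<integral>\<^sup>+x. \<integral>\<^sup>+y. ennreal (?w x * ?\<eta> x powr p * ?w y powr (p - 1) * ?J (x - y))
          * indicator ?B x * indicator (- ?B) y \<partial>lborel \<partial>lborel))"
    using combine[OF main] unfolding it[OF b(1), symmetric] it[OF b(2), symmetric] it[OF b(3), symmetric]
    unfolding A_def N_def M_def fst_conv snd_conv ind C .
qed (rule vb)

section \<open>Local boundedness\<close>

text \<open>The near part of the tail is absorbed by splitting \<open>u\<^sub>+ \<le> h\<close> and \<open>u\<^sub>+ > h\<close> at a
  small multiple \<open>h\<close> of \<open>M\<close>.\<close>

lemma degiorgi_local_bound_mixed:
  assumes ps: "1 < p" "0 < s" "s < 1" and C1: "0 < C1"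
  shows "\<exists>c>0. \<forall>\<Omega> (u :: 'a::euclidean_space \<Rightarrow> real) z \<rho> M E. degiorgi_class s p C1 \<Omega> u \<longrightarrow> 0 < \<rho> \<longrightarrow> 0 < M \<longrightarrow>
      ball z (2 * \<rho>) \<subseteq> E \<longrightarrow> E \<subseteq> \<Omega> \<longrightarrow> E \<in> sets borel \<longrightarrow>
      (\<integral>\<^sup>+x. ennreal (excess 0 (u x) powr p) * indicator E x \<partial>lborel) \<le> ennreal (c * \<rho> ^ DIM('a) * M powr p) \<longrightarrow>
      (\<integral>\<^sup>+y. ennreal (excess 0 (u y) powr (p - 1) * frac_kernel (p * s) (y - z)) * indicator (- E) y \<partial>lborel)
        \<le> ennreal (1 / 2 * \<rho> powr (- (p * s)) * M powr (p - 1)) \<longrightarrow>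
      (AE x in lborel. x \<in> ball z \<rho> \<longrightarrow> u x \<le> M)"
proof -
  let ?n = "DIM('a)" and ?J = "frac_kernel (p * s) :: 'a \<Rightarrow> real"
  have a: "0 < p * s" using ps by simp
  have "\<exists>c>0. \<forall>\<Omega> (u :: 'a \<Rightarrow> real) z \<rho> M. degiorgi_class s p C1 \<Omega> u \<longrightarrow> 0 < \<rho> \<longrightarrow> 0 < M \<longrightarrow>
      ball z (2 * \<rho>) \<subseteq> \<Omega> \<longrightarrow>
      (\<integral>\<^sup>+x. ennreal (excess 0 (u x) powr p) * indicator (ball z (2 * \<rho>)) x \<partial>lborel)
        \<le> ennreal (c * \<rho> ^ ?n * M powr p) \<longrightarrow>
      (\<integral>\<^sup>+y. ennreal (excess 0 (u y) powr (p - 1) * ?J (y - z)) * indicator (- ball z \<rho>) y \<partial>lborel)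
        \<le> ennreal (\<rho> powr (- (p * s)) * M powr (p - 1)) \<longrightarrow>
      (AE x in lborel. x \<in> ball z \<rho> \<longrightarrow> u x \<le> M)"
    by (rule degiorgi_local_bound[OF ps C1])
  then obtain c where c: "0 < c" and bound: "\<And>\<Omega> (u :: 'a \<Rightarrow> real) z \<rho> M. degiorgi_class s p C1 \<Omega> u \<Longrightarrow> 0 < \<rho> \<Longrightarrow> 0 < M \<Longrightarrow>
      ball z (2 * \<rho>) \<subseteq> \<Omega> \<Longrightarrow>
      (\<integral>\<^sup>+x. ennreal (excess 0 (u x) powr p) * indicator (ball z (2 * \<rho>)) x \<partial>lborel)
        \<le> ennreal (c * \<rho> ^ ?n * M powr p) \<Longrightarrow>
      (\<integral>\<^sup>+y. ennreal (excess 0 (u y) powr (p - 1) * ?J (y - z)) * indicator (- ball z \<rho>) y \<partial>lborel)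
        \<le> ennreal (\<rho> powr (- (p * s)) * M powr (p - 1)) \<Longrightarrow>
      (AE x in lborel. x \<in> ball z \<rho> \<longrightarrow> u x \<le> M)"
    by blast
  obtain C5 where C5: "0 < C5" "\<And>R. 0 < R \<Longrightarrow> (\<integral>\<^sup>+h. ennreal (?J h) * indicator {h. R \<le> norm h} h \<partial>lborel)
      \<le> ennreal (C5 * R powr (- (p * s)))" using frac_kernel_far[OF a, where 'a = 'a] by blast
  \<comment> \<open>The tail outside \<open>ball z \<rho>\<close> has three parts. Values up to
    \<open>\<theta> * M\<close> contribute at most 1/4 of the allowed amount by this choice, larger
    values inside \<open>E\<close> another 1/4 by the entry \<open>\<theta> / 4\<close> of
    \<open>?c\<close>, and the region outside \<open>E\<close> is assumed to contribute at most
    1/2.\<close>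
  define \<theta> where "\<theta> = (1 / (4 * C5)) powr (1 / (p - 1))"
  have \<theta>: "0 < \<theta>" using C5 by (simp add: \<theta>_def)
  have \<theta>_powr: "\<theta> powr (p - 1) * C5 = 1 / 4" using C5 ps by (simp add: \<theta>_def powr_powr)
  let ?c = "min c (\<theta> / 4)"
  show ?thesis
  proof (intro exI[of _ ?c] conjI allI impI)
    fix \<Omega> E :: "'a set" and u :: "'a \<Rightarrow> real" and z \<rho> M
    assume dg: "degiorgi_class s p C1 \<Omega> u" and \<rho>: "0 < \<rho>" and M: "0 < M" and sub: "ball z (2 * \<rho>) \<subseteq> E" "E \<subseteq> \<Omega>"
      and E [measurable]: "E \<in> sets borel"
      and I: "(\<integral>\<^sup>+x. ennreal (excess 0 (u x) powr p) * indicator E x \<partial>lborel) \<le> ennreal (?c * \<rho> ^ ?n * M powr p)"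
      and T: "(\<integral>\<^sup>+y. ennreal (excess 0 (u y) powr (p - 1) * ?J (y - z)) * indicator (- E) y \<partial>lborel)
        \<le> ennreal (1 / 2 * \<rho> powr (- (p * s)) * M powr (p - 1))"
    let ?f = "\<lambda>y. excess 0 (u y) powr (p - 1) * ?J (y - z)" and ?h = "\<theta> * M"
    have [measurable]: "u \<in> borel_measurable borel" using dg by (simp add: degiorgi_class_def)
    have far_sets: "{h::'a. \<rho> \<le> norm h} \<in> sets borel"
      by (intro borel_closed closed_Collect_le continuous_intros)
    note far_sets [measurable]
    have h: "0 < ?h" using \<theta> M by simp
    \<comment> \<open>Above the height \<open>?h\<close>, the power \<open>p - 1\<close> of the
      excess is at most its p-th power divided by \<open>?h\<close>; outside
      \<open>ball z \<rho>\<close> the kernel is at most \<open>\<rho> powr (- (n + p * s))\<close>.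
      The product of both constants is \<open>k\<close>.\<close>
    define k where "k = \<rho> powr (- (real ?n + p * s)) / ?h"
    have k: "0 \<le> k" using h by (simp add: k_def)
    have J_int: "(\<integral>\<^sup>+y. ennreal (?J (z - y)) * indicator {h. \<rho> \<le> norm h} (z - y) \<partial>lborel) \<le> ennreal (C5 * \<rho> powr (- (p * s)))"
    proof -
      have "(\<integral>\<^sup>+y. ennreal (?J (z - y)) * indicator {h. \<rho> \<le> norm h} (z - y) \<partial>lborel)
          = (\<integral>\<^sup>+h. ennreal (?J h) * indicator {h. \<rho> \<le> norm h} h \<partial>lborel)"
        by (rule nn_integral_lborel_diff[where g = "\<lambda>h. ennreal (?J h) * indicator {h. \<rho> \<le> norm h} h"]) measurable
      also have "\<dots> \<le> ennreal (C5 * \<rho> powr (- (p * s)))" by (rule C5(2)[OF \<rho>])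
      finally show ?thesis .
    qed
    have pw: "ennreal (?f y) * indicator (- ball z \<rho>) y
        \<le> ennreal (?h powr (p - 1)) * (ennreal (?J (z - y)) * indicator {h. \<rho> \<le> norm h} (z - y))
          + (ennreal k * (ennreal (excess 0 (u y) powr p) * indicator E y)
          + ennreal (?f y) * indicator (- E) y)" for y
    proof -
      consider "y \<in> ball z \<rho>" | "y \<notin> ball z \<rho>" "y \<notin> E" | "y \<notin> ball z \<rho>" "y \<in> E" by blast
      then show ?thesis
      proof cases
        case 2
        then show ?thesis by (simp add: add_increasing)
      next
        case 3
        then have far: "\<rho> \<le> norm (z - y)" by (simp add: dist_norm)
        show ?thesis
        proof (cases "excess 0 (u y) \<le> ?h")
          case True
          have "?f y \<le> ?h powr (p - 1) * ?J (z - y)"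
            unfolding frac_kernel_commute[of _ y z] using True ps
            by (intro mult_right_mono powr_mono2) auto
          then have "ennreal (?f y) \<le> ennreal (?h powr (p - 1)) * ennreal (?J (z - y))"
            by (simp add: ennreal_mult[symmetric] ennreal_leI)
          then show ?thesis using 3 far by (auto intro: add_increasing2)
        next
          case False
          let ?e = "excess 0 (u y)"
          have "?e powr (p - 1) * ?h \<le> ?e powr (p - 1) * ?e"
            using False by (intro mult_left_mono) auto
          then have "?e powr (p - 1) * ?h \<le> ?e powr p" using powr_minus_one_mult[of ?e p] by simp
          then have "?e powr (p - 1) \<le> ?e powr p / ?h" using h by (simp add: pos_le_divide_eq)
          moreover have "?J (y - z) \<le> \<rho> powr (- (real ?n + p * s))"
            unfolding frac_kernel_def using far \<rho> a
            by (intro powr_mono2') (auto simp: norm_minus_commute)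
          ultimately have "?f y \<le> ?e powr p / ?h * \<rho> powr (- (real ?n + p * s))"
            using h by (intro mult_mono) auto
          then have "?f y \<le> k * ?e powr p" by (simp add: k_def mult_ac)
          then have "ennreal (?f y) \<le> ennreal k * ennreal (?e powr p)"
            using k by (simp add: ennreal_mult[symmetric] ennreal_leI)
          then show ?thesis using 3 by (auto intro: add_increasing)
        qed
      qed simp
    qed
    have "(\<integral>\<^sup>+y. ennreal (?f y) * indicator (- ball z \<rho>) y \<partial>lborel)
      \<le> (\<integral>\<^sup>+y. ennreal (?h powr (p - 1)) * (ennreal (?J (z - y)) * indicator {h. \<rho> \<le> norm h} (z - y))
          + (ennreal k * (ennreal (excess 0 (u y) powr p) * indicator E y)
          + ennreal (?f y) * indicator (- E) y) \<partial>lborel)"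
      by (intro nn_integral_mono pw)
    also have "\<dots> = ennreal (?h powr (p - 1)) * (\<integral>\<^sup>+y. ennreal (?J (z - y)) * indicator {h. \<rho> \<le> norm h} (z - y) \<partial>lborel)
        + (ennreal k * (\<integral>\<^sup>+y. ennreal (excess 0 (u y) powr p) * indicator E y \<partial>lborel)
        + (\<integral>\<^sup>+y. ennreal (?f y) * indicator (- E) y \<partial>lborel))"
    proof -
      have m1: "(\<lambda>y. ennreal (?J (z - y)) * indicator {h. \<rho> \<le> norm h} (z - y)) \<in> borel_measurable lborel"
        and m2: "(\<lambda>y. ennreal (excess 0 (u y) powr p) * indicator E y) \<in> borel_measurable lborel"
        and m3: "(\<lambda>y. ennreal (?f y) * indicator (- E) y) \<in> borel_measurable lborel"
        by measurable
      note c1 = borel_measurable_times_ennreal[OF borel_measurable_const m1]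
        and c2 = borel_measurable_times_ennreal[OF borel_measurable_const m2]
      show ?thesis
        by (simp only: nn_integral_add[OF c1 borel_measurable_add[OF c2 m3]] nn_integral_add[OF c2 m3]
          nn_integral_cmult[OF m1] nn_integral_cmult[OF m2])
    qed
    also have "\<dots> \<le> ennreal (?h powr (p - 1)) * ennreal (C5 * \<rho> powr (- (p * s)))
        + (ennreal k * ennreal (?c * \<rho> ^ ?n * M powr p) + ennreal (1 / 2 * \<rho> powr (- (p * s)) * M powr (p - 1)))"
      by (intro add_mono mult_left_mono J_int I T) auto
    also have "\<dots> = ennreal (?h powr (p - 1) * (C5 * \<rho> powr (- (p * s))) + (k * (?c * \<rho> ^ ?n * M powr p) + 1 / 2 * \<rho> powr (- (p * s)) * M powr (p - 1)))"
    proof -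
      have "ennreal a1 * ennreal b1 + (ennreal a2 * ennreal b2 + ennreal d) = ennreal (a1 * b1 + (a2 * b2 + d))"
        if "0 \<le> a1" "0 \<le> b1" "0 \<le> a2" "0 \<le> b2" "0 \<le> d" for a1 b1 a2 b2 d
        using that by (simp add: ennreal_mult ennreal_plus)
      then show ?thesis using C5 k c \<theta> \<rho> by simp
    qed
    also have "\<dots> \<le> ennreal (\<rho> powr (- (p * s)) * M powr (p - 1))"
    proof (rule ennreal_leI)
      let ?X = "\<rho> powr (- (p * s)) * M powr (p - 1)"
      have "?h powr (p - 1) * (C5 * \<rho> powr (- (p * s))) = (\<theta> powr (p - 1) * C5) * ?X"
        by (simp add: powr_mult mult_ac)
      then have 1: "?h powr (p - 1) * (C5 * \<rho> powr (- (p * s))) = 1 / 4 * ?X" by (simp only: \<theta>_powr)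
      have "\<rho> powr (- (real ?n + p * s)) * \<rho> ^ ?n = \<rho> powr (- (p * s))"
        using \<rho> by (simp add: powr_realpow[symmetric] powr_add[symmetric])
      moreover have "M powr p = M powr (p - 1) * M" using M powr_minus_one_mult[of M p] by simp
      ultimately have "k * (?c * \<rho> ^ ?n * M powr p) = ?c / \<theta> * ?X"
        using M \<theta> by (simp add: k_def field_simps)
      also have "\<dots> \<le> 1 / 4 * ?X" using \<theta> by (intro mult_right_mono) (auto simp: field_simps min_def)
      finally have 2: "k * (?c * \<rho> ^ ?n * M powr p) \<le> 1 / 4 * ?X" .
      have "a + (b + 1 / 2 * x * y) \<le> x * y" if "a = 1 / 4 * (x * y)" "b \<le> 1 / 4 * (x * y)" for a b x y :: real
        using that by simp
      from this[OF 1 2] show "?h powr (p - 1) * (C5 * \<rho> powr (- (p * s)))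
          + (k * (?c * \<rho> ^ ?n * M powr p) + 1 / 2 * \<rho> powr (- (p * s)) * M powr (p - 1)) \<le> ?X" .
    qed
    finally have tail: "(\<integral>\<^sup>+y. ennreal (?f y) * indicator (- ball z \<rho>) y \<partial>lborel) \<le> ennreal (\<rho> powr (- (p * s)) * M powr (p - 1))" .
    have avg: "(\<integral>\<^sup>+x. ennreal (excess 0 (u x) powr p) * indicator (ball z (2 * \<rho>)) x \<partial>lborel) \<le> ennreal (c * \<rho> ^ ?n * M powr p)"
    proof -
      have "(\<integral>\<^sup>+x. ennreal (excess 0 (u x) powr p) * indicator (ball z (2 * \<rho>)) x \<partial>lborel)
          \<le> (\<integral>\<^sup>+x. ennreal (excess 0 (u x) powr p) * indicator E x \<partial>lborel)"
        using sub by (intro nn_integral_mono mult_left_mono) (auto simp: indicator_def)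
      also note I
      also have "ennreal (?c * \<rho> ^ ?n * M powr p) \<le> ennreal (c * \<rho> ^ ?n * M powr p)"
        using \<rho> by (intro ennreal_leI mult_right_mono) auto
      finally show ?thesis .
    qed
    show "AE x in lborel. x \<in> ball z \<rho> \<longrightarrow> u x \<le> M"
      using sub by (intro bound[OF dg \<rho> M _ avg tail]) auto
  qed (use c \<theta> in simp)
qed

text \<open>\<open>v\<close> is not assumed p-integrable on the whole space, so the far values are
  reached through the energy: by Fubini some \<open>x\<close> near \<open>x0\<close> has a finite
  inner integral. For \<open>y\<close> outside \<open>ball x0 r\<close> the kernel centred at
  \<open>x0\<close> is bounded by a multiple of that centred at \<open>x\<close>, and
  \<open>v y\<close> is compared with \<open>v x\<close>; constants are integrable against the
  kernel there.\<close>

lemma tail_integral_finite: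
  fixes v :: "real ^ 'n \<Rightarrow> real"
  assumes vb: "v \<in> borel_measurable borel" and v: "v \<in> X_space s p \<Omega>" and ps: "1 < p" "0 < s"
    and r: "0 < r" and sub: "ball x0 r \<subseteq> \<Omega>"
  shows "(\<integral>\<^sup>+y. ennreal (excess 0 (v y) powr (p - 1) * frac_kernel (p * s) (y - x0)) * indicator (- ball x0 r) y \<partial>lborel) < \<infinity>"
proof -
  let ?J = "frac_kernel (p * s) :: real ^ 'n \<Rightarrow> real" and ?e = "real CARD('n) + p * s"
  have a: "0 < p * s" using ps by simp
  have [measurable]: "v \<in> borel_measurable borel" by (rule vb)
  have [measurable]: "ball z e \<in> sets borel" for z :: "real ^ 'n" and e by simp
  let ?g = "\<lambda>xy. ennreal (\<bar>v (fst xy) - v (snd xy)\<bar> powr p * ?J (fst xy - snd xy)) * indicator (ball x0 r) (fst xy)"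
  have gb: "?g \<in> borel_measurable borel" unfolding borel_prod[symmetric] by measurable
  have "(\<integral>\<^sup>+xy. ?g xy \<partial>lebesgue) \<le> (\<integral>\<^sup>+xy. ennreal (norm (indicator (- ((- \<Omega>) \<times> (- \<Omega>))) xy *\<^sub>R gagliardo s p v xy)) \<partial>lebesgue)"
    using sub by (intro nn_integral_mono) (auto simp: indicator_def gagliardo_eq)
  also have "\<dots> < \<infinity>" using v by (simp only: X_space_def set_integrable_def integrable_iff_bounded mem_Collect_eq)
  finally have fin: "(\<integral>\<^sup>+x. \<integral>\<^sup>+y. ?g (x, y) \<partial>lborel \<partial>lborel) < \<infinity>"
    by (simp only: nn_integral_iterated_lebesgue[OF gb])
  have ae: "AE x in lborel. (\<integral>\<^sup>+y. ?g (x, y) \<partial>lborel) \<noteq> \<infinity>"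
    by (rule nn_integral_PInf_AE) (use fin in auto)
  have nonnull: "\<not> (AE x in lborel. x \<notin> ball x0 (r / 2))"
  proof
    assume "AE x in lborel. x \<notin> ball x0 (r / 2)"
    then have "emeasure lborel (ball x0 (r / 2)) = 0"
      by (subst (asm) AE_iff_measurable[OF _ refl]) (auto simp: ball_def)
    moreover have "0 < unit_ball_vol (real CARD('n)) * (r / 2) ^ CARD('n)" using r by simp
    ultimately show False using r by (simp add: emeasure_ball ennreal_eq_0_iff)
  qed
  have "\<exists>x\<in>ball x0 (r / 2). (\<integral>\<^sup>+y. ?g (x, y) \<partial>lborel) \<noteq> \<infinity>"
  proof (rule ccontr)
    assume none: "\<not> ?thesis"
    have "AE x in lborel. x \<notin> ball x0 (r / 2)"
      by (rule eventually_mono[OF ae]) (use none in blast)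
    then show False using nonnull by contradiction
  qed
  then obtain x where x: "x \<in> ball x0 (r / 2)" and xf: "(\<integral>\<^sup>+y. ?g (x, y) \<partial>lborel) \<noteq> \<infinity>" by blast
  have xr: "x \<in> ball x0 r" using x r by auto
  have xf: "(\<integral>\<^sup>+y. ennreal (\<bar>v x - v y\<bar> powr p * ?J (x - y)) \<partial>lborel) < \<infinity>"
    using xf xr by (simp add: less_top)
  obtain C where C: "(\<integral>\<^sup>+h. ennreal (?J h) * indicator {h. r \<le> norm h} h \<partial>lborel) \<le> ennreal (C * r powr (- (p * s)))"
    using frac_kernel_far[OF a, where 'a = "real ^ 'n"] r by blast
  have far_sets: "{h::real ^ 'n. r \<le> norm h} \<in> sets borel"
    by (intro borel_closed closed_Collect_le continuous_intros)
  note far_sets [measurable]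
  have J_int: "(\<integral>\<^sup>+y. ennreal (?J (x0 - y)) * indicator {h. r \<le> norm h} (x0 - y) \<partial>lborel) < \<infinity>"
  proof -
    have "(\<integral>\<^sup>+y. ennreal (?J (x0 - y)) * indicator {h. r \<le> norm h} (x0 - y) \<partial>lborel)
        = (\<integral>\<^sup>+h. ennreal (?J h) * indicator {h. r \<le> norm h} h \<partial>lborel)"
      by (rule nn_integral_lborel_diff[where g = "\<lambda>h. ennreal (?J h) * indicator {h. r \<le> norm h} h"]) measurable
    then show ?thesis using C by (auto intro: le_less_trans)
  qed
  define a1 where "a1 = 1 + 2 powr p * \<bar>v x\<bar> powr p"
  define a2 where "a2 = 2 powr p * 2 powr ?e"
  have a12: "0 \<le> a1" "0 \<le> a2" by (auto simp: a1_def a2_def)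
  have pw: "ennreal (excess 0 (v y) powr (p - 1) * ?J (y - x0)) * indicator (- ball x0 r) y
     \<le> ennreal a1 * (ennreal (?J (x0 - y)) * indicator {h. r \<le> norm h} (x0 - y))
       + ennreal a2 * ennreal (\<bar>v x - v y\<bar> powr p * ?J (x - y))" for y
  proof (cases "y \<in> ball x0 r")
    case False
    then have y: "r \<le> norm (y - x0)" by (simp add: dist_norm norm_minus_commute)
    have "norm (x - y) \<le> norm (x - x0) + norm (y - x0)"
      using norm_triangle_ineq4[of "x - x0" "y - x0"] by simp
    then have "norm (x - y) \<le> 2 * norm (y - x0)"
      using x y r by (simp add: dist_norm norm_minus_commute)
    moreover have "x \<noteq> y" using False xr by auto
    ultimately have "(2 * norm (y - x0)) powr (- ?e) \<le> ?J (x - y)"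
      unfolding frac_kernel_def DIM_cart DIM_real mult_1_right using a by (intro powr_mono2') auto
    then have "2 powr (- ?e) * ?J (y - x0) \<le> ?J (x - y)" by (simp add: frac_kernel_def powr_mult)
    then have J: "?J (y - x0) \<le> 2 powr ?e * ?J (x - y)"
      by (simp add: powr_minus field_simps del: minus_add_distrib)
    have "excess 0 (v y) powr (p - 1) \<le> 1 + \<bar>v y\<bar> powr p"
    proof (cases "excess 0 (v y) \<le> 1")
      case True
      then have "excess 0 (v y) powr (p - 1) \<le> 1" using ps by (intro powr_le1) auto
      then show ?thesis by (simp add: add_increasing2)
    next
      case False
      then have "excess 0 (v y) powr (p - 1) \<le> excess 0 (v y) powr p" by (intro powr_mono) auto
      also have "\<dots> \<le> \<bar>v y\<bar> powr p" using ps by (intro powr_mono2) (auto simp: excess_def)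
      finally show ?thesis by simp
    qed
    also have "\<bar>v y\<bar> powr p \<le> (\<bar>v x - v y\<bar> + \<bar>v x\<bar>) powr p" using ps by (intro powr_mono2) auto
    also have "\<dots> \<le> 2 powr p * (\<bar>v x - v y\<bar> powr p + \<bar>v x\<bar> powr p)" using ps by (intro powr_add_le) auto
    finally have "excess 0 (v y) powr (p - 1) \<le> a1 + 2 powr p * \<bar>v x - v y\<bar> powr p"
      by (simp add: a1_def algebra_simps)
    then have "excess 0 (v y) powr (p - 1) * ?J (y - x0) \<le> (a1 + 2 powr p * \<bar>v x - v y\<bar> powr p) * ?J (y - x0)"
      by (intro mult_right_mono) auto
    also have "\<dots> = a1 * ?J (y - x0) + 2 powr p * \<bar>v x - v y\<bar> powr p * ?J (y - x0)"
      by (simp add: distrib_right)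
    also have "\<dots> \<le> a1 * ?J (y - x0) + 2 powr p * \<bar>v x - v y\<bar> powr p * (2 powr ?e * ?J (x - y))"
      using J by (intro add_left_mono mult_left_mono) auto
    also have "\<dots> = a1 * ?J (x0 - y) + a2 * (\<bar>v x - v y\<bar> powr p * ?J (x - y))"
      by (simp add: a2_def frac_kernel_commute[of _ y x0] mult_ac)
    finally have "ennreal (excess 0 (v y) powr (p - 1) * ?J (y - x0))
       \<le> ennreal (a1 * ?J (x0 - y) + a2 * (\<bar>v x - v y\<bar> powr p * ?J (x - y)))" by (rule ennreal_leI)
    also have "\<dots> = ennreal a1 * ennreal (?J (x0 - y)) + ennreal a2 * ennreal (\<bar>v x - v y\<bar> powr p * ?J (x - y))"
      using a12 by (simp add: ennreal_mult)
    finally show ?thesis using False y by (simp add: norm_minus_commute)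
  qed simp
  have "(\<integral>\<^sup>+y. ennreal (excess 0 (v y) powr (p - 1) * ?J (y - x0)) * indicator (- ball x0 r) y \<partial>lborel)
     \<le> (\<integral>\<^sup>+y. ennreal a1 * (ennreal (?J (x0 - y)) * indicator {h. r \<le> norm h} (x0 - y))
       + ennreal a2 * ennreal (\<bar>v x - v y\<bar> powr p * ?J (x - y)) \<partial>lborel)"
    by (intro nn_integral_mono pw)
  also have "\<dots> = ennreal a1 * (\<integral>\<^sup>+y. ennreal (?J (x0 - y)) * indicator {h. r \<le> norm h} (x0 - y) \<partial>lborel)
       + ennreal a2 * (\<integral>\<^sup>+y. ennreal (\<bar>v x - v y\<bar> powr p * ?J (x - y)) \<partial>lborel)"
  proof -
    have m1: "(\<lambda>y. ennreal (?J (x0 - y)) * indicator {h. r \<le> norm h} (x0 - y)) \<in> borel_measurable lborel"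
      and m2: "(\<lambda>y. ennreal (\<bar>v x - v y\<bar> powr p * ?J (x - y))) \<in> borel_measurable lborel"
      by measurable
    show ?thesis
      by (simp only: nn_integral_add[OF borel_measurable_times_ennreal[OF borel_measurable_const m1]
            borel_measurable_times_ennreal[OF borel_measurable_const m2]]
          nn_integral_cmult[OF m1] nn_integral_cmult[OF m2])
  qed
  also have "\<dots> < \<infinity>" using J_int xf by (simp add: ennreal_mult_less_top)
  finally show ?thesis .
qed

text \<open>Translates the Bochner integrals of the statement into the extended nonnegative
  integrals of the iteration; finiteness excludes the default value 0.\<close>

lemma nn_integral_eq_set_lebesgue_integral:
  fixes f g :: "'a::euclidean_space \<Rightarrow> real"
  assumes f: "f \<in> borel_measurable borel" "\<And>x. 0 \<le> f x" and g: "AE x in lebesgue. g x = f x"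
    and A: "A \<in> sets borel" and fin: "(\<integral>\<^sup>+x. ennreal (f x) * indicator A x \<partial>lborel) < \<infinity>"
  shows "(\<integral>\<^sup>+x. ennreal (f x) * indicator A x \<partial>lborel) = ennreal (LINT x:A|lebesgue. g x)"
    and "0 \<le> (LINT x:A|lebesgue. g x)"
proof -
  have fl: "f \<in> borel_measurable lebesgue" using f by (intro measurable_completion) simp
  have gl: "g \<in> borel_measurable lebesgue"
    by (rule lebesgue_measurable_AE_cong[OF fl]) (use g in \<open>auto elim!: eventually_mono\<close>)
  have Al: "A \<in> sets lebesgue" using A by auto
  have ind: "ennreal (indicator A x *\<^sub>R f x) = ennreal (f x) * indicator A x" for x
    by (simp add: indicator_def)
  have m: "(\<lambda>x. indicator A x *\<^sub>R f x) \<in> borel_measurable lebesgue" "(\<lambda>x. indicator A x *\<^sub>R g x) \<in> borel_measurable lebesgue"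
    using fl gl Al by (auto intro!: borel_measurable_scaleR borel_measurable_indicator)
  have nn: "0 \<le> indicator A x *\<^sub>R f x" for x using f by simp
  have "integrable lebesgue (\<lambda>x. indicator A x *\<^sub>R f x)"
  proof (rule integrableI_nonneg[OF m(1)])
    show "(\<integral>\<^sup>+x. ennreal (indicator A x *\<^sub>R f x) \<partial>lebesgue) < \<infinity>"
      by (simp only: ind nn_integral_completion fin)
  qed (use nn in simp)
  then have "(\<integral>\<^sup>+x. ennreal (indicator A x *\<^sub>R f x) \<partial>lebesgue) = ennreal (\<integral>x. indicator A x *\<^sub>R f x \<partial>lebesgue)"
    using nn by (intro nn_integral_eq_integral) auto
  moreover have eq: "(\<integral>x. indicator A x *\<^sub>R f x \<partial>lebesgue) = (LINT x:A|lebesgue. g x)"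
    unfolding set_lebesgue_integral_def using m g by (intro integral_cong_AE) (auto elim!: eventually_mono)
  ultimately show "(\<integral>\<^sup>+x. ennreal (f x) * indicator A x \<partial>lborel) = ennreal (LINT x:A|lebesgue. g x)"
    by (simp only: ind nn_integral_completion)
  show "0 \<le> (LINT x:A|lebesgue. g x)"
    unfolding eq[symmetric] using nn by (intro Bochner_Integration.integral_nonneg) auto
qed

section \<open>Covering by small balls and the final bound\<close>

lemma pos_part_eq_excess: "pos_part f x = excess 0 (f x)"
  by (simp add: pos_part_def excess_def)

text \<open>Only countably many exceptional sets may be united, so the centres are taken from a
  countable dense set. For each \<open>x\<close> a centre is found in the nonempty open set
  \<open>ball x \<rho> \<inter> ball x0 r\<close>.\<close>

lemma AE_ball_of_AE_small_balls:
  fixes x0 :: "'a::euclidean_space"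
  assumes "0 < \<rho>" and "\<And>z. z \<in> ball x0 r \<Longrightarrow> AE x in M. x \<in> ball z \<rho> \<longrightarrow> P x"
  shows "AE x in M. x \<in> ball x0 r \<longrightarrow> P x"
proof -
  obtain D :: "'a set" where D: "countable D" "\<And>X. open X \<Longrightarrow> X \<noteq> {} \<Longrightarrow> \<exists>d\<in>D. d \<in> X"
    using countable_dense_setE by blast
  have "AE x in M. \<forall>z\<in>D \<inter> ball x0 r. x \<in> ball z \<rho> \<longrightarrow> P x"
    using D(1) assms(2) by (intro AE_ball_countable') auto
  then show ?thesis
  proof (rule eventually_mono)
    fix x assume all: "\<forall>z\<in>D \<inter> ball x0 r. x \<in> ball z \<rho> \<longrightarrow> P x"
    show "x \<in> ball x0 r \<longrightarrow> P x"
    proof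
      assume x: "x \<in> ball x0 r"
      then have "x \<in> ball x \<rho> \<inter> ball x0 r" using \<open>0 < \<rho>\<close> by simp
      then have "ball x \<rho> \<inter> ball x0 r \<noteq> {}" by blast
      then obtain d where "d \<in> D" "d \<in> ball x \<rho> \<inter> ball x0 r"
        using D(2)[of "ball x \<rho> \<inter> ball x0 r"] by auto
      then show "P x" using all by (auto simp: dist_commute)
    qed
  qed
qed

theorem theorem1p1:
  fixes s p lam Lam :: real and \<Omega> :: "(real ^ 'n) set"
  assumes "0 < s" "s < 1" "p > 1" "0 < lam" "lam \<le> Lam"
    and "real CARD('n) / (p * s) > 1"
    and "bounded_lipschitz_domain \<Omega>"
  shows "\<exists>C0>0. \<forall>q K V g x0 r u.
      q > real CARD('n) / (p * s) \<longrightarrow> admissible_kernel s p lam Lam K \<longrightarrow>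
      V \<in> potentials q \<longrightarrow> g \<in> W_space s p \<longrightarrow>
      r > 0 \<longrightarrow> ball x0 (2 * r) \<subseteq> \<Omega> \<longrightarrow> weak_subsolution s p K V \<Omega> g u \<longrightarrow>
      (\<forall>\<delta>\<in>{0<..1}.
         esssup (restrict_space lebesgue (ball x0 r)) (\<lambda>x. ereal (u x))
         \<le> ereal (\<delta> * tail s p r (pos_part u) x0
             + C0 * \<delta> powr (- ((p - 1) * real CARD('n) / (s * p\<^sup>2))) *
               ((LINT x:ball x0 (2 * r)|lebesgue. (pos_part u x) powr p)
                  / measure lebesgue (ball x0 (2 * r))) powr (1 / p)))"
proof -
  let ?n = "CARD('n)" and ?J = "frac_kernel (p * s) :: real ^ 'n \<Rightarrow> real"
  note ps = assms(3,1,2) and lam = assms(4)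
  have Lam: "0 \<le> Lam" "0 < Lam" using assms by auto
  have a: "0 < p * s" using ps by simp
  have open_\<Omega>: "open \<Omega>" using assms(7) by (simp add: bounded_lipschitz_domain_def)
  define C1 where "C1 = Lam / (lam * 2 powr (- p - 1)) * ((2 * p) powr p + 3)"
  have C1: "0 < C1" unfolding C1_def using Lam lam by (intro mult_pos_pos divide_pos_pos add_nonneg_pos) auto
  obtain c where c: "0 < c" and bound: "\<And>(v :: real ^ 'n \<Rightarrow> real) z \<rho> M E. degiorgi_class s p C1 \<Omega> v \<Longrightarrow> 0 < \<rho> \<Longrightarrow> 0 < M \<Longrightarrow>
      ball z (2 * \<rho>) \<subseteq> E \<Longrightarrow> E \<subseteq> \<Omega> \<Longrightarrow> E \<in> sets borel \<Longrightarrow>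
      (\<integral>\<^sup>+x. ennreal (excess 0 (v x) powr p) * indicator E x \<partial>lborel) \<le> ennreal (c * \<rho> ^ DIM(real ^ 'n) * M powr p) \<Longrightarrow>
      (\<integral>\<^sup>+y. ennreal (excess 0 (v y) powr (p - 1) * ?J (y - z)) * indicator (- E) y \<partial>lborel)
        \<le> ennreal (1 / 2 * \<rho> powr (- (p * s)) * M powr (p - 1)) \<Longrightarrow>
      (AE x in lborel. x \<in> ball z \<rho> \<longrightarrow> v x \<le> M)"
    using degiorgi_local_bound_mixed[OF ps C1, where 'a = "real ^ 'n"] by blast
  define S where "S = sphere_area (real ?n)"
  have S: "0 < S" by (auto simp: S_def sphere_area_def intro!: divide_pos_pos Gamma_real_pos)
  \<comment> \<open>\<open>p * s / S\<close> is the normalisation inside \<open>tail\<close>,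
    \<open>2 powr (n + p * s)\<close> the price of moving the centre of the kernel from
    \<open>x0\<close> to \<open>z\<close>, and the separate 2 answers the 1/2 in the tail hypothesis
    of \<open>bound\<close>.\<close>
  define b where "b = p * s / (S * (2 * 2 powr (real ?n + p * s)))"
  have b: "0 < b" using a S by (simp add: b_def)
  \<comment> \<open>The entry 1/2 gives \<open>2 * \<rho> \<le> r\<close>, so
    \<open>ball z (2 * \<rho>)\<close> stays in the ball of radius \<open>2 * r\<close>; the other
    entry serves the tail condition.\<close>
  define \<epsilon> where "\<epsilon> = min (1 / 2) (b powr (1 / (p * s)))"
  have \<epsilon>: "0 < \<epsilon>" "\<epsilon> \<le> 1 / 2" using b by (auto simp: \<epsilon>_def)
  have \<epsilon>b: "\<epsilon> powr (p * s) \<le> b"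
  proof -
    have "\<epsilon> powr (p * s) \<le> (b powr (1 / (p * s))) powr (p * s)"
      using \<epsilon> a by (intro powr_mono2) (auto simp: \<epsilon>_def)
    also have "\<dots> = b" using ps b by (simp add: powr_powr)
    finally show ?thesis .
  qed
  define A where "A = unit_ball_vol (real ?n) * 2 ^ ?n"
  have A: "0 < A" by (simp add: A_def)
  \<comment> \<open>\<open>A * r ^ n\<close> is the volume of \<open>ball x0 (2 * r)\<close>, and
    \<open>C0\<close> solves \<open>c * \<epsilon> ^ n * C0 powr p = A\<close>: with it the lower
    bound on \<open>M\<close> by the average implies the integral hypothesis of
    \<open>bound\<close>.\<close>
  define C0 where "C0 = (A / (c * \<epsilon> ^ ?n)) powr (1 / p)"
  have C0: "0 < C0" using A c \<epsilon> by (simp add: C0_def)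
  have C0p: "C0 powr p = A / (c * \<epsilon> ^ ?n)" using ps A c \<epsilon> by (simp add: C0_def powr_powr)
  show ?thesis
  proof (intro exI[of _ C0] conjI allI impI ballI)
    fix q \<delta> r :: real and K V g u :: "real ^ 'n \<Rightarrow> real" and x0 :: "real ^ 'n"
    assume K: "admissible_kernel s p lam Lam K" and V: "V \<in> potentials q" and r: "r > 0"
      and sub: "ball x0 (2 * r) \<subseteq> \<Omega>" and u: "weak_subsolution s p K V \<Omega> g u" and "\<delta> \<in> {0<..1}"
    then have \<delta>: "0 < \<delta>" "\<delta> \<le> 1" by auto
    have K_meas: "K \<in> borel_measurable lebesgue" using K by (simp add: admissible_kernel_def)
    obtain v where vb: "v \<in> borel_measurable borel" and ae: "AE x in lebesgue. u x = v x"
      and vY: "v \<in> Y_space s p V \<Omega>"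
      and test: "\<forall>\<phi>\<in>Y0_space s p V \<Omega>. \<phi> \<in> borel_measurable borel \<longrightarrow> (\<forall>x. 0 \<le> \<phi> x) \<longrightarrow> (\<forall>x. \<phi> x \<noteq> 0 \<longrightarrow> 0 \<le> v x) \<longrightarrow>
        (\<integral>z. H p (v (fst z) - v (snd z)) * (\<phi> (fst z) - \<phi> (snd z)) * K (fst z - snd z) \<partial>lebesgue) \<le> 0"
      using borel_representative[OF u V K_meas open_\<Omega>] by blast
    have [measurable]: "v \<in> borel_measurable borel" by (rule vb)
    have vX: "v \<in> X_space s p \<Omega>" using vY by (simp add: Y_space_def)
    have dg: "degiorgi_class s p C1 \<Omega> v"
      unfolding C1_def by (rule degiorgi_class_of_subsolution[OF K vb vY V open_\<Omega> ps lam Lam(1) test])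
    let ?E = "ball x0 (2 * r)"
    define I where "I = (LINT x:?E|lebesgue. (pos_part u x) powr p)"
    define \<Theta> where "\<Theta> = (LINT y:- ball x0 r|lebesgue. \<bar>pos_part u y\<bar> powr (p - 1) / norm (y - x0) powr (real CARD('n) + p * s))"
    have I: "(\<integral>\<^sup>+x. ennreal (excess 0 (v x) powr p) * indicator ?E x \<partial>lborel) = ennreal I" "0 \<le> I"
    proof -
      have ae': "AE x in lebesgue. pos_part u x powr p = excess 0 (v x) powr p"
        using ae by (rule eventually_mono) (simp add: pos_part_eq_excess)
      have "(\<integral>\<^sup>+x. ennreal (excess 0 (v x) powr p) * indicator ?E x \<partial>lborel)
          \<le> (\<integral>\<^sup>+x. ennreal (norm (indicator \<Omega> x *\<^sub>R \<bar>v x\<bar> powr p)) \<partial>lebesgue)"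
        unfolding nn_integral_completion using sub ps
        by (intro nn_integral_mono) (auto simp: indicator_def excess_def intro!: ennreal_leI powr_mono2)
      also have "\<dots> < \<infinity>" using vX by (simp only: X_space_def set_integrable_def integrable_iff_bounded mem_Collect_eq)
      finally have fin: "(\<integral>\<^sup>+x. ennreal (excess 0 (v x) powr p) * indicator ?E x \<partial>lborel) < \<infinity>" .
      have m: "(\<lambda>x. excess 0 (v x) powr p) \<in> borel_measurable borel" by measurable
      show "(\<integral>\<^sup>+x. ennreal (excess 0 (v x) powr p) * indicator ?E x \<partial>lborel) = ennreal I" "0 \<le> I"
        unfolding I_def using nn_integral_eq_set_lebesgue_integral[OF m _ ae' _ fin] by auto
    qed
    have \<Theta>: "(\<integral>\<^sup>+y. ennreal (excess 0 (v y) powr (p - 1) * ?J (y - x0)) * indicator (- ball x0 r) y \<partial>lborel) = ennreal \<Theta>" "0 \<le> \<Theta>"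
    proof -
      have ae': "AE y in lebesgue. \<bar>pos_part u y\<bar> powr (p - 1) / norm (y - x0) powr (real CARD('n) + p * s)
          = excess 0 (v y) powr (p - 1) * ?J (y - x0)"
        using ae by (rule eventually_mono) (simp add: pos_part_eq_excess frac_kernel_cart)
      have "ball x0 r \<subseteq> ?E" using r by (intro subset_ball) simp
      then have "ball x0 r \<subseteq> \<Omega>" using sub by blast
      then have fin: "(\<integral>\<^sup>+y. ennreal (excess 0 (v y) powr (p - 1) * ?J (y - x0)) * indicator (- ball x0 r) y \<partial>lborel) < \<infinity>"
        by (rule tail_integral_finite[OF vb vX ps(1,2) r])
      have m: "(\<lambda>y. excess 0 (v y) powr (p - 1) * ?J (y - x0)) \<in> borel_measurable borel" by measurable
      show "(\<integral>\<^sup>+y. ennreal (excess 0 (v y) powr (p - 1) * ?J (y - x0)) * indicator (- ball x0 r) y \<partial>lborel) = ennreal \<Theta>" "0 \<le> \<Theta>"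
        unfolding \<Theta>_def using nn_integral_eq_set_lebesgue_integral[OF m _ ae' _ fin] by auto
    qed
    define \<tau> where "\<tau> = tail s p r (pos_part u) x0"
    have \<tau>: "0 \<le> \<tau>" "\<tau> powr (p - 1) = p * s / S * r powr (p * s) * \<Theta>"
    proof -
      have eq: "\<tau> = (p * s / S * r powr (p * s) * \<Theta>) powr (1 / (p - 1))"
        by (simp add: \<tau>_def tail_def S_def \<Theta>_def)
      then show "0 \<le> \<tau>" by simp
      have nn: "0 \<le> p * s / S * r powr (p * s) * \<Theta>" using a S \<Theta> by auto
      have "(x powr (1 / (p - 1))) powr (p - 1) = x" if "0 \<le> x" for x
        using that ps by (simp add: powr_powr)
      then show "\<tau> powr (p - 1) = p * s / S * r powr (p * s) * \<Theta>"
        unfolding eq using nn by blast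
    qed
    define vol where "vol = measure lebesgue ?E"
    have vol: "vol = A * r ^ ?n" using r by (simp add: vol_def A_def content_ball power_mult_distrib)
    have vol_pos: "0 < vol" using A r by (simp add: vol)
    define \<gamma> where "\<gamma> = (p - 1) * real ?n / (s * p\<^sup>2)"
    define avg where "avg = (I / vol) powr (1 / p)"
    have avg: "0 \<le> avg" "avg powr p = I / vol" using I(2) vol_pos ps by (auto simp: avg_def powr_powr)
    \<comment> \<open>The exponent is dictated by the tail:
      \<open>D powr (p * s) = \<delta> powr (p - 1)\<close>. For the average it yields
      \<open>D ^ n = \<delta> powr (\<gamma> * p)\<close>, which cancels the power of \<delta> in
      \<open>M powr p\<close>.\<close>
    define D where "D = \<delta> powr ((p - 1) / (p * s))"
    have D: "0 < D" "D \<le> 1" using \<delta> ps a by (auto simp: D_def intro!: powr_le1)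
    define \<rho> where "\<rho> = \<epsilon> * D * r"
    have \<rho>: "0 < \<rho>" using \<epsilon> D r by (simp add: \<rho>_def)
    have \<rho>_le: "2 * \<rho> \<le> r"
    proof -
      have "\<epsilon> * D \<le> 1 / 2 * 1" using \<epsilon> D by (intro mult_mono) auto
      then have "\<epsilon> * D * r \<le> 1 / 2 * r" using r by (intro mult_right_mono) auto
      then show ?thesis by (simp add: \<rho>_def)
    qed
    have aeM: "AE x in lborel. x \<in> ball x0 r \<longrightarrow> v x \<le> M"
      if M: "0 < M" "\<delta> * \<tau> \<le> M" "C0 * \<delta> powr (- \<gamma>) * avg \<le> M" for M
    proof (rule AE_ball_of_AE_small_balls[OF \<rho>])
      fix z assume z: "z \<in> ball x0 r"
      have sub_z: "ball z (2 * \<rho>) \<subseteq> ?E"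
      proof
        fix y assume "y \<in> ball z (2 * \<rho>)"
        then show "y \<in> ?E" using z \<rho>_le dist_triangle[of x0 y z] by simp
      qed
      have I_le: "I \<le> c * \<rho> ^ ?n * M powr p"
      proof -
        have "(C0 * \<delta> powr (- \<gamma>) * avg) powr p \<le> M powr p"
          using M C0 avg ps by (intro powr_mono2) auto
        moreover have "(C0 * \<delta> powr (- \<gamma>) * avg) powr p = A / (c * \<epsilon> ^ ?n) * \<delta> powr (- (\<gamma> * p)) * (I / vol)"
          by (simp only: powr_mult C0p avg(2) powr_powr) simp
        ultimately have "c * \<rho> ^ ?n * (A / (c * \<epsilon> ^ ?n) * \<delta> powr (- (\<gamma> * p)) * (I / vol)) \<le> c * \<rho> ^ ?n * M powr p"
          using c \<rho> by (intro mult_left_mono) auto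
        moreover have "c * \<rho> ^ ?n * (A / (c * \<epsilon> ^ ?n) * \<delta> powr (- (\<gamma> * p)) * (I / vol)) = I"
        proof -
          have "D ^ ?n = \<delta> powr ((p - 1) / (p * s) * real ?n)" using \<delta> by (simp add: D_def powr_power mult.commute)
          moreover have "(p - 1) / (p * s) * real ?n = \<gamma> * p"
            using ps by (simp add: \<gamma>_def power2_eq_square)
          ultimately have D': "D ^ ?n * \<delta> powr (- (\<gamma> * p)) = 1" using \<delta> by (simp add: powr_add[symmetric])
          have "c * \<rho> ^ ?n * (A / (c * \<epsilon> ^ ?n) * \<delta> powr (- (\<gamma> * p)) * (I / vol))
              = (D ^ ?n * \<delta> powr (- (\<gamma> * p))) * I"
            using c A r \<epsilon> by (simp add: \<rho>_def vol power_mult_distrib)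
          then show ?thesis unfolding D' by simp
        qed
        ultimately show ?thesis by simp
      qed
      have T_le: "(\<integral>\<^sup>+y. ennreal (excess 0 (v y) powr (p - 1) * ?J (y - z)) * indicator (- ?E) y \<partial>lborel)
          \<le> ennreal (1 / 2 * \<rho> powr (- (p * s)) * M powr (p - 1))"
      proof -
        let ?e = "2 powr (real ?n + p * s)"
        have "(\<integral>\<^sup>+y. ennreal (excess 0 (v y) powr (p - 1) * ?J (y - z)) * indicator (- ?E) y \<partial>lborel)
          \<le> (\<integral>\<^sup>+y. ennreal ?e * (ennreal (excess 0 (v y) powr (p - 1) * ?J (y - x0)) * indicator (- ball x0 r) y) \<partial>lborel)"
        proof (intro nn_integral_mono)
          fix y
          show "ennreal (excess 0 (v y) powr (p - 1) * ?J (y - z)) * indicator (- ?E) y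
            \<le> ennreal ?e * (ennreal (excess 0 (v y) powr (p - 1) * ?J (y - x0)) * indicator (- ball x0 r) y)"
          proof (cases "y \<in> ?E")
            case False
            then have y: "2 * r \<le> norm (y - x0)" by (simp add: dist_norm norm_minus_commute)
            have "norm (y - x0) \<le> norm (y - z) + norm (z - x0)" using norm_triangle_ineq[of "y - z" "z - x0"] by simp
            then have "norm (y - x0) / 2 \<le> norm (y - z)" using z y by (simp add: dist_norm norm_minus_commute)
            then have "?J (y - z) \<le> (norm (y - x0) / 2) powr (- (real ?n + p * s))"
              unfolding frac_kernel_def DIM_cart DIM_real mult_1_right using a y r by (intro powr_mono2') auto
            also have "\<dots> = ?e * ?J (y - x0)"
              by (simp add: frac_kernel_def powr_divide powr_minus_divide del: minus_add_distrib)
            finally have "excess 0 (v y) powr (p - 1) * ?J (y - z) \<le> excess 0 (v y) powr (p - 1) * (?e * ?J (y - x0))"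
              by (intro mult_left_mono) auto
            then have "ennreal (excess 0 (v y) powr (p - 1) * ?J (y - z)) \<le> ennreal ?e * ennreal (excess 0 (v y) powr (p - 1) * ?J (y - x0))"
              by (simp add: ennreal_mult[symmetric] ennreal_leI mult_ac)
            then show ?thesis using False y r by (simp add: dist_norm norm_minus_commute)
          qed simp
        qed
        also have "\<dots> = ennreal ?e * ennreal \<Theta>"
          unfolding \<Theta>(1)[symmetric] by (rule nn_integral_cmult) measurable
        also have "\<dots> = ennreal (?e * \<Theta>)" using \<Theta> by (simp add: ennreal_mult)
        also have "\<dots> \<le> ennreal (1 / 2 * \<rho> powr (- (p * s)) * M powr (p - 1))"
        proof (rule ennreal_leI)
          have "(\<delta> * \<tau>) powr (p - 1) \<le> M powr (p - 1)"
            using M \<delta> \<tau> ps by (intro powr_mono2) auto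
          moreover have "(\<delta> * \<tau>) powr (p - 1) = D powr (p * s) * (p * s / S * r powr (p * s) * \<Theta>)"
            using ps by (simp add: powr_mult \<tau> D_def powr_powr)
          ultimately have "1 / 2 * \<rho> powr (- (p * s)) * (D powr (p * s) * (p * s / S * r powr (p * s) * \<Theta>))
              \<le> 1 / 2 * \<rho> powr (- (p * s)) * M powr (p - 1)"
            by (intro mult_left_mono) auto
          moreover have "1 / 2 * \<rho> powr (- (p * s)) * (D powr (p * s) * (p * s / S * r powr (p * s) * \<Theta>))
              = p * s / (2 * S) / \<epsilon> powr (p * s) * \<Theta>"
            using D r \<epsilon> by (simp add: \<rho>_def powr_mult powr_minus_divide mult_ac)
          moreover have "?e * \<Theta> \<le> p * s / (2 * S) / \<epsilon> powr (p * s) * \<Theta>"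
          proof (intro mult_right_mono \<Theta>(2))
            have "?e * \<epsilon> powr (p * s) \<le> ?e * b" using \<epsilon>b by (intro mult_left_mono) auto
            also have "\<dots> = p * s / (2 * S)" by (simp add: b_def)
            finally show "?e \<le> p * s / (2 * S) / \<epsilon> powr (p * s)" using \<epsilon> by (subst pos_le_divide_eq) auto
          qed
          ultimately show "?e * \<Theta> \<le> 1 / 2 * \<rho> powr (- (p * s)) * M powr (p - 1)" by linarith
        qed
        finally show ?thesis .
      qed
      show "AE x in lborel. x \<in> ball z \<rho> \<longrightarrow> v x \<le> M"
        by (rule bound[OF dg \<rho> M(1) sub_z sub _ _ T_le]) (use I I_le in \<open>auto intro: ennreal_leI\<close>)
    qed
    let ?R = "restrict_space lebesgue (ball x0 r)"
    have u_meas: "(\<lambda>x. ereal (u x)) \<in> borel_measurable ?R"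
    proof -
      have "u \<in> borel_measurable lebesgue"
        using u by (simp add: weak_subsolution_def Yg_minus_space_def Y_space_def X_space_def)
      then show ?thesis by (intro measurable_restrict_space1) auto
    qed
    have "esssup ?R (\<lambda>x. ereal (u x)) \<le> ereal (\<delta> * \<tau> + C0 * \<delta> powr (- \<gamma>) * avg)"
    \<comment> \<open>\<open>bound\<close> requires \<open>M > 0\<close>, which the right-hand side
      misses when tail and average both vanish; an arbitrary \<open>e > 0\<close> is added and
      removed at the end.\<close>
    proof (rule ereal_le_epsilon2)
      fix e :: real assume e: "0 < e"
      let ?M = "\<delta> * \<tau> + C0 * \<delta> powr (- \<gamma>) * avg + e"
      have nn: "0 \<le> \<delta> * \<tau>" "0 \<le> C0 * \<delta> powr (- \<gamma>) * avg" using \<delta> \<tau> C0 avg by auto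
      have "AE x in lborel. x \<in> ball x0 r \<longrightarrow> v x \<le> ?M"
        by (rule aeM) (use nn e in linarith)+
      then have "AE x in lebesgue. x \<in> ball x0 r \<longrightarrow> v x \<le> ?M" by (rule AE_completion)
      with ae have "AE x in lebesgue. x \<in> ball x0 r \<longrightarrow> ereal (u x) \<le> ereal ?M"
        by eventually_elim simp
      then have "AE x in ?R. ereal (u x) \<le> ereal ?M" by (simp add: AE_restrict_space_iff)
      then have "esssup ?R (\<lambda>x. ereal (u x)) \<le> ereal ?M" using u_meas by (intro esssup_I)
      then show "esssup ?R (\<lambda>x. ereal (u x)) \<le> ereal (\<delta> * \<tau> + C0 * \<delta> powr (- \<gamma>) * avg) + ereal e" by simp
    qed
    then show "esssup ?R (\<lambda>x. ereal (u x))
         \<le> ereal (\<delta> * tail s p r (pos_part u) x0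
             + C0 * \<delta> powr (- ((p - 1) * real CARD('n) / (s * p\<^sup>2))) *
               ((LINT x:ball x0 (2 * r)|lebesgue. (pos_part u x) powr p)
                  / measure lebesgue (ball x0 (2 * r))) powr (1 / p))"
      unfolding \<tau>_def \<gamma>_def avg_def I_def vol_def .
  qed (rule C0)
qed

end
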